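(* Let $G$ be a group, $g\in G$, and let $(\mathcal B,\langle\!\langle-\rangle\!\rangle)$ be a shadowed bicategory equipped with $G$-twisting data. Let $M\in\mathcal B^{G\text{-tw}}(R,S)$ and $N\in\mathcal B^{G\text{-tw}}(U,T)$ be left dualizable 1-cells, with chosen left duals ${}^*M$ and ${}^*N$. Let $Q\in\mathcal B^{G\text{-tw}}(S,T)$, $P\in\mathcal B^{G\text{-tw}}(R,U)$, $K\in\mathcal B^{G\text{-tw}}(T,S)$ and $L\in\mathcal B^{G\text{-tw}}(U,R)$ be 1-cells, and let $$f\colon M\odot Q\Rightarrow P\odot N,\qquad h\colon N\odot K\Rightarrow L\odot M$$ be 2-cells. Suppressing associativity constraints, define $$F=(\mathrm{id}_L\odot f)\circ(h\odot\mathrm{id}_Q)\colon N\odot(K\odot Q)\Rightarrow(L\odot P)\odot N,$$ $$H=(\mathrm{id}_P\odot h)\circ(f\odot\mathrm{id}_K)\colon M\odot(Q\odot K)\Rightarrow(P\odot L)\odot M.$$ Then, as maps ${}^g\langle\!\langle K\odot Q\rangle\!\rangle_T\to{}^g\langle\!\langle P\odot L\rangle\!\rangle_R$, $${}^g\theta_{L,P}\circ\operatorname{tr}^g_{\mathcal B,N}(F)=\operatorname{tr}^g_{\mathcal B,M}(H)\circ{}^g\theta_{K,Q},$$ where $\operatorname{tr}^g_{\mathcal B,N}$ and $\operatorname{tr}^g_{\mathcal B,M}$ denote the $g$-twisted traces formed with respect to the left dualizable 1-cells $N$ and $M$.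
   Context: **Bicategories.** For 1-cells $M\colon A\to B$, $N\colon B\to C$ the horizontal composite is written $M\odot N\colon A\to C$ (first $M$, then $N$); $U_A$ is the unit 1-cell; associators and unitors $\mathfrak a,\mathfrak l,\mathfrak r$ are suppressed where harmless. $\mathrm{Pic}_{\mathcal B}(A)$ is the monoidal groupoid (under $\odot$) of invertible 1-cells $A\to A$ and invertible 2-cells. **$G$-twisting data**: for each 0-cell $A$ a strong monoidal functor $\Theta_A\colon G\to\mathrm{Pic}_{\mathcal B}(A)$ with structure 2-cells $\mu^A_{g,h}\colon\Theta_A(g)\odot\Theta_A(h)\Rightarrow\Theta_A(gh)$, $\eta^A\colon U_A\Rightarrow\Theta_A(e)$. For $M\colon A\to B$: ${}^gM=\Theta_A(g^{-1})\odot M$, $M^g=M\odot\Theta_B(g)$; ${}^gf=\mathrm{id}\odot f$ for a 2-cell $f$. **Bicategory of $G$-twists $\mathcal B^{G\text{-tw}}$.** Same 0-cells. A 1-cell $A\to B$ is $(M,\tau)$ with $M\colon A\to B$ in $\mathcal B$ and invertible 2-cells $\tau_g\colon\Theta_A(g)\odot M\Rightarrow M\odot\Theta_B(g)$, $g\in G$, such that $\tau_e$ is the canonical isomorphism given by $\eta^A,\eta^B$ and unitors, and $\tau_{gh}=(\mathrm{id}_M\odot\mu^B_{g,h})(\tau_g\odot\mathrm{id})(\mathrm{id}\odot\tau_h)((\mu^A_{g,h})^{-1}\odot\mathrm{id}_M)$. A 2-cell $(M,\tau)\Rightarrow(N,\sigma)$ is a 2-cell $f\colon M\Rightarrow N$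 with $\sigma_g(\mathrm{id}\odot f)=(f\odot\mathrm{id})\tau_g$ for all $g$. Composite: $(M\odot N,\tau\star\sigma)$, $(\tau\star\sigma)_g=(\mathrm{id}_M\odot\sigma_g)(\tau_g\odot\mathrm{id}_N)$. Unit: $U_A$ with $\mathfrak l^{-1}\mathfrak r$. Transport map: $g_M=(\tau_{g^{-1}})^{-1}\colon M^{g^{-1}}\Rightarrow{}^gM$. **Shadows.** A shadow on $\mathcal B$ with values in a category $\mathcal T$ is a family of functors $\langle\!\langle-\rangle\!\rangle_R\colon\mathcal B(R,R)\to\mathcal T$ with natural isomorphisms $\theta_{M,N}\colon\langle\!\langle M\odot N\rangle\!\rangle_R\cong\langle\!\langle N\odot M\rangle\!\rangle_S$ ($M\colon R\to S$, $N\colon S\to R$) such that, up to associators, $\theta_{M\odot N,P}=\theta_{N,P\odot M}\circ\theta_{M,N\odot P}$, and $\langle\!\langle\mathfrak l\rangle\!\rangle\circ\theta_{M,U_R}=\langle\!\langle\mathfrak r\rangle\!\rangle$, $\langle\!\langle\mathfrak r\rangle\!\rangle\circ\theta_{U_R,M}=\langle\!\langle\mathfrak l\rangle\!\rangle$. **Twisted shadow.** ${}^g\langle\!\langle(M,\tau)\rangle\!\rangle_R=\langle\!\langle{}^gM\rangle\!\rangle_R$, ${}^g\langle\!\langle f\rangle\!\rangle=\langle\!\langle{}^gf\rangle\!\rangle$. Twisted cyclicity ${}^g\theta_{M,N}$: $\langle\!\langle\Theta_R(g^{-1})\odot M\odot N\rangle\!\rangle_R\xrightarrow{\theta}\langle\!\langle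 N\odot\Theta_R(g^{-1})\odot M\rangle\!\rangle_S\xrightarrow{g_N\odot\mathrm{id}}\langle\!\langle\Theta_S(g^{-1})\odot N\odot M\rangle\!\rangle_S$. **Twisted trace.** $M\colon R\to S$ is left dualizable with left dual ${}^*M\colon S\to R$ if there are 2-cells $\bar\eta\colon U_S\Rightarrow{}^*M\odot M$, $\bar\epsilon\colon M\odot{}^*M\Rightarrow U_R$ (in $\mathcal B^{G\text{-tw}}$) satisfying the triangle identities. For $X\colon S\to S$, $Y\colon R\to R$ and $f\colon M\odot X\Rightarrow Y\odot M$, $\operatorname{tr}^g(f)=\operatorname{tr}^g_{\mathcal B,M}(f)\colon{}^g\langle\!\langle X\rangle\!\rangle_S\to{}^g\langle\!\langle Y\rangle\!\rangle_R$ is ${}^g\langle\!\langle X\rangle\!\rangle\xrightarrow{\bar\eta\odot\mathrm{id}}{}^g\langle\!\langle{}^*M\odot M\odot X\rangle\!\rangle\xrightarrow{\mathrm{id}\odot f}{}^g\langle\!\langle{}^*M\odot Y\odot M\rangle\!\rangle\xrightarrow{{}^g\theta_{{}^*M\odot Y,M}}{}^g\langle\!\langle M\odot{}^*M\odot Y\rangle\!\rangle\xrightarrow{\bar\epsilon\odot\mathrm{id}}{}^g\langle\!\langle Y\rangle\!\rangle$. *)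

theory Defs
  imports "HOL-Algebra.Group"
begin

section \<open>Bicategories\<close>

text \<open>
  Horizontal composition is written in diagrammatic order: for \<open>M : A \<rightarrow> B\<close> and \<open>N : B \<rightarrow> C\<close> the
  composite \<open>M \<odot> N : A \<rightarrow> C\<close> is first \<open>M\<close>, then \<open>N\<close>; \<open>f \<odot>\<odot> k\<close> is the horizontal composite of
  2-cells. Vertical composition \<open>k \<cdot> f\<close> is in the usual order (\<open>k\<close> after \<open>f\<close>).
  All operations are total functions whose values are relevant only on composable arguments.
\<close>

record ('o, 'm, 'c) bicat =
  cells0 :: "'o set"
  cells1 :: "'m set"
  src :: "'m \<Rightarrow> 'o"
  trg :: "'m \<Rightarrow> 'o"
  cells2 :: "'c set"
  dom2 :: "'c \<Rightarrow> 'm"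
  cod2 :: "'c \<Rightarrow> 'm"
  id2 :: "'m \<Rightarrow> 'c"
  vcomp :: "'c \<Rightarrow> 'c \<Rightarrow> 'c"  (infixr "\<cdot>\<index>" 65)
  unit1 :: "'o \<Rightarrow> 'm"
  hcomp1 :: "'m \<Rightarrow> 'm \<Rightarrow> 'm"  ("(_ \<odot>\<index> _)" [71, 71] 70)
  hcomp2 :: "'c \<Rightarrow> 'c \<Rightarrow> 'c"  ("(_ \<odot>\<odot>\<index> _)" [71, 71] 70)
  assoc :: "'m \<Rightarrow> 'm \<Rightarrow> 'm \<Rightarrow> 'c"
  lunit :: "'m \<Rightarrow> 'c"
  runit :: "'m \<Rightarrow> 'c"

definition hom1 :: "('o, 'm, 'c) bicat \<Rightarrow> 'o \<Rightarrow> 'o \<Rightarrow> 'm set" where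
  "hom1 \<B> A B = {M \<in> cells1 \<B>. src \<B> M = A \<and> trg \<B> M = B}"

definition hom2 :: "('o, 'm, 'c) bicat \<Rightarrow> 'm \<Rightarrow> 'm \<Rightarrow> 'c set" where
  "hom2 \<B> M N = {f \<in> cells2 \<B>. dom2 \<B> f = M \<and> cod2 \<B> f = N}"

definition inverse2 :: "('o, 'm, 'c) bicat \<Rightarrow> 'c \<Rightarrow> 'c \<Rightarrow> bool" where
  "inverse2 \<B> f k \<longleftrightarrow>
     f \<in> cells2 \<B> \<and> k \<in> hom2 \<B> (cod2 \<B> f) (dom2 \<B> f) \<and>
     k \<cdot>\<^bsub>\<B>\<^esub> f = id2 \<B> (dom2 \<B> f) \<and> f \<cdot>\<^bsub>\<B>\<^esub> k = id2 \<B> (cod2 \<B> f)"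

definition iso2 :: "('o, 'm, 'c) bicat \<Rightarrow> 'c \<Rightarrow> bool" where
  "iso2 \<B> f \<longleftrightarrow> (\<exists>k. inverse2 \<B> f k)"

definition inv2 :: "('o, 'm, 'c) bicat \<Rightarrow> 'c \<Rightarrow> 'c" where
  "inv2 \<B> f = (THE k. inverse2 \<B> f k)"

definition invertible1 :: "('o, 'm, 'c) bicat \<Rightarrow> 'm \<Rightarrow> bool" where
  "invertible1 \<B> M \<longleftrightarrow>
     M \<in> cells1 \<B> \<and>
     (\<exists>N \<in> hom1 \<B> (trg \<B> M) (src \<B> M).
       (\<exists>f \<in> hom2 \<B> (M \<odot>\<^bsub>\<B>\<^esub> N) (unit1 \<B> (src \<B> M)). iso2 \<B> f) \<and>
       (\<exists>f \<in> hom2 \<B> (N \<odot>\<^bsub>\<B>\<^esub> M) (unit1 \<B> (trg \<B> M)). iso2 \<B> f))"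

locale bicategory =
  fixes \<B> :: "('o, 'm, 'c) bicat" (structure)
  assumes src_closed: "M \<in> cells1 \<B> \<Longrightarrow> src \<B> M \<in> cells0 \<B>"
    and trg_closed: "M \<in> cells1 \<B> \<Longrightarrow> trg \<B> M \<in> cells0 \<B>"
    and dom2_closed: "f \<in> cells2 \<B> \<Longrightarrow> dom2 \<B> f \<in> cells1 \<B>"
    and cod2_closed: "f \<in> cells2 \<B> \<Longrightarrow> cod2 \<B> f \<in> cells1 \<B>"
    and parallel_src: "f \<in> cells2 \<B> \<Longrightarrow> src \<B> (dom2 \<B> f) = src \<B> (cod2 \<B> f)"
    and parallel_trg: "f \<in> cells2 \<B> \<Longrightarrow> trg \<B> (dom2 \<B> f) = trg \<B> (cod2 \<B> f)"
    \<comment> \<open>the categories \<open>\<B>(A, B)\<close>\<close>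
    and id2_in: "M \<in> cells1 \<B> \<Longrightarrow> id2 \<B> M \<in> hom2 \<B> M M"
    and vcomp_in: "\<lbrakk>f \<in> hom2 \<B> M N; k \<in> hom2 \<B> N P\<rbrakk> \<Longrightarrow> k \<cdot> f \<in> hom2 \<B> M P"
    and vcomp_id_left: "f \<in> hom2 \<B> M N \<Longrightarrow> id2 \<B> N \<cdot> f = f"
    and vcomp_id_right: "f \<in> hom2 \<B> M N \<Longrightarrow> f \<cdot> id2 \<B> M = f"
    and vcomp_assoc: "\<lbrakk>f \<in> hom2 \<B> M N; k \<in> hom2 \<B> N P; j \<in> hom2 \<B> P Q\<rbrakk>
      \<Longrightarrow> (j \<cdot> k) \<cdot> f = j \<cdot> (k \<cdot> f)"
    \<comment> \<open>units and the horizontal composition functors\<close>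
    and unit1_in: "A \<in> cells0 \<B> \<Longrightarrow> unit1 \<B> A \<in> hom1 \<B> A A"
    and hcomp1_in: "\<lbrakk>M \<in> hom1 \<B> A B; N \<in> hom1 \<B> B C\<rbrakk> \<Longrightarrow> M \<odot> N \<in> hom1 \<B> A C"
    and hcomp2_in: "\<lbrakk>M \<in> hom1 \<B> A B; N \<in> hom1 \<B> B C; f \<in> hom2 \<B> M M'; k \<in> hom2 \<B> N N'\<rbrakk>
      \<Longrightarrow> f \<odot>\<odot> k \<in> hom2 \<B> (M \<odot> N) (M' \<odot> N')"
    and hcomp2_id: "\<lbrakk>M \<in> hom1 \<B> A B; N \<in> hom1 \<B> B C\<rbrakk>
      \<Longrightarrow> id2 \<B> M \<odot>\<odot> id2 \<B> N = id2 \<B> (M \<odot> N)"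
    and interchange: "\<lbrakk>M \<in> hom1 \<B> A B; N \<in> hom1 \<B> B C;
        f \<in> hom2 \<B> M M'; f' \<in> hom2 \<B> M' M''; k \<in> hom2 \<B> N N'; k' \<in> hom2 \<B> N' N''\<rbrakk>
      \<Longrightarrow> (f' \<cdot> f) \<odot>\<odot> (k' \<cdot> k) = (f' \<odot>\<odot> k') \<cdot> (f \<odot>\<odot> k)"
    \<comment> \<open>associators and unitors\<close>
    and assoc_in: "\<lbrakk>M \<in> hom1 \<B> A B; N \<in> hom1 \<B> B C; P \<in> hom1 \<B> C D\<rbrakk>
      \<Longrightarrow> assoc \<B> M N P \<in> hom2 \<B> ((M \<odot> N) \<odot> P) (M \<odot> (N \<odot> P))"
    and assoc_iso: "\<lbrakk>M \<in> hom1 \<B> A B; N \<in> hom1 \<B> B C; P \<in> hom1 \<B> C D\<rbrakk>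
      \<Longrightarrow> iso2 \<B> (assoc \<B> M N P)"
    and assoc_natural: "\<lbrakk>M \<in> hom1 \<B> A B; N \<in> hom1 \<B> B C; P \<in> hom1 \<B> C D;
        f \<in> hom2 \<B> M M'; k \<in> hom2 \<B> N N'; j \<in> hom2 \<B> P P'\<rbrakk>
      \<Longrightarrow> assoc \<B> M' N' P' \<cdot> ((f \<odot>\<odot> k) \<odot>\<odot> j) = (f \<odot>\<odot> (k \<odot>\<odot> j)) \<cdot> assoc \<B> M N P"
    and lunit_in: "M \<in> hom1 \<B> A B \<Longrightarrow> lunit \<B> M \<in> hom2 \<B> (unit1 \<B> A \<odot> M) M"
    and lunit_iso: "M \<in> cells1 \<B> \<Longrightarrow> iso2 \<B> (lunit \<B> M)"
    and lunit_natural: "\<lbrakk>M \<in> hom1 \<B> A B; f \<in> hom2 \<B> M M'\<rbrakk>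
      \<Longrightarrow> lunit \<B> M' \<cdot> (id2 \<B> (unit1 \<B> A) \<odot>\<odot> f) = f \<cdot> lunit \<B> M"
    and runit_in: "M \<in> hom1 \<B> A B \<Longrightarrow> runit \<B> M \<in> hom2 \<B> (M \<odot> unit1 \<B> B) M"
    and runit_iso: "M \<in> cells1 \<B> \<Longrightarrow> iso2 \<B> (runit \<B> M)"
    and runit_natural: "\<lbrakk>M \<in> hom1 \<B> A B; f \<in> hom2 \<B> M M'\<rbrakk>
      \<Longrightarrow> runit \<B> M' \<cdot> (f \<odot>\<odot> id2 \<B> (unit1 \<B> B)) = f \<cdot> runit \<B> M"
    and pentagon: "\<lbrakk>M \<in> hom1 \<B> A B; N \<in> hom1 \<B> B C; P \<in> hom1 \<B> C D; Q \<in> hom1 \<B> D E\<rbrakk>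
      \<Longrightarrow> (id2 \<B> M \<odot>\<odot> assoc \<B> N P Q) \<cdot> assoc \<B> M (N \<odot> P) Q \<cdot> (assoc \<B> M N P \<odot>\<odot> id2 \<B> Q)
        = assoc \<B> M N (P \<odot> Q) \<cdot> assoc \<B> (M \<odot> N) P Q"
    and triangle: "\<lbrakk>M \<in> hom1 \<B> A B; N \<in> hom1 \<B> B C\<rbrakk>
      \<Longrightarrow> (id2 \<B> M \<odot>\<odot> lunit \<B> N) \<cdot> assoc \<B> M (unit1 \<B> B) N = runit \<B> M \<odot>\<odot> id2 \<B> N"

text \<open>\<open>D\<close> is a left dual of \<open>M\<close> with coevaluation \<open>\<eta>\<close> and evaluation \<open>\<epsilon>\<close>.\<close>

definition left_dual :: "('o, 'm, 'c) bicat \<Rightarrow> 'm \<Rightarrow> 'm \<Rightarrow> 'c \<Rightarrow> 'c \<Rightarrow> bool" where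
  "left_dual \<B> M D \<eta> \<epsilon> \<longleftrightarrow>
     M \<in> cells1 \<B> \<and>
     D \<in> hom1 \<B> (trg \<B> M) (src \<B> M) \<and>
     \<eta> \<in> hom2 \<B> (unit1 \<B> (trg \<B> M)) (D \<odot>\<^bsub>\<B>\<^esub> M) \<and>
     \<epsilon> \<in> hom2 \<B> (M \<odot>\<^bsub>\<B>\<^esub> D) (unit1 \<B> (src \<B> M)) \<and>
     lunit \<B> M \<cdot>\<^bsub>\<B>\<^esub> (\<epsilon> \<odot>\<odot>\<^bsub>\<B>\<^esub> id2 \<B> M) \<cdot>\<^bsub>\<B>\<^esub> inv2 \<B> (assoc \<B> M D M)
       \<cdot>\<^bsub>\<B>\<^esub> (id2 \<B> M \<odot>\<odot>\<^bsub>\<B>\<^esub> \<eta>) \<cdot>\<^bsub>\<B>\<^esub> inv2 \<B> (runit \<B> M) = id2 \<B> M \<and>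
     runit \<B> D \<cdot>\<^bsub>\<B>\<^esub> (id2 \<B> D \<odot>\<odot>\<^bsub>\<B>\<^esub> \<epsilon>) \<cdot>\<^bsub>\<B>\<^esub> assoc \<B> D M D
       \<cdot>\<^bsub>\<B>\<^esub> (\<eta> \<odot>\<odot>\<^bsub>\<B>\<^esub> id2 \<B> D) \<cdot>\<^bsub>\<B>\<^esub> inv2 \<B> (lunit \<B> D) = id2 \<B> D"


section \<open>Categories and shadows\<close>

record ('x, 'a) cat =
  objs :: "'x set"
  arrs :: "'a set"
  Dom :: "'a \<Rightarrow> 'x"
  Cod :: "'a \<Rightarrow> 'x"
  Id :: "'x \<Rightarrow> 'a"
  Comp :: "'a \<Rightarrow> 'a \<Rightarrow> 'a"  (infixr "\<bullet>\<index>" 65)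

definition homs :: "('x, 'a) cat \<Rightarrow> 'x \<Rightarrow> 'x \<Rightarrow> 'a set" where
  "homs \<T> x y = {f \<in> arrs \<T>. Dom \<T> f = x \<and> Cod \<T> f = y}"

definition is_iso :: "('x, 'a) cat \<Rightarrow> 'a \<Rightarrow> bool" where
  "is_iso \<T> f \<longleftrightarrow>
     f \<in> arrs \<T> \<and>
     (\<exists>k \<in> homs \<T> (Cod \<T> f) (Dom \<T> f).
       k \<bullet>\<^bsub>\<T>\<^esub> f = Id \<T> (Dom \<T> f) \<and> f \<bullet>\<^bsub>\<T>\<^esub> k = Id \<T> (Cod \<T> f))"

locale category =
  fixes \<T> :: "('x, 'a) cat" (structure)
  assumes Dom_closed: "f \<in> arrs \<T> \<Longrightarrow> Dom \<T> f \<in> objs \<T>"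
    and Cod_closed: "f \<in> arrs \<T> \<Longrightarrow> Cod \<T> f \<in> objs \<T>"
    and Id_in: "x \<in> objs \<T> \<Longrightarrow> Id \<T> x \<in> homs \<T> x x"
    and Comp_in: "\<lbrakk>f \<in> homs \<T> x y; k \<in> homs \<T> y z\<rbrakk> \<Longrightarrow> k \<bullet> f \<in> homs \<T> x z"
    and Comp_Id_left: "f \<in> homs \<T> x y \<Longrightarrow> Id \<T> y \<bullet> f = f"
    and Comp_Id_right: "f \<in> homs \<T> x y \<Longrightarrow> f \<bullet> Id \<T> x = f"
    and Comp_assoc: "\<lbrakk>f \<in> homs \<T> w x; k \<in> homs \<T> x y; j \<in> homs \<T> y z\<rbrakk>
      \<Longrightarrow> (j \<bullet> k) \<bullet> f = j \<bullet> (k \<bullet> f)"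

text \<open>
  The functors \<open>\<langle>\<langle>-\<rangle>\<rangle>\<^sub>R : \<B>(R, R) \<rightarrow> \<T>\<close> are given by \<open>sh0\<close> on 1-cells and \<open>sh1\<close> on 2-cells; the index
  \<open>R\<close> is determined by the argument.
\<close>

record ('m, 'c, 'x, 'a) shadow_data =
  sh0 :: "'m \<Rightarrow> 'x"
  sh1 :: "'c \<Rightarrow> 'a"
  cyc :: "'m \<Rightarrow> 'm \<Rightarrow> 'a"

locale shadowed_bicategory = bicategory \<B> + category \<T>
  for \<B> :: "('o, 'm, 'c) bicat" (structure)
    and \<T> :: "('x, 'a) cat" +
  fixes Sh :: "('m, 'c, 'x, 'a) shadow_data"
  assumes sh0_in: "M \<in> hom1 \<B> R R \<Longrightarrow> sh0 Sh M \<in> objs \<T>"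
    and sh1_in: "\<lbrakk>M \<in> hom1 \<B> R R; f \<in> hom2 \<B> M N\<rbrakk>
      \<Longrightarrow> sh1 Sh f \<in> homs \<T> (sh0 Sh M) (sh0 Sh N)"
    and sh1_id: "M \<in> hom1 \<B> R R \<Longrightarrow> sh1 Sh (id2 \<B> M) = Id \<T> (sh0 Sh M)"
    and sh1_comp: "\<lbrakk>M \<in> hom1 \<B> R R; f \<in> hom2 \<B> M N; k \<in> hom2 \<B> N P\<rbrakk>
      \<Longrightarrow> sh1 Sh (k \<cdot> f) = sh1 Sh k \<bullet>\<^bsub>\<T>\<^esub> sh1 Sh f"
    and cyc_in: "\<lbrakk>M \<in> hom1 \<B> R S; N \<in> hom1 \<B> S R\<rbrakk>
      \<Longrightarrow> cyc Sh M N \<in> homs \<T> (sh0 Sh (M \<odot> N)) (sh0 Sh (N \<odot> M))"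
    and cyc_iso: "\<lbrakk>M \<in> hom1 \<B> R S; N \<in> hom1 \<B> S R\<rbrakk> \<Longrightarrow> is_iso \<T> (cyc Sh M N)"
    and cyc_natural: "\<lbrakk>M \<in> hom1 \<B> R S; N \<in> hom1 \<B> S R; f \<in> hom2 \<B> M M'; k \<in> hom2 \<B> N N'\<rbrakk>
      \<Longrightarrow> cyc Sh M' N' \<bullet>\<^bsub>\<T>\<^esub> sh1 Sh (f \<odot>\<odot> k) = sh1 Sh (k \<odot>\<odot> f) \<bullet>\<^bsub>\<T>\<^esub> cyc Sh M N"
    and cyc_hcomp: "\<lbrakk>M \<in> hom1 \<B> A B; N \<in> hom1 \<B> B C; P \<in> hom1 \<B> C A\<rbrakk>
      \<Longrightarrow> cyc Sh (M \<odot> N) P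
        = sh1 Sh (assoc \<B> P M N) \<bullet>\<^bsub>\<T>\<^esub> cyc Sh N (P \<odot> M) \<bullet>\<^bsub>\<T>\<^esub> sh1 Sh (assoc \<B> N P M)
          \<bullet>\<^bsub>\<T>\<^esub> cyc Sh M (N \<odot> P) \<bullet>\<^bsub>\<T>\<^esub> sh1 Sh (assoc \<B> M N P)"
    and cyc_unit_right: "M \<in> hom1 \<B> R R
      \<Longrightarrow> sh1 Sh (lunit \<B> M) \<bullet>\<^bsub>\<T>\<^esub> cyc Sh M (unit1 \<B> R) = sh1 Sh (runit \<B> M)"
    and cyc_unit_left: "M \<in> hom1 \<B> R R
      \<Longrightarrow> sh1 Sh (runit \<B> M) \<bullet>\<^bsub>\<T>\<^esub> cyc Sh (unit1 \<B> R) M = sh1 Sh (lunit \<B> M)"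


section \<open>Twisting data\<close>

record ('g, 'o, 'm, 'c) twist_data =
  Tw :: "'o \<Rightarrow> 'g \<Rightarrow> 'm"
  mu :: "'o \<Rightarrow> 'g \<Rightarrow> 'g \<Rightarrow> 'c"
  eta :: "'o \<Rightarrow> 'c"

text \<open>
  For each 0-cell \<open>A\<close>, \<open>(Tw \<Theta> A, mu \<Theta> A, eta \<Theta> A)\<close> is a strong monoidal functor from \<open>G\<close>, viewed as
  a discrete monoidal category, to the monoidal groupoid of invertible 1-cells \<open>A \<rightarrow> A\<close> and
  invertible 2-cells. Since \<open>G\<close> is discrete, functoriality and naturality of \<open>mu\<close> are automatic.
\<close>

locale twisted_bicategory = group G + bicategory \<B>
  for G :: "('g, 'e) monoid_scheme"
    and \<B> :: "('o, 'm, 'c) bicat" (structure) +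
  fixes \<Theta> :: "('g, 'o, 'm, 'c) twist_data"
  assumes Tw_in: "\<lbrakk>A \<in> cells0 \<B>; g \<in> carrier G\<rbrakk> \<Longrightarrow> Tw \<Theta> A g \<in> hom1 \<B> A A"
    and Tw_invertible: "\<lbrakk>A \<in> cells0 \<B>; g \<in> carrier G\<rbrakk> \<Longrightarrow> invertible1 \<B> (Tw \<Theta> A g)"
    and mu_in: "\<lbrakk>A \<in> cells0 \<B>; g \<in> carrier G; h \<in> carrier G\<rbrakk>
      \<Longrightarrow> mu \<Theta> A g h \<in> hom2 \<B> (Tw \<Theta> A g \<odot> Tw \<Theta> A h) (Tw \<Theta> A (g \<otimes>\<^bsub>G\<^esub> h))"
    and mu_iso: "\<lbrakk>A \<in> cells0 \<B>; g \<in> carrier G; h \<in> carrier G\<rbrakk> \<Longrightarrow> iso2 \<B> (mu \<Theta> A g h)"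
    and eta_in: "A \<in> cells0 \<B> \<Longrightarrow> eta \<Theta> A \<in> hom2 \<B> (unit1 \<B> A) (Tw \<Theta> A \<one>\<^bsub>G\<^esub>)"
    and eta_iso: "A \<in> cells0 \<B> \<Longrightarrow> iso2 \<B> (eta \<Theta> A)"
    and mu_assoc: "\<lbrakk>A \<in> cells0 \<B>; g \<in> carrier G; h \<in> carrier G; k \<in> carrier G\<rbrakk>
      \<Longrightarrow> mu \<Theta> A (g \<otimes>\<^bsub>G\<^esub> h) k \<cdot> (mu \<Theta> A g h \<odot>\<odot> id2 \<B> (Tw \<Theta> A k))
        = mu \<Theta> A g (h \<otimes>\<^bsub>G\<^esub> k) \<cdot> (id2 \<B> (Tw \<Theta> A g) \<odot>\<odot> mu \<Theta> A h k)
          \<cdot> assoc \<B> (Tw \<Theta> A g) (Tw \<Theta> A h) (Tw \<Theta> A k)"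
    and mu_eta_left: "\<lbrakk>A \<in> cells0 \<B>; g \<in> carrier G\<rbrakk>
      \<Longrightarrow> mu \<Theta> A \<one>\<^bsub>G\<^esub> g \<cdot> (eta \<Theta> A \<odot>\<odot> id2 \<B> (Tw \<Theta> A g)) = lunit \<B> (Tw \<Theta> A g)"
    and mu_eta_right: "\<lbrakk>A \<in> cells0 \<B>; g \<in> carrier G\<rbrakk>
      \<Longrightarrow> mu \<Theta> A g \<one>\<^bsub>G\<^esub> \<cdot> (id2 \<B> (Tw \<Theta> A g) \<odot>\<odot> eta \<Theta> A) = runit \<B> (Tw \<Theta> A g)"


section \<open>The bicategory of twists\<close>

text \<open>
  The same 2-cell of \<open>\<B>\<close> may be a 2-cell between several pairs of twisted 1-cells, so a 2-cell of
  the bicategory of twists records its domain and codomain. The families \<open>\<tau>\<close> are indexed by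
  \<open>carrier G\<close>, hence extensional there.
\<close>

datatype ('g, 'm, 'c) tw1 = Tw1 (und1: 'm) (tau: "'g \<Rightarrow> 'c")

datatype ('g, 'm, 'c) tw2 = Tw2 (tdom: "('g, 'm, 'c) tw1") (und2: 'c) (tcod: "('g, 'm, 'c) tw1")

definition twist_cells1 ::
  "('g, 'e) monoid_scheme \<Rightarrow> ('o, 'm, 'c) bicat \<Rightarrow> ('g, 'o, 'm, 'c) twist_data \<Rightarrow> ('g, 'm, 'c) tw1 set"
  where
  "twist_cells1 G \<B> \<Theta> = {Tw1 M \<tau> | M \<tau>.
     M \<in> cells1 \<B> \<and> \<tau> \<in> extensional (carrier G) \<and>
     (\<forall>g \<in> carrier G.
        \<tau> g \<in> hom2 \<B> (Tw \<Theta> (src \<B> M) g \<odot>\<^bsub>\<B>\<^esub> M) (M \<odot>\<^bsub>\<B>\<^esub> Tw \<Theta> (trg \<B> M) g) \<and> iso2 \<B> (\<tau> g)) \<and>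
     \<tau> \<one>\<^bsub>G\<^esub> = (id2 \<B> M \<odot>\<odot>\<^bsub>\<B>\<^esub> eta \<Theta> (trg \<B> M)) \<cdot>\<^bsub>\<B>\<^esub> inv2 \<B> (runit \<B> M)
       \<cdot>\<^bsub>\<B>\<^esub> lunit \<B> M \<cdot>\<^bsub>\<B>\<^esub> (inv2 \<B> (eta \<Theta> (src \<B> M)) \<odot>\<odot>\<^bsub>\<B>\<^esub> id2 \<B> M) \<and>
     (\<forall>g \<in> carrier G. \<forall>h \<in> carrier G.
        \<tau> (g \<otimes>\<^bsub>G\<^esub> h)
        = (id2 \<B> M \<odot>\<odot>\<^bsub>\<B>\<^esub> mu \<Theta> (trg \<B> M) g h)
          \<cdot>\<^bsub>\<B>\<^esub> assoc \<B> M (Tw \<Theta> (trg \<B> M) g) (Tw \<Theta> (trg \<B> M) h)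
          \<cdot>\<^bsub>\<B>\<^esub> (\<tau> g \<odot>\<odot>\<^bsub>\<B>\<^esub> id2 \<B> (Tw \<Theta> (trg \<B> M) h))
          \<cdot>\<^bsub>\<B>\<^esub> inv2 \<B> (assoc \<B> (Tw \<Theta> (src \<B> M) g) M (Tw \<Theta> (trg \<B> M) h))
          \<cdot>\<^bsub>\<B>\<^esub> (id2 \<B> (Tw \<Theta> (src \<B> M) g) \<odot>\<odot>\<^bsub>\<B>\<^esub> \<tau> h)
          \<cdot>\<^bsub>\<B>\<^esub> assoc \<B> (Tw \<Theta> (src \<B> M) g) (Tw \<Theta> (src \<B> M) h) M
          \<cdot>\<^bsub>\<B>\<^esub> (inv2 \<B> (mu \<Theta> (src \<B> M) g h) \<odot>\<odot>\<^bsub>\<B>\<^esub> id2 \<B> M))}"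

definition twist_cells2 ::
  "('g, 'e) monoid_scheme \<Rightarrow> ('o, 'm, 'c) bicat \<Rightarrow> ('g, 'o, 'm, 'c) twist_data \<Rightarrow> ('g, 'm, 'c) tw2 set"
  where
  "twist_cells2 G \<B> \<Theta> = {Tw2 (Tw1 M \<tau>) f (Tw1 N \<sigma>) | M \<tau> f N \<sigma>.
     Tw1 M \<tau> \<in> twist_cells1 G \<B> \<Theta> \<and> Tw1 N \<sigma> \<in> twist_cells1 G \<B> \<Theta> \<and> f \<in> hom2 \<B> M N \<and>
     (\<forall>g \<in> carrier G.
        \<sigma> g \<cdot>\<^bsub>\<B>\<^esub> (id2 \<B> (Tw \<Theta> (src \<B> M) g) \<odot>\<odot>\<^bsub>\<B>\<^esub> f)
        = (f \<odot>\<odot>\<^bsub>\<B>\<^esub> id2 \<B> (Tw \<Theta> (trg \<B> M) g)) \<cdot>\<^bsub>\<B>\<^esub> \<tau> g)}"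

definition twist_unit ::
  "('g, 'e) monoid_scheme \<Rightarrow> ('o, 'm, 'c) bicat \<Rightarrow> ('g, 'o, 'm, 'c) twist_data
    \<Rightarrow> 'o \<Rightarrow> ('g, 'm, 'c) tw1" where
  "twist_unit G \<B> \<Theta> A =
     Tw1 (unit1 \<B> A)
         (\<lambda>g \<in> carrier G. inv2 \<B> (lunit \<B> (Tw \<Theta> A g)) \<cdot>\<^bsub>\<B>\<^esub> runit \<B> (Tw \<Theta> A g))"

definition twist_hcomp ::
  "('g, 'e) monoid_scheme \<Rightarrow> ('o, 'm, 'c) bicat \<Rightarrow> ('g, 'o, 'm, 'c) twist_data
    \<Rightarrow> ('g, 'm, 'c) tw1 \<Rightarrow> ('g, 'm, 'c) tw1 \<Rightarrow> ('g, 'm, 'c) tw1" where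
  "twist_hcomp G \<B> \<Theta> X Y =
     (let M = und1 X; \<tau> = tau X; N = und1 Y; \<sigma> = tau Y;
          A = src \<B> M; B = trg \<B> M; C = trg \<B> N in
      Tw1 (M \<odot>\<^bsub>\<B>\<^esub> N)
          (\<lambda>g \<in> carrier G.
             inv2 \<B> (assoc \<B> M N (Tw \<Theta> C g))
             \<cdot>\<^bsub>\<B>\<^esub> (id2 \<B> M \<odot>\<odot>\<^bsub>\<B>\<^esub> \<sigma> g)
             \<cdot>\<^bsub>\<B>\<^esub> assoc \<B> M (Tw \<Theta> B g) N
             \<cdot>\<^bsub>\<B>\<^esub> (\<tau> g \<odot>\<odot>\<^bsub>\<B>\<^esub> id2 \<B> N)
             \<cdot>\<^bsub>\<B>\<^esub> inv2 \<B> (assoc \<B> (Tw \<Theta> A g) M N)))"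

definition twist_bicat ::
  "('g, 'e) monoid_scheme \<Rightarrow> ('o, 'm, 'c) bicat \<Rightarrow> ('g, 'o, 'm, 'c) twist_data
    \<Rightarrow> ('o, ('g, 'm, 'c) tw1, ('g, 'm, 'c) tw2) bicat" where
  "twist_bicat G \<B> \<Theta> =
     (let hc = twist_hcomp G \<B> \<Theta>; u = twist_unit G \<B> \<Theta> in
      \<lparr> cells0 = cells0 \<B>,
        cells1 = twist_cells1 G \<B> \<Theta>,
        src = (\<lambda>X. src \<B> (und1 X)),
        trg = (\<lambda>X. trg \<B> (und1 X)),
        cells2 = twist_cells2 G \<B> \<Theta>,
        dom2 = tdom,
        cod2 = tcod,
        id2 = (\<lambda>X. Tw2 X (id2 \<B> (und1 X)) X),
        vcomp = (\<lambda>k f. Tw2 (tdom f) (und2 k \<cdot>\<^bsub>\<B>\<^esub> und2 f) (tcod k)),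
        unit1 = u,
        hcomp1 = hc,
        hcomp2 = (\<lambda>f k. Tw2 (hc (tdom f) (tdom k)) (und2 f \<odot>\<odot>\<^bsub>\<B>\<^esub> und2 k) (hc (tcod f) (tcod k))),
        assoc = (\<lambda>X Y Z. Tw2 (hc (hc X Y) Z) (assoc \<B> (und1 X) (und1 Y) (und1 Z)) (hc X (hc Y Z))),
        lunit = (\<lambda>X. Tw2 (hc (u (src \<B> (und1 X))) X) (lunit \<B> (und1 X)) X),
        runit = (\<lambda>X. Tw2 (hc X (u (trg \<B> (und1 X)))) (runit \<B> (und1 X)) X) \<rparr>)"


section \<open>Twisted shadow and twisted trace\<close>

text \<open>The transport map \<open>g\<^sub>M : M\<^bsup>g\<inverse>\<^esup> \<Rightarrow> \<^bsup>g\<^esup>M\<close>.\<close>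

definition transport ::
  "('g, 'e) monoid_scheme \<Rightarrow> ('o, 'm, 'c) bicat \<Rightarrow> 'g \<Rightarrow> ('g, 'm, 'c) tw1 \<Rightarrow> 'c" where
  "transport G \<B> g X = inv2 \<B> (tau X (inv\<^bsub>G\<^esub> g))"

definition twisted_cyc ::
  "('g, 'e) monoid_scheme \<Rightarrow> ('o, 'm, 'c) bicat \<Rightarrow> ('g, 'o, 'm, 'c) twist_data
    \<Rightarrow> ('x, 'a) cat \<Rightarrow> ('m, 'c, 'x, 'a) shadow_data \<Rightarrow> 'g
    \<Rightarrow> ('g, 'm, 'c) tw1 \<Rightarrow> ('g, 'm, 'c) tw1 \<Rightarrow> 'a" where
  "twisted_cyc G \<B> \<Theta> \<T> Sh g X Y =
     (let M = und1 X; N = und1 Y;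
          \<Theta>R = Tw \<Theta> (src \<B> M) (inv\<^bsub>G\<^esub> g); \<Theta>S = Tw \<Theta> (src \<B> N) (inv\<^bsub>G\<^esub> g) in
      sh1 Sh (assoc \<B> \<Theta>S N M)
      \<bullet>\<^bsub>\<T>\<^esub> sh1 Sh (transport G \<B> g Y \<odot>\<odot>\<^bsub>\<B>\<^esub> id2 \<B> M)
      \<bullet>\<^bsub>\<T>\<^esub> sh1 Sh (inv2 \<B> (assoc \<B> N \<Theta>R M))
      \<bullet>\<^bsub>\<T>\<^esub> cyc Sh (\<Theta>R \<odot>\<^bsub>\<B>\<^esub> M) N
      \<bullet>\<^bsub>\<T>\<^esub> sh1 Sh (inv2 \<B> (assoc \<B> \<Theta>R M N)))"

definition twisted_shadow ::
  "('g, 'e) monoid_scheme \<Rightarrow> ('o, 'm, 'c) bicat \<Rightarrow> ('g, 'o, 'm, 'c) twist_data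
    \<Rightarrow> ('x, 'a) cat \<Rightarrow> ('m, 'c, 'x, 'a) shadow_data \<Rightarrow> 'g
    \<Rightarrow> (('g, 'm, 'c) tw1, ('g, 'm, 'c) tw2, 'x, 'a) shadow_data" where
  "twisted_shadow G \<B> \<Theta> \<T> Sh g =
     \<lparr> sh0 = (\<lambda>X. sh0 Sh (Tw \<Theta> (src \<B> (und1 X)) (inv\<^bsub>G\<^esub> g) \<odot>\<^bsub>\<B>\<^esub> und1 X)),
       sh1 = (\<lambda>f. sh1 Sh (id2 \<B> (Tw \<Theta> (src \<B> (und1 (tdom f))) (inv\<^bsub>G\<^esub> g)) \<odot>\<odot>\<^bsub>\<B>\<^esub> und2 f)),
       cyc = twisted_cyc G \<B> \<Theta> \<T> Sh g \<rparr>"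

text \<open>
  The \<open>g\<close>-twisted trace of \<open>f : M \<odot> X \<Rightarrow> Y \<odot> M\<close> with respect to the left dual \<open>D\<close> of \<open>M\<close> with
  coevaluation \<open>\<eta>\<close> and evaluation \<open>\<epsilon>\<close> in the bicategory of twists.
\<close>

definition twisted_trace ::
  "('g, 'e) monoid_scheme \<Rightarrow> ('o, 'm, 'c) bicat \<Rightarrow> ('g, 'o, 'm, 'c) twist_data
    \<Rightarrow> ('x, 'a) cat \<Rightarrow> ('m, 'c, 'x, 'a) shadow_data \<Rightarrow> 'g
    \<Rightarrow> ('g, 'm, 'c) tw1 \<Rightarrow> ('g, 'm, 'c) tw1 \<Rightarrow> ('g, 'm, 'c) tw2 \<Rightarrow> ('g, 'm, 'c) tw2
    \<Rightarrow> ('g, 'm, 'c) tw1 \<Rightarrow> ('g, 'm, 'c) tw1 \<Rightarrow> ('g, 'm, 'c) tw2 \<Rightarrow> 'a" where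
  "twisted_trace G \<B> \<Theta> \<T> Sh g M D \<eta> \<epsilon> X Y f =
     (let \<C> = twist_bicat G \<B> \<Theta>; gSh = twisted_shadow G \<B> \<Theta> \<T> Sh g in
      sh1 gSh (lunit \<C> Y)
      \<bullet>\<^bsub>\<T>\<^esub> sh1 gSh (\<epsilon> \<odot>\<odot>\<^bsub>\<C>\<^esub> id2 \<C> Y)
      \<bullet>\<^bsub>\<T>\<^esub> sh1 gSh (inv2 \<C> (assoc \<C> M D Y))
      \<bullet>\<^bsub>\<T>\<^esub> cyc gSh (D \<odot>\<^bsub>\<C>\<^esub> Y) M
      \<bullet>\<^bsub>\<T>\<^esub> sh1 gSh (inv2 \<C> (assoc \<C> D Y M))
      \<bullet>\<^bsub>\<T>\<^esub> sh1 gSh (id2 \<C> D \<odot>\<odot>\<^bsub>\<C>\<^esub> f)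
      \<bullet>\<^bsub>\<T>\<^esub> sh1 gSh (assoc \<C> D M X)
      \<bullet>\<^bsub>\<T>\<^esub> sh1 gSh (\<eta> \<odot>\<odot>\<^bsub>\<C>\<^esub> id2 \<C> X)
      \<bullet>\<^bsub>\<T>\<^esub> sh1 gSh (inv2 \<C> (lunit \<C> X)))"

end

theory Submission
  imports Defs
begin

text \<open>
  Write \<open>\<theta>\<^sub>X\<^sub>,\<^sub>Y : \<langle>X \<odot> Y\<rangle> \<rightarrow> \<langle>Y \<odot> X\<rangle>\<close> for the twisted cyclicity map, which moves \<open>Y\<close> across the base point.
  The left duals \<open>M'\<close> and \<open>N'\<close> turn \<open>h : N \<odot> K \<Rightarrow> L \<odot> M\<close> into its mate \<open>h' : K \<odot> M' \<Rightarrow> N' \<odot> L\<close>. Both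
  sides of the theorem are equal to one composite
  \<open>\<langle>K \<odot> Q\<rangle> \<rightarrow> \<langle>(K \<odot> M') \<odot> (M \<odot> Q)\<rangle> \<rightarrow> \<langle>(M \<odot> Q) \<odot> (K \<odot> M')\<rangle> \<rightarrow> \<langle>P \<odot> L\<rangle>\<close>,
  whose first map creates \<open>M' \<odot> M\<close>, whose second map is a single \<open>\<theta>\<close>, and whose last map is built from
  \<open>f\<close> and \<open>h\<close>. The trace over \<open>M\<close> ends with \<open>h\<close> and the annihilation of \<open>M \<odot> M'\<close>, the trace over \<open>N\<close> with
  \<open>h'\<close> and the annihilation of \<open>N \<odot> N'\<close>; these agree by a triangle identity for \<open>N\<close>. That the trace over
  \<open>N\<close> can be made to begin with the creation of \<open>M' \<odot> M\<close> is a triangle identity for \<open>M\<close>. To bring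
  either side to this form, the maps \<open>\<theta>\<close> that occur in it are slid past the 2-cells by naturality and
  merged into one.

  Only three properties of \<open>\<theta>\<close> enter: naturality, the unit law for
  \<open>\<theta>\<^sub>X\<^sub>,\<^sub>U\<close> with \<open>U\<close> a unit 1-cell, and the rule that moving \<open>Y
  \<odot> Z\<close> at once is the same as moving \<open>Z\<close> and then \<open>Y\<close>. They are collected in the
  locale \<open>weak_shadow\<close>, in which \<open>trace_cyclic\<close> proves the theorem. The point of this detour
  is that the twisted shadow is in general not a shadow: \<open>\<theta>\<^sub>X\<^sub>,\<^sub>Y\<close> carries the
  twist \<open>\<Theta>(g\<inverse>)\<close> past \<open>Y\<close> by a transport map. Hence
  \<open>\<theta>\<^sub>U\<^sub>,\<^sub>X\<close> is in general not the map given by unitors, and the hexagon, in the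
  form that expresses \<open>\<theta>\<close> at \<open>(X \<odot> Y, Z)\<close> by two moves, would carry the twist
  past too many 1-cells. The three properties above do survive; \<open>weak_shadow_twisted\<close> proves this from the
  cocycle description of composites of twisted 1-cells. An ordinary shadow has the three properties because its
  \<open>\<theta>\<close> is an involution (\<open>cyc_involution\<close>).

  Applying \<open>trace_cyclic\<close> to twists needs the bicategory of twists to be a bicategory
  (\<open>bicategory_twist_bicat\<close>). This, like everything else, involves many diagrams of associators and
  unitors. They are handled uniformly by a strictification: a 2-cell is replaced by the family of
  2-cells that it induces on right-bracketed composites with a further 1-cell \<open>X\<close>, in which
  associators and unitors become identities.
\<close>

section \<open>Calculus of 2-cells\<close>

text \<open>
  The axioms of a bicategory are restated with hypotheses on sources, targets, domains and codomains
  instead of membership in hom-sets. In this form the left-hand side of an equation determines its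
  hypotheses, so that the equations can be used for conditional rewriting.
\<close>

context bicategory
begin

abbreviation whisker_left :: "'m \<Rightarrow> 'c \<Rightarrow> 'c"  (infixr "\<triangleright>" 72)
  where "M \<triangleright> f \<equiv> id2 \<B> M \<odot>\<odot> f"

abbreviation whisker_right :: "'c \<Rightarrow> 'm \<Rightarrow> 'c"  (infixl "\<triangleleft>" 72)
  where "f \<triangleleft> N \<equiv> f \<odot>\<odot> id2 \<B> N"

lemma hom2_iff: "f \<in> hom2 \<B> M N \<longleftrightarrow> f \<in> cells2 \<B> \<and> dom2 \<B> f = M \<and> cod2 \<B> f = N"
  by (auto simp: hom2_def)

lemma hom1_iff: "M \<in> hom1 \<B> A B \<longleftrightarrow> M \<in> cells1 \<B> \<and> src \<B> M = A \<and> trg \<B> M = B"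
  by (auto simp: hom1_def)

lemma src_cod2 [simp]: "f \<in> cells2 \<B> \<Longrightarrow> src \<B> (cod2 \<B> f) = src \<B> (dom2 \<B> f)"
  using parallel_src by simp

lemma trg_cod2 [simp]: "f \<in> cells2 \<B> \<Longrightarrow> trg \<B> (cod2 \<B> f) = trg \<B> (dom2 \<B> f)"
  using parallel_trg by simp

lemmas closed_simps [simp] = src_closed trg_closed dom2_closed cod2_closed

lemma id2_cell [simp]:
  assumes "M \<in> cells1 \<B>"
  shows "id2 \<B> M \<in> cells2 \<B>" "dom2 \<B> (id2 \<B> M) = M" "cod2 \<B> (id2 \<B> M) = M"
  using id2_in[OF assms] by (auto simp: hom2_iff)

lemma vcomp_cell [simp]:
  assumes "f \<in> cells2 \<B>" "k \<in> cells2 \<B>" "dom2 \<B> k = cod2 \<B> f"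
  shows "k \<cdot> f \<in> cells2 \<B>" "dom2 \<B> (k \<cdot> f) = dom2 \<B> f" "cod2 \<B> (k \<cdot> f) = cod2 \<B> k"
  using vcomp_in[of f _ _ k] assms by (auto simp: hom2_iff)

lemma vcomp_assoc' [simp]:
  "\<lbrakk>f \<in> cells2 \<B>; k \<in> cells2 \<B>; j \<in> cells2 \<B>; dom2 \<B> k = cod2 \<B> f; dom2 \<B> j = cod2 \<B> k\<rbrakk>
    \<Longrightarrow> (j \<cdot> k) \<cdot> f = j \<cdot> k \<cdot> f"
  using vcomp_assoc by (auto simp: hom2_iff)

text \<open>Rewrites with \<open>k \<cdot> f = h\<close> inside a composite that is bracketed to the right.\<close>
lemma vcomp_prolong:
  "\<lbrakk>k \<cdot> f = h; f \<in> cells2 \<B>; k \<in> cells2 \<B>; dom2 \<B> k = cod2 \<B> f; z \<in> cells2 \<B>; cod2 \<B> z = dom2 \<B> f\<rbrakk>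
    \<Longrightarrow> k \<cdot> f \<cdot> z = h \<cdot> z"
  by auto

lemma vcomp_id_left' [simp]: "\<lbrakk>f \<in> cells2 \<B>; cod2 \<B> f = N\<rbrakk> \<Longrightarrow> id2 \<B> N \<cdot> f = f"
  using vcomp_id_left by (auto simp: hom2_iff)

lemma vcomp_id_right' [simp]: "\<lbrakk>f \<in> cells2 \<B>; dom2 \<B> f = M\<rbrakk> \<Longrightarrow> f \<cdot> id2 \<B> M = f"
  using vcomp_id_right by (auto simp: hom2_iff)

lemma unit1_cell [simp]:
  assumes "A \<in> cells0 \<B>"
  shows "unit1 \<B> A \<in> cells1 \<B>" "src \<B> (unit1 \<B> A) = A" "trg \<B> (unit1 \<B> A) = A"
  using unit1_in[OF assms] by (auto simp: hom1_iff)

lemma hcomp1_cell [simp]: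
  assumes "M \<in> cells1 \<B>" "N \<in> cells1 \<B>" "src \<B> N = trg \<B> M"
  shows "M \<odot> N \<in> cells1 \<B>" "src \<B> (M \<odot> N) = src \<B> M" "trg \<B> (M \<odot> N) = trg \<B> N"
  using hcomp1_in[of M _ _ N] assms by (auto simp: hom1_iff)

lemma hcomp2_cell [simp]:
  assumes "f \<in> cells2 \<B>" "k \<in> cells2 \<B>" "src \<B> (dom2 \<B> k) = trg \<B> (dom2 \<B> f)"
  shows "f \<odot>\<odot> k \<in> cells2 \<B>" "dom2 \<B> (f \<odot>\<odot> k) = dom2 \<B> f \<odot> dom2 \<B> k"
    "cod2 \<B> (f \<odot>\<odot> k) = cod2 \<B> f \<odot> cod2 \<B> k"
  using hcomp2_in[of "dom2 \<B> f" _ _ "dom2 \<B> k" _ f "cod2 \<B> f" k "cod2 \<B> k"] assms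
  by (auto simp: hom1_iff hom2_iff)

lemma hcomp2_id' [simp]:
  "\<lbrakk>M \<in> cells1 \<B>; N \<in> cells1 \<B>; src \<B> N = trg \<B> M\<rbrakk> \<Longrightarrow> M \<triangleright> id2 \<B> N = id2 \<B> (M \<odot> N)"
  using hcomp2_id by (auto simp: hom1_iff)

lemma interchange':
  "\<lbrakk>f \<in> cells2 \<B>; f' \<in> cells2 \<B>; dom2 \<B> f' = cod2 \<B> f; k \<in> cells2 \<B>; k' \<in> cells2 \<B>;
    dom2 \<B> k' = cod2 \<B> k; src \<B> (dom2 \<B> k) = trg \<B> (dom2 \<B> f)\<rbrakk>
    \<Longrightarrow> (f' \<odot>\<odot> k') \<cdot> (f \<odot>\<odot> k) = (f' \<cdot> f) \<odot>\<odot> (k' \<cdot> k)"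
  using interchange[of "dom2 \<B> f" _ _ "dom2 \<B> k" _ f "cod2 \<B> f" f' _ k _ k']
  by (auto simp: hom1_iff hom2_iff)

lemma whisker_left_vcomp:
  "\<lbrakk>f \<in> cells2 \<B>; k \<in> cells2 \<B>; dom2 \<B> k = cod2 \<B> f; M \<in> cells1 \<B>; src \<B> (dom2 \<B> f) = trg \<B> M\<rbrakk>
    \<Longrightarrow> M \<triangleright> (k \<cdot> f) = (M \<triangleright> k) \<cdot> (M \<triangleright> f)"
  by (simp add: interchange')

lemma whisker_right_vcomp:
  "\<lbrakk>f \<in> cells2 \<B>; k \<in> cells2 \<B>; dom2 \<B> k = cod2 \<B> f; M \<in> cells1 \<B>; src \<B> M = trg \<B> (dom2 \<B> f)\<rbrakk>
    \<Longrightarrow> (k \<cdot> f) \<triangleleft> M = (k \<triangleleft> M) \<cdot> (f \<triangleleft> M)"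
  by (simp add: interchange')

lemma whisker_exchange:
  "\<lbrakk>f \<in> cells2 \<B>; k \<in> cells2 \<B>; src \<B> (dom2 \<B> k) = trg \<B> (dom2 \<B> f)\<rbrakk>
    \<Longrightarrow> (cod2 \<B> f \<triangleright> k) \<cdot> (f \<triangleleft> dom2 \<B> k) = (f \<triangleleft> cod2 \<B> k) \<cdot> (dom2 \<B> f \<triangleright> k)"
  by (simp add: interchange')

lemma assoc_cell [simp]:
  assumes "M \<in> cells1 \<B>" "N \<in> cells1 \<B>" "P \<in> cells1 \<B>" "src \<B> N = trg \<B> M" "src \<B> P = trg \<B> N"
  shows "assoc \<B> M N P \<in> cells2 \<B>" "dom2 \<B> (assoc \<B> M N P) = (M \<odot> N) \<odot> P"
    "cod2 \<B> (assoc \<B> M N P) = M \<odot> (N \<odot> P)"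
  using assoc_in[of M _ _ N _ P] assms by (auto simp: hom1_iff hom2_iff)

lemma lunit_cell [simp]:
  assumes "M \<in> cells1 \<B>"
  shows "lunit \<B> M \<in> cells2 \<B>" "dom2 \<B> (lunit \<B> M) = unit1 \<B> (src \<B> M) \<odot> M"
    "cod2 \<B> (lunit \<B> M) = M"
  using lunit_in[of M] assms by (auto simp: hom1_iff hom2_iff)

lemma runit_cell [simp]:
  assumes "M \<in> cells1 \<B>"
  shows "runit \<B> M \<in> cells2 \<B>" "dom2 \<B> (runit \<B> M) = M \<odot> unit1 \<B> (trg \<B> M)"
    "cod2 \<B> (runit \<B> M) = M"
  using runit_in[of M] assms by (auto simp: hom1_iff hom2_iff)

lemma inverse2_unique:
  assumes "inverse2 \<B> f k" "inverse2 \<B> f k'"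
  shows "k = k'"
proof -
  have "k \<cdot> f \<cdot> k' = (k \<cdot> f) \<cdot> k'"
    using assms unfolding inverse2_def by (intro vcomp_assoc'[symmetric]) (auto simp: hom2_iff)
  then show ?thesis
    using assms unfolding inverse2_def by (auto simp: hom2_iff)
qed

lemma inv2_eqI: "inverse2 \<B> f k \<Longrightarrow> inv2 \<B> f = k"
  unfolding inv2_def using inverse2_unique by blast

lemma inverse2_inv2: "iso2 \<B> f \<Longrightarrow> inverse2 \<B> f (inv2 \<B> f)"
  unfolding iso2_def using inv2_eqI by metis

lemma inv2_cell [simp]:
  assumes "iso2 \<B> f"
  shows "inv2 \<B> f \<in> cells2 \<B>" "dom2 \<B> (inv2 \<B> f) = cod2 \<B> f" "cod2 \<B> (inv2 \<B> f) = dom2 \<B> f"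
    "inv2 \<B> f \<cdot> f = id2 \<B> (dom2 \<B> f)" "f \<cdot> inv2 \<B> f = id2 \<B> (cod2 \<B> f)"
  using inverse2_inv2[OF assms] by (auto simp: inverse2_def hom2_iff)

lemma iso2_cell: "iso2 \<B> f \<Longrightarrow> f \<in> cells2 \<B>"
  by (auto simp: iso2_def inverse2_def)

lemma inv2_cancel [simp]:
  assumes "iso2 \<B> f"
  shows "\<lbrakk>k \<in> cells2 \<B>; cod2 \<B> k = dom2 \<B> f\<rbrakk> \<Longrightarrow> inv2 \<B> f \<cdot> f \<cdot> k = k"
    and "\<lbrakk>k \<in> cells2 \<B>; cod2 \<B> k = cod2 \<B> f\<rbrakk> \<Longrightarrow> f \<cdot> inv2 \<B> f \<cdot> k = k"
proof -
  have f: "f \<in> cells2 \<B>" using assms by (rule iso2_cell)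
  show "inv2 \<B> f \<cdot> f \<cdot> k = k" if "k \<in> cells2 \<B>" "cod2 \<B> k = dom2 \<B> f"
    using vcomp_assoc'[of k f "inv2 \<B> f"] assms f that by (simp del: vcomp_assoc')
  show "f \<cdot> inv2 \<B> f \<cdot> k = k" if "k \<in> cells2 \<B>" "cod2 \<B> k = cod2 \<B> f"
    using vcomp_assoc'[of k "inv2 \<B> f" f] assms f that by (simp del: vcomp_assoc')
qed

lemma iso2I:
  assumes "f \<in> cells2 \<B>" "k \<in> cells2 \<B>" "dom2 \<B> k = cod2 \<B> f" "cod2 \<B> k = dom2 \<B> f"
    "k \<cdot> f = id2 \<B> (dom2 \<B> f)" "f \<cdot> k = id2 \<B> (cod2 \<B> f)"
  shows "iso2 \<B> f" "inv2 \<B> f = k"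
proof -
  have "inverse2 \<B> f k" using assms by (simp add: inverse2_def hom2_iff)
  then show "iso2 \<B> f" "inv2 \<B> f = k" by (auto simp: iso2_def inv2_eqI)
qed

lemma iso2_inv2 [simp]:
  assumes "iso2 \<B> f"
  shows "iso2 \<B> (inv2 \<B> f)" "inv2 \<B> (inv2 \<B> f) = f"
  using iso2I[of "inv2 \<B> f" f] assms iso2_cell by auto

lemma iso2_id2 [simp]: "M \<in> cells1 \<B> \<Longrightarrow> iso2 \<B> (id2 \<B> M)" "M \<in> cells1 \<B> \<Longrightarrow> inv2 \<B> (id2 \<B> M) = id2 \<B> M"
  by (rule iso2I[of _ "id2 \<B> M"]; simp)+

lemma iso2_vcomp [simp]:
  assumes "iso2 \<B> f" "iso2 \<B> k" "dom2 \<B> k = cod2 \<B> f"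
  shows "iso2 \<B> (k \<cdot> f)" "inv2 \<B> (k \<cdot> f) = inv2 \<B> f \<cdot> inv2 \<B> k"
  using assms by (auto intro!: iso2I[of _ "inv2 \<B> f \<cdot> inv2 \<B> k"] simp: iso2_cell)

lemma iso2_hcomp [simp]:
  assumes "iso2 \<B> f" "iso2 \<B> k" "src \<B> (dom2 \<B> k) = trg \<B> (dom2 \<B> f)"
  shows "iso2 \<B> (f \<odot>\<odot> k)" "inv2 \<B> (f \<odot>\<odot> k) = inv2 \<B> f \<odot>\<odot> inv2 \<B> k"
  using assms by (auto intro!: iso2I[of _ "inv2 \<B> f \<odot>\<odot> inv2 \<B> k"] simp: iso2_cell interchange')

lemma assoc_iso' [simp]:
  "\<lbrakk>M \<in> cells1 \<B>; N \<in> cells1 \<B>; P \<in> cells1 \<B>; src \<B> N = trg \<B> M; src \<B> P = trg \<B> N\<rbrakk>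
    \<Longrightarrow> iso2 \<B> (assoc \<B> M N P)"
  using assoc_iso by (auto simp: hom1_iff)

lemmas unit_isos [simp] = lunit_iso runit_iso

lemma whisker_left_inv2 [simp]:
  assumes "iso2 \<B> f" "M \<in> cells1 \<B>" "src \<B> (dom2 \<B> f) = trg \<B> M"
  shows "(M \<triangleright> inv2 \<B> f) \<cdot> (M \<triangleright> f) = id2 \<B> (M \<odot> dom2 \<B> f)"
    and "\<lbrakk>k \<in> cells2 \<B>; cod2 \<B> k = M \<odot> dom2 \<B> f\<rbrakk> \<Longrightarrow> (M \<triangleright> inv2 \<B> f) \<cdot> (M \<triangleright> f) \<cdot> k = k"
  using assms inv2_cancel(1)[of "M \<triangleright> f" k] iso2_cell[of f] by (simp_all add: interchange')

lemma iso2_epi: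
  assumes "iso2 \<B> f" "k \<in> cells2 \<B>" "k' \<in> cells2 \<B>" "dom2 \<B> k = cod2 \<B> f" "dom2 \<B> k' = cod2 \<B> f"
    "k \<cdot> f = k' \<cdot> f"
  shows "k = k'"
proof -
  have "(k \<cdot> f) \<cdot> inv2 \<B> f = (k' \<cdot> f) \<cdot> inv2 \<B> f" using assms by simp
  then show ?thesis using assms(1-5) iso2_cell[of f] by simp
qed

lemma iso2_mono:
  assumes "iso2 \<B> f" "k \<in> cells2 \<B>" "k' \<in> cells2 \<B>" "cod2 \<B> k = dom2 \<B> f" "cod2 \<B> k' = dom2 \<B> f"
    "f \<cdot> k = f \<cdot> k'"
  shows "k = k'"
proof -
  have "inv2 \<B> f \<cdot> f \<cdot> k = inv2 \<B> f \<cdot> f \<cdot> k'" using assms by simp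
  then show ?thesis using assms(1-5) iso2_cell[of f] by simp
qed

lemma assoc_natural':
  "\<lbrakk>f \<in> cells2 \<B>; k \<in> cells2 \<B>; j \<in> cells2 \<B>; src \<B> (dom2 \<B> k) = trg \<B> (dom2 \<B> f);
    src \<B> (dom2 \<B> j) = trg \<B> (dom2 \<B> k)\<rbrakk>
    \<Longrightarrow> assoc \<B> (cod2 \<B> f) (cod2 \<B> k) (cod2 \<B> j) \<cdot> ((f \<odot>\<odot> k) \<odot>\<odot> j)
      = (f \<odot>\<odot> (k \<odot>\<odot> j)) \<cdot> assoc \<B> (dom2 \<B> f) (dom2 \<B> k) (dom2 \<B> j)"
  using assoc_natural[of "dom2 \<B> f" _ _ "dom2 \<B> k" _ "dom2 \<B> j" _ f "cod2 \<B> f" k "cod2 \<B> k" j "cod2 \<B> j"]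
  by (auto simp: hom1_iff hom2_iff)

lemma lunit_natural':
  "f \<in> cells2 \<B> \<Longrightarrow> lunit \<B> (cod2 \<B> f) \<cdot> (unit1 \<B> (src \<B> (dom2 \<B> f)) \<triangleright> f) = f \<cdot> lunit \<B> (dom2 \<B> f)"
  using lunit_natural[of "dom2 \<B> f" _ _ f] by (auto simp: hom1_iff hom2_iff)

lemma runit_natural':
  "f \<in> cells2 \<B> \<Longrightarrow> runit \<B> (cod2 \<B> f) \<cdot> (f \<triangleleft> unit1 \<B> (trg \<B> (dom2 \<B> f))) = f \<cdot> runit \<B> (dom2 \<B> f)"
  using runit_natural[of "dom2 \<B> f" _ _ f] by (auto simp: hom1_iff hom2_iff)

lemma whisker_right_faithful:
  assumes "f \<in> cells2 \<B>" "k \<in> cells2 \<B>" "dom2 \<B> f = dom2 \<B> k" "cod2 \<B> f = cod2 \<B> k"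
    "f \<triangleleft> unit1 \<B> (trg \<B> (dom2 \<B> f)) = k \<triangleleft> unit1 \<B> (trg \<B> (dom2 \<B> f))"
  shows "f = k"
  using runit_natural'[of f] runit_natural'[of k] assms
  by (auto intro!: iso2_epi[of "runit \<B> (dom2 \<B> k)" f k])

lemma whisker_left_faithful:
  assumes "f \<in> cells2 \<B>" "k \<in> cells2 \<B>" "dom2 \<B> f = dom2 \<B> k" "cod2 \<B> f = cod2 \<B> k"
    "unit1 \<B> (src \<B> (dom2 \<B> f)) \<triangleright> f = unit1 \<B> (src \<B> (dom2 \<B> f)) \<triangleright> k"
  shows "f = k"
  using lunit_natural'[of f] lunit_natural'[of k] assms
  by (auto intro!: iso2_epi[of "lunit \<B> (dom2 \<B> k)" f k])

lemma pentagon':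
  "\<lbrakk>M \<in> cells1 \<B>; N \<in> cells1 \<B>; P \<in> cells1 \<B>; Q \<in> cells1 \<B>;
    src \<B> N = trg \<B> M; src \<B> P = trg \<B> N; src \<B> Q = trg \<B> P\<rbrakk>
   \<Longrightarrow> (M \<triangleright> assoc \<B> N P Q) \<cdot> assoc \<B> M (N \<odot> P) Q \<cdot> (assoc \<B> M N P \<triangleleft> Q)
        = assoc \<B> M N (P \<odot> Q) \<cdot> assoc \<B> (M \<odot> N) P Q"
  using pentagon by (auto simp: hom1_iff)

lemma triangle':
  "\<lbrakk>M \<in> cells1 \<B>; N \<in> cells1 \<B>; src \<B> N = trg \<B> M; trg \<B> M = B\<rbrakk>
    \<Longrightarrow> (M \<triangleright> lunit \<B> N) \<cdot> assoc \<B> M (unit1 \<B> B) N = runit \<B> M \<triangleleft> N"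
  using triangle[of M _ B N] by (simp add: hom1_iff)

text \<open>
  Kelly's consequence of the pentagon and triangle axioms. It suffices to prove it after whiskering
  with the unit 1-cell and composing with isomorphisms; there the pentagon turns the left unitor of
  \<open>M \<odot> N\<close> into an instance of the triangle axiom.
\<close>
lemma lunit_whisker_right:
  assumes M: "M \<in> cells1 \<B>" and N: "N \<in> cells1 \<B>" and MN: "src \<B> N = trg \<B> M"
  shows "lunit \<B> M \<triangleleft> N = lunit \<B> (M \<odot> N) \<cdot> assoc \<B> (unit1 \<B> (src \<B> M)) M N"
proof -
  let ?U = "unit1 \<B> (src \<B> M)"
  note [simp] = assms
  let ?e = "assoc \<B> ?U (?U \<odot> M) N \<cdot> (assoc \<B> ?U ?U M \<triangleleft> N)"
  have "(?U \<triangleright> (lunit \<B> (M \<odot> N) \<cdot> assoc \<B> ?U M N)) \<cdot> ?e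
      = (?U \<triangleright> lunit \<B> (M \<odot> N)) \<cdot> (?U \<triangleright> assoc \<B> ?U M N) \<cdot> ?e"
    by (simp add: whisker_left_vcomp)
  also have "\<dots> = (?U \<triangleright> lunit \<B> (M \<odot> N)) \<cdot> assoc \<B> ?U ?U (M \<odot> N) \<cdot> assoc \<B> (?U \<odot> ?U) M N"
    by (simp add: pentagon')
  also have "\<dots> = ((?U \<triangleright> lunit \<B> (M \<odot> N)) \<cdot> assoc \<B> ?U ?U (M \<odot> N)) \<cdot> assoc \<B> (?U \<odot> ?U) M N"
    by simp
  also have "\<dots> = (runit \<B> ?U \<triangleleft> (M \<odot> N)) \<cdot> assoc \<B> (?U \<odot> ?U) M N"
    by (simp add: triangle' del: vcomp_assoc')
  also have "\<dots> = assoc \<B> ?U M N \<cdot> ((runit \<B> ?U \<triangleleft> M) \<triangleleft> N)"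
    using assoc_natural'[of "runit \<B> ?U" "id2 \<B> M" "id2 \<B> N"] by simp
  also have "\<dots> = assoc \<B> ?U M N \<cdot> (((?U \<triangleright> lunit \<B> M) \<cdot> assoc \<B> ?U ?U M) \<triangleleft> N)"
    by (simp add: triangle')
  also have "\<dots> = (assoc \<B> ?U M N \<cdot> ((?U \<triangleright> lunit \<B> M) \<triangleleft> N)) \<cdot> (assoc \<B> ?U ?U M \<triangleleft> N)"
    by (simp add: whisker_right_vcomp)
  also have "assoc \<B> ?U M N \<cdot> ((?U \<triangleright> lunit \<B> M) \<triangleleft> N)
      = (?U \<triangleright> (lunit \<B> M \<triangleleft> N)) \<cdot> assoc \<B> ?U (?U \<odot> M) N"
    using assoc_natural'[of "id2 \<B> ?U" "lunit \<B> M" "id2 \<B> N"] by simp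
  also have "\<dots> \<cdot> (assoc \<B> ?U ?U M \<triangleleft> N) = (?U \<triangleright> (lunit \<B> M \<triangleleft> N)) \<cdot> ?e"
    by simp
  finally have "?U \<triangleright> (lunit \<B> (M \<odot> N) \<cdot> assoc \<B> ?U M N) = ?U \<triangleright> (lunit \<B> M \<triangleleft> N)"
    by (rule iso2_epi[of ?e, rotated -1]) simp_all
  then show ?thesis
    by - (rule whisker_left_faithful, simp_all)
qed

end

section \<open>Strictification\<close>

text \<open>
  Formal composites of 1-cells. Remembering how a 1-cell is built makes it possible to rebracket it
  to the right and to delete its units.
\<close>

datatype ('o, 'm) word = Atom 'm | Empty 'o | Cat "('o, 'm) word" "('o, 'm) word"

context bicategory
begin

primrec ev :: "('o, 'm) word \<Rightarrow> 'm" where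
  "ev (Atom M) = M"
| "ev (Empty A) = unit1 \<B> A"
| "ev (Cat s t) = ev s \<odot> ev t"

primrec wf_word :: "('o, 'm) word \<Rightarrow> bool" where
  "wf_word (Atom M) \<longleftrightarrow> M \<in> cells1 \<B>"
| "wf_word (Empty A) \<longleftrightarrow> A \<in> cells0 \<B>"
| "wf_word (Cat s t) \<longleftrightarrow> wf_word s \<and> wf_word t \<and> src \<B> (ev t) = trg \<B> (ev s)"

text \<open>
  \<open>act1 s\<close> and \<open>act2 s\<close> are the functor of left composition with the word \<open>s\<close>, bracketed to the right
  and without units. Composition of words becomes composition of functors on the nose, as in
  Cayley's theorem; \<open>flatten s X\<close> compares the functor with composition in the bicategory.
\<close>
primrec act1 :: "('o, 'm) word \<Rightarrow> 'm \<Rightarrow> 'm" where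
  "act1 (Atom M) X = M \<odot> X"
| "act1 (Empty A) X = X"
| "act1 (Cat s t) X = act1 s (act1 t X)"

primrec act2 :: "('o, 'm) word \<Rightarrow> 'c \<Rightarrow> 'c" where
  "act2 (Atom M) x = M \<triangleright> x"
| "act2 (Empty A) x = x"
| "act2 (Cat s t) x = act2 s (act2 t x)"

primrec flatten :: "('o, 'm) word \<Rightarrow> 'm \<Rightarrow> 'c" where
  "flatten (Atom M) X = id2 \<B> (M \<odot> X)"
| "flatten (Empty A) X = lunit \<B> X"
| "flatten (Cat s t) X = act2 s (flatten t X) \<cdot> flatten s (ev t \<odot> X) \<cdot> assoc \<B> (ev s) (ev t) X"

lemma ev_cell [simp]: "wf_word s \<Longrightarrow> ev s \<in> cells1 \<B>"
  by (induction s) auto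

lemma act1_cell [simp]:
  assumes "wf_word s" "X \<in> cells1 \<B>" "src \<B> X = trg \<B> (ev s)"
  shows "act1 s X \<in> cells1 \<B>" "src \<B> (act1 s X) = src \<B> (ev s)" "trg \<B> (act1 s X) = trg \<B> X"
proof -
  have "act1 s X \<in> cells1 \<B> \<and> src \<B> (act1 s X) = src \<B> (ev s) \<and> trg \<B> (act1 s X) = trg \<B> X"
    using assms by (induction s arbitrary: X) auto
  then show "act1 s X \<in> cells1 \<B>" "src \<B> (act1 s X) = src \<B> (ev s)" "trg \<B> (act1 s X) = trg \<B> X"
    by auto
qed

lemma act2_cell [simp]:
  assumes "wf_word s" "x \<in> cells2 \<B>" "src \<B> (dom2 \<B> x) = trg \<B> (ev s)"
  shows "act2 s x \<in> cells2 \<B>" "dom2 \<B> (act2 s x) = act1 s (dom2 \<B> x)"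
    "cod2 \<B> (act2 s x) = act1 s (cod2 \<B> x)"
proof -
  have "act2 s x \<in> cells2 \<B> \<and> dom2 \<B> (act2 s x) = act1 s (dom2 \<B> x)
      \<and> cod2 \<B> (act2 s x) = act1 s (cod2 \<B> x)"
    using assms by (induction s arbitrary: x) auto
  then show "act2 s x \<in> cells2 \<B>" "dom2 \<B> (act2 s x) = act1 s (dom2 \<B> x)"
    "cod2 \<B> (act2 s x) = act1 s (cod2 \<B> x)"
    by auto
qed

lemma act2_id [simp]:
  "\<lbrakk>wf_word s; X \<in> cells1 \<B>; src \<B> X = trg \<B> (ev s)\<rbrakk> \<Longrightarrow> act2 s (id2 \<B> X) = id2 \<B> (act1 s X)"
  by (induction s arbitrary: X) auto

lemma act2_vcomp:
  "\<lbrakk>wf_word s; x \<in> cells2 \<B>; y \<in> cells2 \<B>; dom2 \<B> y = cod2 \<B> x; src \<B> (dom2 \<B> x) = trg \<B> (ev s)\<rbrakk>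
    \<Longrightarrow> act2 s (y \<cdot> x) = act2 s y \<cdot> act2 s x"
  by (induction s arbitrary: x y) (auto simp: whisker_left_vcomp)

lemma act2_iso [simp]:
  "\<lbrakk>wf_word s; iso2 \<B> x; src \<B> (dom2 \<B> x) = trg \<B> (ev s)\<rbrakk> \<Longrightarrow> iso2 \<B> (act2 s x)"
  by (induction s arbitrary: x) (auto simp: iso2_cell)

lemma flatten_cell [simp]:
  assumes "wf_word s" "X \<in> cells1 \<B>" "src \<B> X = trg \<B> (ev s)"
  shows "flatten s X \<in> cells2 \<B>" "dom2 \<B> (flatten s X) = ev s \<odot> X"
    "cod2 \<B> (flatten s X) = act1 s X" "iso2 \<B> (flatten s X)"
proof -
  have "flatten s X \<in> cells2 \<B> \<and> dom2 \<B> (flatten s X) = ev s \<odot> X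
      \<and> cod2 \<B> (flatten s X) = act1 s X \<and> iso2 \<B> (flatten s X)"
    using assms by (induction s arbitrary: X) auto
  then show "flatten s X \<in> cells2 \<B>" "dom2 \<B> (flatten s X) = ev s \<odot> X"
    "cod2 \<B> (flatten s X) = act1 s X" "iso2 \<B> (flatten s X)"
    by auto
qed

lemma flatten_natural:
  "\<lbrakk>wf_word s; x \<in> cells2 \<B>; src \<B> (dom2 \<B> x) = trg \<B> (ev s)\<rbrakk>
    \<Longrightarrow> flatten s (cod2 \<B> x) \<cdot> (ev s \<triangleright> x) = act2 s x \<cdot> flatten s (dom2 \<B> x)"
proof (induction s arbitrary: x)
  case (Atom M)
  then show ?case by simp
next
  case (Empty A)
  then show ?case using lunit_natural'[of x] by simp
next
  case (Cat s t)
  let ?X = "dom2 \<B> x" and ?Y = "cod2 \<B> x"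
  note [simp] = Cat.prems
  have 1: "assoc \<B> (ev s) (ev t) ?Y \<cdot> ((ev s \<odot> ev t) \<triangleright> x)
      = (ev s \<triangleright> (ev t \<triangleright> x)) \<cdot> assoc \<B> (ev s) (ev t) ?X"
    using assoc_natural'[of "id2 \<B> (ev s)" "id2 \<B> (ev t)" x] Cat.prems by simp
  have 2: "flatten s (ev t \<odot> ?Y) \<cdot> (ev s \<triangleright> (ev t \<triangleright> x)) \<cdot> z
      = act2 s (ev t \<triangleright> x) \<cdot> flatten s (ev t \<odot> ?X) \<cdot> z"
    if "z \<in> cells2 \<B>" "cod2 \<B> z = ev s \<odot> (ev t \<odot> ?X)" for z
    using Cat.IH(1)[of "ev t \<triangleright> x"] Cat.prems that
    by (subst vcomp_prolong) (auto intro: Cat.IH(1))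
  have 3: "act2 s (flatten t ?Y) \<cdot> act2 s (ev t \<triangleright> x) \<cdot> z
      = act2 s (act2 t x) \<cdot> act2 s (flatten t ?X) \<cdot> z"
    if "z \<in> cells2 \<B>" "cod2 \<B> z = act1 s (ev t \<odot> ?X)" for z
    using arg_cong[OF Cat.IH(2)[of x], of "act2 s"] Cat.prems that
    by (subst vcomp_prolong) (auto simp: act2_vcomp)
  show ?case
    using Cat.prems by (simp add: 1 2 3)
qed

text \<open>
  \<open>rep s t f \<alpha>\<close> states that \<open>\<alpha>\<close> is the strict form of the 2-cell \<open>f\<close> from the word \<open>s\<close> to the word
  \<open>t\<close>: the transformation between the functors of \<open>s\<close> and \<open>t\<close> that \<open>f\<close> induces. A relation rather
  than a function, so that the strict form of a composite can be computed by resolution while the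
  words in the middle are still unknown.
\<close>
definition rep :: "('o, 'm) word \<Rightarrow> ('o, 'm) word \<Rightarrow> 'c \<Rightarrow> ('m \<Rightarrow> 'c) \<Rightarrow> bool" where
  "rep s t f \<alpha> \<longleftrightarrow> wf_word s \<and> wf_word t \<and> f \<in> hom2 \<B> (ev s) (ev t) \<and>
     (\<forall>X \<in> cells1 \<B>. src \<B> X = trg \<B> (ev s) \<longrightarrow>
        \<alpha> X \<in> hom2 \<B> (act1 s X) (act1 t X) \<and> \<alpha> X \<cdot> flatten s X = flatten t X \<cdot> (f \<triangleleft> X))"

lemma rep_wf: "rep s t f \<alpha> \<Longrightarrow> wf_word s" "rep s t f \<alpha> \<Longrightarrow> wf_word t"
  "rep s t f \<alpha> \<Longrightarrow> src \<B> (ev t) = src \<B> (ev s)" "rep s t f \<alpha> \<Longrightarrow> trg \<B> (ev t) = trg \<B> (ev s)"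
  "rep s t f \<alpha> \<Longrightarrow> f \<in> cells2 \<B>" "rep s t f \<alpha> \<Longrightarrow> dom2 \<B> f = ev s" "rep s t f \<alpha> \<Longrightarrow> cod2 \<B> f = ev t"
  using src_cod2[of f] trg_cod2[of f] by (auto simp: rep_def hom2_iff simp del: src_cod2 trg_cod2)

lemma rep_cell:
  assumes "rep s t f \<alpha>" "X \<in> cells1 \<B>" "src \<B> X = trg \<B> (ev s)"
  shows "\<alpha> X \<in> cells2 \<B>" "dom2 \<B> (\<alpha> X) = act1 s X" "cod2 \<B> (\<alpha> X) = act1 t X"
  using assms by (auto simp: rep_def hom2_iff)

lemma rep_flatten:
  assumes "rep s t f \<alpha>" "X \<in> cells1 \<B>" "src \<B> X = trg \<B> (ev s)"
  shows "\<alpha> X \<cdot> flatten s X = flatten t X \<cdot> (f \<triangleleft> X)"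
  using assms by (auto simp: rep_def hom2_iff)

lemma repI:
  assumes "wf_word s" "wf_word t" "f \<in> cells2 \<B>" "dom2 \<B> f = ev s" "cod2 \<B> f = ev t"
    "\<And>X. \<lbrakk>X \<in> cells1 \<B>; src \<B> X = trg \<B> (ev s)\<rbrakk> \<Longrightarrow> \<alpha> X \<in> cells2 \<B>"
    "\<And>X. \<lbrakk>X \<in> cells1 \<B>; src \<B> X = trg \<B> (ev s)\<rbrakk> \<Longrightarrow> dom2 \<B> (\<alpha> X) = act1 s X"
    "\<And>X. \<lbrakk>X \<in> cells1 \<B>; src \<B> X = trg \<B> (ev s)\<rbrakk> \<Longrightarrow> cod2 \<B> (\<alpha> X) = act1 t X"
    "\<And>X. \<lbrakk>X \<in> cells1 \<B>; src \<B> X = trg \<B> (ev s)\<rbrakk> \<Longrightarrow> \<alpha> X \<cdot> flatten s X = flatten t X \<cdot> (f \<triangleleft> X)"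
  shows "rep s t f \<alpha>"
  using assms by (auto simp: rep_def hom2_iff)

lemma rep_determined:
  assumes "rep s t f \<alpha>" "rep s t f \<beta>" "X \<in> cells1 \<B>" "src \<B> X = trg \<B> (ev s)"
  shows "\<alpha> X = \<beta> X"
  by (rule iso2_epi[of "flatten s X"])
    (use assms in \<open>simp_all add: rep_cell[OF assms(1)] rep_cell[OF assms(2)] rep_flatten[OF assms(1)]
      rep_flatten[OF assms(2)] rep_wf[OF assms(1)]\<close>)

text \<open>
  Strict forms are faithful, since \<open>X\<close> may be a unit 1-cell. This reduces an equation between 2-cells to
  one in which no associators and unitors occur; \<open>rep_eqD\<close> is the converse.
\<close>
lemma rep_eqI:
  assumes f: "rep s t f \<alpha>" and k: "rep s t k \<beta>"
    and eq: "\<And>X. \<lbrakk>X \<in> cells1 \<B>; src \<B> X = trg \<B> (ev s)\<rbrakk> \<Longrightarrow> \<alpha> X = \<beta> X"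
  shows "f = k"
proof -
  let ?U = "unit1 \<B> (trg \<B> (ev s))"
  note [simp] = rep_wf[OF f] rep_wf[OF k]
  have "flatten t ?U \<cdot> (f \<triangleleft> ?U) = flatten t ?U \<cdot> (k \<triangleleft> ?U)"
    using rep_flatten[OF f, of ?U] rep_flatten[OF k, of ?U] eq[of ?U] by simp
  then have "f \<triangleleft> ?U = k \<triangleleft> ?U"
    by (rule iso2_mono[rotated -1]) simp_all
  then show ?thesis
    by - (rule whisker_right_faithful, simp_all)
qed

lemma rep_eqD:
  assumes "f = k" "X \<in> cells1 \<B>" "src \<B> X = trg \<B> (ev s)" "rep s t f \<alpha>" "rep s t k \<beta>"
    "\<alpha> X = x" "\<beta> X = y"
  shows "x = y"
  using rep_determined assms by metis

text \<open>The strict form of an arbitrary 2-cell, used for those 2-cells that are not composites.\<close>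
definition strict :: "('o, 'm) word \<Rightarrow> ('o, 'm) word \<Rightarrow> 'c \<Rightarrow> 'm \<Rightarrow> 'c" where
  "strict s t f X = flatten t X \<cdot> (f \<triangleleft> X) \<cdot> inv2 \<B> (flatten s X)"

lemma rep_strict:
  assumes "wf_word s" "wf_word t" "f \<in> cells2 \<B>" "dom2 \<B> f = ev s" "cod2 \<B> f = ev t"
  shows "rep s t f (strict s t f)"
proof -
  have [simp]: "trg \<B> (ev t) = trg \<B> (ev s)"
    using trg_cod2[of f] assms by simp
  show ?thesis
    by (rule repI) (use assms in \<open>simp_all add: strict_def\<close>)
qed

lemma rep_id: "\<lbrakk>wf_word s; ev s = M\<rbrakk> \<Longrightarrow> rep s s (id2 \<B> M) (\<lambda>X. id2 \<B> (act1 s X))"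
  by (auto intro!: repI)

lemma rep_vcomp:
  assumes f: "rep s t f \<alpha>" and k: "rep t u k \<beta>"
  shows "rep s u (k \<cdot> f) (\<lambda>X. \<beta> X \<cdot> \<alpha> X)"
proof -
  note [simp] = rep_wf[OF f] rep_wf[OF k] rep_cell[OF f] rep_cell[OF k] rep_flatten[OF f]
  show ?thesis
  proof (rule repI)
    fix X assume [simp]: "X \<in> cells1 \<B>" "src \<B> X = trg \<B> (ev s)"
    have "\<beta> X \<cdot> flatten t X \<cdot> (f \<triangleleft> X) = (flatten u X \<cdot> (k \<triangleleft> X)) \<cdot> (f \<triangleleft> X)"
      by (rule vcomp_prolong[OF rep_flatten[OF k]]) simp_all
    then show "(\<beta> X \<cdot> \<alpha> X) \<cdot> flatten s X = flatten u X \<cdot> ((k \<cdot> f) \<triangleleft> X)"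
      by (simp add: whisker_right_vcomp)
  qed simp_all
qed

text \<open>In strict form, naturality in \<open>X\<close> is the interchange law.\<close>
lemma rep_natural:
  assumes f: "rep s t f \<alpha>" and x: "x \<in> cells2 \<B>" "src \<B> (dom2 \<B> x) = trg \<B> (ev s)"
  shows "\<alpha> (cod2 \<B> x) \<cdot> act2 s x = act2 t x \<cdot> \<alpha> (dom2 \<B> x)"
proof (rule iso2_epi[of "flatten s (dom2 \<B> x)"])
  note [simp] = rep_wf[OF f] rep_cell[OF f] rep_flatten[OF f] x
  have "(\<alpha> (cod2 \<B> x) \<cdot> act2 s x) \<cdot> flatten s (dom2 \<B> x)
      = \<alpha> (cod2 \<B> x) \<cdot> flatten s (cod2 \<B> x) \<cdot> (ev s \<triangleright> x)"
    by (simp add: flatten_natural)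
  also have "\<dots> = flatten t (cod2 \<B> x) \<cdot> (f \<triangleleft> cod2 \<B> x) \<cdot> (ev s \<triangleright> x)"
    by (subst vcomp_prolong[OF rep_flatten[OF f]]) simp_all
  also have "(f \<triangleleft> cod2 \<B> x) \<cdot> (ev s \<triangleright> x) = (ev t \<triangleright> x) \<cdot> (f \<triangleleft> dom2 \<B> x)"
    using whisker_exchange[of f x] by simp
  also have "flatten t (cod2 \<B> x) \<cdot> (ev t \<triangleright> x) \<cdot> (f \<triangleleft> dom2 \<B> x)
      = act2 t x \<cdot> flatten t (dom2 \<B> x) \<cdot> (f \<triangleleft> dom2 \<B> x)"
    by (subst vcomp_prolong[OF flatten_natural]) simp_all
  finally show "(\<alpha> (cod2 \<B> x) \<cdot> act2 s x) \<cdot> flatten s (dom2 \<B> x)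
      = (act2 t x \<cdot> \<alpha> (dom2 \<B> x)) \<cdot> flatten s (dom2 \<B> x)"
    by simp
qed (simp_all add: rep_wf[OF f] rep_cell[OF f] x)

lemma rep_cong:
  assumes "rep s t f \<alpha>" "\<And>X. \<lbrakk>X \<in> cells1 \<B>; src \<B> X = trg \<B> (ev s)\<rbrakk> \<Longrightarrow> \<alpha> X = \<beta> X"
  shows "rep s t f \<beta>"
  using assms by (simp add: rep_def)

lemma rep_inv2:
  assumes f: "rep s t f \<alpha>" and iso: "iso2 \<B> f"
  shows "rep t s (inv2 \<B> f) (\<lambda>X. inv2 \<B> (\<alpha> X))"
    and "\<lbrakk>X \<in> cells1 \<B>; src \<B> X = trg \<B> (ev s)\<rbrakk> \<Longrightarrow> iso2 \<B> (\<alpha> X)"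
proof -
  note [simp] = rep_wf[OF f] iso
  have \<alpha>: "\<alpha> X = flatten t X \<cdot> (f \<triangleleft> X) \<cdot> inv2 \<B> (flatten s X)"
    if [simp]: "X \<in> cells1 \<B>" "src \<B> X = trg \<B> (ev s)" for X
    using rep_determined[OF f rep_strict that] by (simp add: strict_def)
  show iso\<alpha>: "iso2 \<B> (\<alpha> X)" if [simp]: "X \<in> cells1 \<B>" "src \<B> X = trg \<B> (ev s)" for X
    by (simp add: \<alpha>)
  show "rep t s (inv2 \<B> f) (\<lambda>X. inv2 \<B> (\<alpha> X))"
    by (rule repI) (simp_all add: \<alpha>)
qed

lemma rep_hcomp:
  assumes f: "rep s t f \<alpha>" and k: "rep u v k \<beta>" and su: "src \<B> (ev u) = trg \<B> (ev s)"
  shows "rep (Cat s u) (Cat t v) (f \<odot>\<odot> k) (\<lambda>X. \<alpha> (act1 v X) \<cdot> act2 s (\<beta> X))"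
proof (rule repI)
  note [simp] = rep_wf[OF f] rep_wf[OF k] rep_cell[OF f] rep_cell[OF k] su
  fix X assume "X \<in> cells1 \<B>" "src \<B> X = trg \<B> (ev (Cat s u))"
  then have [simp]: "X \<in> cells1 \<B>" "src \<B> X = trg \<B> (ev u)" by simp_all
  have "(\<alpha> (act1 v X) \<cdot> act2 s (\<beta> X)) \<cdot> flatten (Cat s u) X
      = \<alpha> (act1 v X) \<cdot> act2 s (\<beta> X \<cdot> flatten u X) \<cdot> flatten s (ev u \<odot> X) \<cdot> assoc \<B> (ev s) (ev u) X"
    by (simp add: act2_vcomp)
  also have "\<dots> = \<alpha> (act1 v X) \<cdot> act2 s (flatten v X) \<cdot> act2 s (k \<triangleleft> X)
        \<cdot> flatten s (ev u \<odot> X) \<cdot> assoc \<B> (ev s) (ev u) X"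
    by (simp add: rep_flatten[OF k] act2_vcomp)
  also have "\<dots> = \<alpha> (act1 v X) \<cdot> act2 s (flatten v X) \<cdot> flatten s (ev v \<odot> X)
        \<cdot> (ev s \<triangleright> (k \<triangleleft> X)) \<cdot> assoc \<B> (ev s) (ev u) X"
    using vcomp_prolong[OF flatten_natural[of s "k \<triangleleft> X"], of "assoc \<B> (ev s) (ev u) X"] by simp
  also have "\<dots> = (act2 t (flatten v X) \<cdot> \<alpha> (ev v \<odot> X)) \<cdot> flatten s (ev v \<odot> X)
        \<cdot> (ev s \<triangleright> (k \<triangleleft> X)) \<cdot> assoc \<B> (ev s) (ev u) X"
    using rep_natural[OF f, of "flatten v X"]
    by (intro vcomp_prolong) simp_all
  also have "\<dots> = act2 t (flatten v X) \<cdot> \<alpha> (ev v \<odot> X) \<cdot> flatten s (ev v \<odot> X)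
        \<cdot> (ev s \<triangleright> (k \<triangleleft> X)) \<cdot> assoc \<B> (ev s) (ev u) X"
    by simp
  also have "\<dots> = act2 t (flatten v X) \<cdot> flatten t (ev v \<odot> X) \<cdot> (f \<triangleleft> (ev v \<odot> X))
        \<cdot> (ev s \<triangleright> (k \<triangleleft> X)) \<cdot> assoc \<B> (ev s) (ev u) X"
    by (subst vcomp_prolong[OF rep_flatten[OF f, of "ev v \<odot> X"]]) simp_all
  also have "(f \<triangleleft> (ev v \<odot> X)) \<cdot> (ev s \<triangleright> (k \<triangleleft> X)) \<cdot> assoc \<B> (ev s) (ev u) X
      = (f \<odot>\<odot> (k \<triangleleft> X)) \<cdot> assoc \<B> (ev s) (ev u) X"
    by (subst vcomp_prolong[OF interchange']) simp_all
  also have "\<dots> = assoc \<B> (ev t) (ev v) X \<cdot> ((f \<odot>\<odot> k) \<triangleleft> X)"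
    using assoc_natural'[of f k "id2 \<B> X"] by simp
  finally show "(\<alpha> (act1 v X) \<cdot> act2 s (\<beta> X)) \<cdot> flatten (Cat s u) X
      = flatten (Cat t v) X \<cdot> ((f \<odot>\<odot> k) \<triangleleft> X)"
    by simp
qed (use assms in \<open>simp_all add: rep_wf[OF f] rep_wf[OF k] rep_cell[OF f] rep_cell[OF k]\<close>)

text \<open>The associator has a trivial strict form: this is the pentagon axiom.\<close>
lemma rep_assoc:
  assumes "wf_word s" "wf_word t" "wf_word u" "src \<B> (ev t) = trg \<B> (ev s)" "src \<B> (ev u) = trg \<B> (ev t)"
  shows "rep (Cat (Cat s t) u) (Cat s (Cat t u)) (assoc \<B> (ev s) (ev t) (ev u))
    (\<lambda>X. id2 \<B> (act1 s (act1 t (act1 u X))))"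
proof (rule repI)
  note [simp] = assms
  fix X assume "X \<in> cells1 \<B>" "src \<B> X = trg \<B> (ev (Cat (Cat s t) u))"
  then have [simp]: "X \<in> cells1 \<B>" "src \<B> X = trg \<B> (ev u)" by simp_all
  have 1: "assoc \<B> (ev s) (ev t) (act1 u X) \<cdot> ((ev s \<odot> ev t) \<triangleright> flatten u X) \<cdot> assoc \<B> (ev s \<odot> ev t) (ev u) X
     = ((ev s \<triangleright> (ev t \<triangleright> flatten u X)) \<cdot> assoc \<B> (ev s) (ev t) (ev u \<odot> X)) \<cdot> assoc \<B> (ev s \<odot> ev t) (ev u) X"
    using assoc_natural'[of "id2 \<B> (ev s)" "id2 \<B> (ev t)" "flatten u X"]
    by (intro vcomp_prolong) simp_all
  have "flatten (Cat (Cat s t) u) X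
    = act2 s (act2 t (flatten u X)) \<cdot> act2 s (flatten t (ev u \<odot> X)) \<cdot> flatten s (ev t \<odot> (ev u \<odot> X))
      \<cdot> assoc \<B> (ev s) (ev t) (ev u \<odot> X) \<cdot> assoc \<B> (ev s \<odot> ev t) (ev u) X"
    by (simp add: 1)
  also have "\<dots> = act2 s (act2 t (flatten u X)) \<cdot> act2 s (flatten t (ev u \<odot> X)) \<cdot> flatten s (ev t \<odot> (ev u \<odot> X))
      \<cdot> (ev s \<triangleright> assoc \<B> (ev t) (ev u) X) \<cdot> assoc \<B> (ev s) (ev t \<odot> ev u) X
      \<cdot> (assoc \<B> (ev s) (ev t) (ev u) \<triangleleft> X)"
    by (simp add: pentagon')
  also have "\<dots> = act2 s (act2 t (flatten u X)) \<cdot> act2 s (flatten t (ev u \<odot> X))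
      \<cdot> act2 s (assoc \<B> (ev t) (ev u) X) \<cdot> flatten s ((ev t \<odot> ev u) \<odot> X) \<cdot> assoc \<B> (ev s) (ev t \<odot> ev u) X
      \<cdot> (assoc \<B> (ev s) (ev t) (ev u) \<triangleleft> X)"
    using vcomp_prolong[OF flatten_natural[of s "assoc \<B> (ev t) (ev u) X"],
      of "assoc \<B> (ev s) (ev t \<odot> ev u) X \<cdot> (assoc \<B> (ev s) (ev t) (ev u) \<triangleleft> X)"]
    by simp
  finally show "id2 \<B> (act1 s (act1 t (act1 u X))) \<cdot> flatten (Cat (Cat s t) u) X
     = flatten (Cat s (Cat t u)) X \<cdot> (assoc \<B> (ev s) (ev t) (ev u) \<triangleleft> X)"
    by (simp add: act2_vcomp)
qed (use assms in simp_all)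

text \<open>For the left unitor, triviality of the strict form is \<open>lunit_whisker_right\<close>.\<close>
lemma rep_lunit:
  assumes "wf_word s"
  shows "rep (Cat (Empty (src \<B> (ev s))) s) s (lunit \<B> (ev s)) (\<lambda>X. id2 \<B> (act1 s X))"
proof (rule repI)
  note [simp] = assms
  fix X assume "X \<in> cells1 \<B>" "src \<B> X = trg \<B> (ev (Cat (Empty (src \<B> (ev s))) s))"
  then have [simp]: "X \<in> cells1 \<B>" "src \<B> X = trg \<B> (ev s)" by simp_all
  show "id2 \<B> (act1 s X) \<cdot> flatten (Cat (Empty (src \<B> (ev s))) s) X = flatten s X \<cdot> (lunit \<B> (ev s) \<triangleleft> X)"
    by (simp add: lunit_whisker_right)
qed (use assms in simp_all)

text \<open>For the right unitor, it is the triangle axiom.\<close>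
lemma rep_runit:
  assumes "wf_word s"
  shows "rep (Cat s (Empty (trg \<B> (ev s)))) s (runit \<B> (ev s)) (\<lambda>X. id2 \<B> (act1 s X))"
proof (rule repI)
  note [simp] = assms
  fix X assume "X \<in> cells1 \<B>" "src \<B> X = trg \<B> (ev (Cat s (Empty (trg \<B> (ev s)))))"
  then have [simp]: "X \<in> cells1 \<B>" "src \<B> X = trg \<B> (ev s)" by simp_all
  let ?U = "unit1 \<B> (trg \<B> (ev s))"
  have "act2 s (lunit \<B> X) \<cdot> flatten s (?U \<odot> X) \<cdot> assoc \<B> (ev s) ?U X
    = (flatten s X \<cdot> (ev s \<triangleright> lunit \<B> X)) \<cdot> assoc \<B> (ev s) ?U X"
    using flatten_natural[of s "lunit \<B> X", symmetric]
    by (intro vcomp_prolong) simp_all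
  then show "id2 \<B> (act1 s X) \<cdot> flatten (Cat s (Empty (trg \<B> (ev s)))) X = flatten s X \<cdot> (runit \<B> (ev s) \<triangleleft> X)"
    by (simp add: triangle')
qed (use assms in simp_all)

text \<open>
  The rules above with the evaluations of words replaced by variables. Resolution can then match a
  1-cell that is not literally of the form \<open>ev s\<close>; the equations are left to the simplifier.
\<close>
lemma rep_assocI:
  assumes "ev s = M" "ev t = N" "ev u = P" "wf_word s" "wf_word t" "wf_word u"
    "src \<B> N = trg \<B> M" "src \<B> P = trg \<B> N"
  shows "rep (Cat (Cat s t) u) (Cat s (Cat t u)) (assoc \<B> M N P)
      (\<lambda>X. id2 \<B> (act1 s (act1 t (act1 u X))))"
    and "rep (Cat s (Cat t u)) (Cat (Cat s t) u) (inv2 \<B> (assoc \<B> M N P))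
      (\<lambda>X. id2 \<B> (act1 s (act1 t (act1 u X))))"
proof -
  show a: "rep (Cat (Cat s t) u) (Cat s (Cat t u)) (assoc \<B> M N P)
      (\<lambda>X. id2 \<B> (act1 s (act1 t (act1 u X))))"
    using rep_assoc assms by auto
  show "rep (Cat s (Cat t u)) (Cat (Cat s t) u) (inv2 \<B> (assoc \<B> M N P))
      (\<lambda>X. id2 \<B> (act1 s (act1 t (act1 u X))))"
    by (rule rep_cong[OF rep_inv2(1)[OF a]]) (use assms in auto)
qed

lemma rep_lunitI:
  assumes "ev s = M" "src \<B> M = A" "wf_word s"
  shows "rep (Cat (Empty A) s) s (lunit \<B> M) (\<lambda>X. id2 \<B> (act1 s X))"
    and "rep s (Cat (Empty A) s) (inv2 \<B> (lunit \<B> M)) (\<lambda>X. id2 \<B> (act1 s X))"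
proof -
  show a: "rep (Cat (Empty A) s) s (lunit \<B> M) (\<lambda>X. id2 \<B> (act1 s X))"
    using rep_lunit assms by auto
  show "rep s (Cat (Empty A) s) (inv2 \<B> (lunit \<B> M)) (\<lambda>X. id2 \<B> (act1 s X))"
    by (rule rep_cong[OF rep_inv2(1)[OF a]]) (use assms in auto)
qed

lemma rep_runitI:
  assumes "ev s = M" "trg \<B> M = A" "wf_word s"
  shows "rep (Cat s (Empty A)) s (runit \<B> M) (\<lambda>X. id2 \<B> (act1 s X))"
    and "rep s (Cat s (Empty A)) (inv2 \<B> (runit \<B> M)) (\<lambda>X. id2 \<B> (act1 s X))"
proof -
  show a: "rep (Cat s (Empty A)) s (runit \<B> M) (\<lambda>X. id2 \<B> (act1 s X))"
    using rep_runit assms by auto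
  show "rep s (Cat s (Empty A)) (inv2 \<B> (runit \<B> M)) (\<lambda>X. id2 \<B> (act1 s X))"
    by (rule rep_cong[OF rep_inv2(1)[OF a]]) (use assms in auto)
qed

lemmas rep_rules = rep_vcomp rep_hcomp rep_id rep_assocI rep_lunitI rep_runitI

end

section \<open>Traces in weakly shadowed bicategories\<close>

context category
begin

lemma homs_iff: "f \<in> homs \<T> x y \<longleftrightarrow> f \<in> arrs \<T> \<and> Dom \<T> f = x \<and> Cod \<T> f = y"
  by (auto simp: homs_def)

lemma Comp_arr [simp]:
  assumes "f \<in> arrs \<T>" "k \<in> arrs \<T>" "Dom \<T> k = Cod \<T> f"
  shows "k \<bullet> f \<in> arrs \<T>" "Dom \<T> (k \<bullet> f) = Dom \<T> f" "Cod \<T> (k \<bullet> f) = Cod \<T> k"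
  using Comp_in[of f _ _ k] assms by (auto simp: homs_iff)

lemma Comp_assoc' [simp]:
  "\<lbrakk>f \<in> arrs \<T>; k \<in> arrs \<T>; j \<in> arrs \<T>; Dom \<T> k = Cod \<T> f; Dom \<T> j = Cod \<T> k\<rbrakk>
    \<Longrightarrow> (j \<bullet> k) \<bullet> f = j \<bullet> k \<bullet> f"
  using Comp_assoc by (auto simp: homs_iff)

lemma Comp_prolong:
  "\<lbrakk>k \<bullet> f = h; f \<in> arrs \<T>; k \<in> arrs \<T>; Dom \<T> k = Cod \<T> f; z \<in> arrs \<T>; Cod \<T> z = Dom \<T> f\<rbrakk>
    \<Longrightarrow> k \<bullet> f \<bullet> z = h \<bullet> z"
  by auto

lemma Comp_Id' [simp]:
  "\<lbrakk>f \<in> arrs \<T>; Cod \<T> f = y\<rbrakk> \<Longrightarrow> Id \<T> y \<bullet> f = f"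
  "\<lbrakk>f \<in> arrs \<T>; Dom \<T> f = x\<rbrakk> \<Longrightarrow> f \<bullet> Id \<T> x = f"
  using Comp_Id_left Comp_Id_right by (auto simp: homs_iff)

end

text \<open>
  A shadow whose cyclicity maps need not be involutive, so that moving \<open>N\<close> past the base point is not
  undone by moving \<open>M\<close>. The laws concern the 1-cell that moves: moving \<open>N \<odot> P\<close> is moving \<open>P\<close> and then
  \<open>N\<close>, and moving a unit 1-cell does nothing.
\<close>
locale weak_shadow = bicategory \<B> + category \<T>
  for \<B> :: "('o, 'm, 'c) bicat" (structure)
    and \<T> :: "('x, 'a) cat" +
  fixes Sh :: "('m, 'c, 'x, 'a) shadow_data"
  assumes sh0_obj: "\<lbrakk>M \<in> cells1 \<B>; src \<B> M = trg \<B> M\<rbrakk> \<Longrightarrow> sh0 Sh M \<in> objs \<T>"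
    and sh1_arr [simp]: "\<lbrakk>f \<in> cells2 \<B>; src \<B> (dom2 \<B> f) = trg \<B> (dom2 \<B> f)\<rbrakk> \<Longrightarrow> sh1 Sh f \<in> arrs \<T>"
    and sh1_Dom [simp]: "\<lbrakk>f \<in> cells2 \<B>; src \<B> (dom2 \<B> f) = trg \<B> (dom2 \<B> f)\<rbrakk>
      \<Longrightarrow> Dom \<T> (sh1 Sh f) = sh0 Sh (dom2 \<B> f)"
    and sh1_Cod [simp]: "\<lbrakk>f \<in> cells2 \<B>; src \<B> (dom2 \<B> f) = trg \<B> (dom2 \<B> f)\<rbrakk>
      \<Longrightarrow> Cod \<T> (sh1 Sh f) = sh0 Sh (cod2 \<B> f)"
    and sh1_Id [simp]: "\<lbrakk>M \<in> cells1 \<B>; src \<B> M = trg \<B> M\<rbrakk>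
      \<Longrightarrow> sh1 Sh (id2 \<B> M) = Id \<T> (sh0 Sh M)"
    and sh1_vcomp: "\<lbrakk>f \<in> cells2 \<B>; k \<in> cells2 \<B>; dom2 \<B> k = cod2 \<B> f;
        src \<B> (dom2 \<B> f) = trg \<B> (dom2 \<B> f)\<rbrakk>
      \<Longrightarrow> sh1 Sh (k \<cdot> f) = sh1 Sh k \<bullet>\<^bsub>\<T>\<^esub> sh1 Sh f"
    and cyc_arr [simp]: "\<lbrakk>M \<in> cells1 \<B>; N \<in> cells1 \<B>; src \<B> N = trg \<B> M; src \<B> M = trg \<B> N\<rbrakk>
      \<Longrightarrow> cyc Sh M N \<in> arrs \<T>"
    and cyc_Dom [simp]: "\<lbrakk>M \<in> cells1 \<B>; N \<in> cells1 \<B>; src \<B> N = trg \<B> M; src \<B> M = trg \<B> N\<rbrakk>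
      \<Longrightarrow> Dom \<T> (cyc Sh M N) = sh0 Sh (M \<odot> N)"
    and cyc_Cod [simp]: "\<lbrakk>M \<in> cells1 \<B>; N \<in> cells1 \<B>; src \<B> N = trg \<B> M; src \<B> M = trg \<B> N\<rbrakk>
      \<Longrightarrow> Cod \<T> (cyc Sh M N) = sh0 Sh (N \<odot> M)"
    and cyc_slide: "\<lbrakk>f \<in> cells2 \<B>; k \<in> cells2 \<B>; src \<B> (dom2 \<B> k) = trg \<B> (dom2 \<B> f);
        src \<B> (dom2 \<B> f) = trg \<B> (dom2 \<B> k)\<rbrakk>
      \<Longrightarrow> cyc Sh (cod2 \<B> f) (cod2 \<B> k) \<bullet>\<^bsub>\<T>\<^esub> sh1 Sh (f \<odot>\<odot> k)
        = sh1 Sh (k \<odot>\<odot> f) \<bullet>\<^bsub>\<T>\<^esub> cyc Sh (dom2 \<B> f) (dom2 \<B> k)"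
    and cyc_hcomp_right: "\<lbrakk>M \<in> cells1 \<B>; N \<in> cells1 \<B>; P \<in> cells1 \<B>; src \<B> N = trg \<B> M;
        src \<B> P = trg \<B> N; src \<B> M = trg \<B> P\<rbrakk>
      \<Longrightarrow> cyc Sh M (N \<odot> P)
        = sh1 Sh (inv2 \<B> (assoc \<B> N P M)) \<bullet>\<^bsub>\<T>\<^esub> cyc Sh (P \<odot> M) N
          \<bullet>\<^bsub>\<T>\<^esub> sh1 Sh (inv2 \<B> (assoc \<B> P M N)) \<bullet>\<^bsub>\<T>\<^esub> cyc Sh (M \<odot> N) P
          \<bullet>\<^bsub>\<T>\<^esub> sh1 Sh (inv2 \<B> (assoc \<B> M N P))"
    and cyc_unit: "\<lbrakk>M \<in> cells1 \<B>; trg \<B> M = R; src \<B> M = R\<rbrakk>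
      \<Longrightarrow> sh1 Sh (lunit \<B> M) \<bullet>\<^bsub>\<T>\<^esub> cyc Sh M (unit1 \<B> R) = sh1 Sh (runit \<B> M)"

text \<open>
  The formula of the twisted trace for arbitrary cyclicity maps. The twist is thereby hidden in the
  bicategory and the cyclicity maps, and only their laws matter.
\<close>
definition trace ::
  "('o, 'm, 'c) bicat \<Rightarrow> ('x, 'a) cat \<Rightarrow> ('m, 'c, 'x, 'a) shadow_data
    \<Rightarrow> 'm \<Rightarrow> 'm \<Rightarrow> 'c \<Rightarrow> 'c \<Rightarrow> 'm \<Rightarrow> 'm \<Rightarrow> 'c \<Rightarrow> 'a" where
  "trace \<B> \<T> Sh M D \<eta> \<epsilon> X Y f =
      sh1 Sh (lunit \<B> Y)
      \<bullet>\<^bsub>\<T>\<^esub> sh1 Sh (\<epsilon> \<odot>\<odot>\<^bsub>\<B>\<^esub> id2 \<B> Y)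
      \<bullet>\<^bsub>\<T>\<^esub> sh1 Sh (inv2 \<B> (assoc \<B> M D Y))
      \<bullet>\<^bsub>\<T>\<^esub> cyc Sh (D \<odot>\<^bsub>\<B>\<^esub> Y) M
      \<bullet>\<^bsub>\<T>\<^esub> sh1 Sh (inv2 \<B> (assoc \<B> D Y M))
      \<bullet>\<^bsub>\<T>\<^esub> sh1 Sh (id2 \<B> D \<odot>\<odot>\<^bsub>\<B>\<^esub> f)
      \<bullet>\<^bsub>\<T>\<^esub> sh1 Sh (assoc \<B> D M X)
      \<bullet>\<^bsub>\<T>\<^esub> sh1 Sh (\<eta> \<odot>\<odot>\<^bsub>\<B>\<^esub> id2 \<B> X)
      \<bullet>\<^bsub>\<T>\<^esub> sh1 Sh (inv2 \<B> (lunit \<B> X))"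

context bicategory
begin

lemma left_dual_strict:
  assumes dual: "left_dual \<B> M D \<eta> \<epsilon>"
  defines "\<eta>' \<equiv> strict (Empty (trg \<B> M)) (Cat (Atom D) (Atom M)) \<eta>"
    and "\<epsilon>' \<equiv> strict (Cat (Atom M) (Atom D)) (Empty (src \<B> M)) \<epsilon>"
  assumes X: "X \<in> cells1 \<B>" "src \<B> X = trg \<B> M"
  shows "\<epsilon>' (M \<odot> X) \<cdot> (M \<triangleright> \<eta>' X) = id2 \<B> (M \<odot> X)"
proof -
  have [simp]: "M \<in> cells1 \<B>" "D \<in> cells1 \<B>" "src \<B> D = trg \<B> M" "trg \<B> D = src \<B> M"
    "\<eta> \<in> cells2 \<B>" "dom2 \<B> \<eta> = unit1 \<B> (trg \<B> M)" "cod2 \<B> \<eta> = D \<odot> M"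
    "\<epsilon> \<in> cells2 \<B>" "cod2 \<B> \<epsilon> = unit1 \<B> (src \<B> M)" "dom2 \<B> \<epsilon> = M \<odot> D"
    using dual by (auto simp: left_dual_def hom1_iff hom2_iff)
  have \<eta>': "rep (Empty (trg \<B> M)) (Cat (Atom D) (Atom M)) \<eta> \<eta>'"
    unfolding \<eta>'_def by (rule rep_strict) simp_all
  have \<epsilon>': "rep (Cat (Atom M) (Atom D)) (Empty (src \<B> M)) \<epsilon> \<epsilon>'"
    unfolding \<epsilon>'_def by (rule rep_strict) simp_all
  note [simp] = rep_cell[OF \<eta>'] rep_cell[OF \<epsilon>'] X
  have zigzag: "lunit \<B> M \<cdot> (\<epsilon> \<triangleleft> M) \<cdot> inv2 \<B> (assoc \<B> M D M) \<cdot> (M \<triangleright> \<eta>) \<cdot> inv2 \<B> (runit \<B> M) = id2 \<B> M"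
    using dual by (simp add: left_dual_def)
  show ?thesis
    by (rule rep_eqD[OF zigzag, where s = "Atom M" and t = "Atom M" and X = X],
        (rule rep_rules \<eta>' \<epsilon>' | (simp; fail))+)
qed

end

context weak_shadow
begin

lemma sh1_vcomp_prolong:
  "\<lbrakk>f \<in> cells2 \<B>; k \<in> cells2 \<B>; dom2 \<B> k = cod2 \<B> f; src \<B> (dom2 \<B> f) = trg \<B> (dom2 \<B> f);
    z \<in> arrs \<T>; Cod \<T> z = sh0 Sh (dom2 \<B> f)\<rbrakk>
   \<Longrightarrow> sh1 Sh k \<bullet>\<^bsub>\<T>\<^esub> sh1 Sh f \<bullet>\<^bsub>\<T>\<^esub> z = sh1 Sh (k \<cdot> f) \<bullet>\<^bsub>\<T>\<^esub> z"
  by (rule Comp_prolong) (simp_all add: sh1_vcomp)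

text \<open>
  The law for a composite, solved for its two moves: first \<open>N\<close> and then \<open>P\<close> passes the base point.
\<close>
lemma cyc_rotate:
  assumes [simp]: "N \<in> cells1 \<B>" "A \<in> cells1 \<B>" "P \<in> cells1 \<B>" "src \<B> A = trg \<B> N" "src \<B> P = trg \<B> A"
    "src \<B> N = trg \<B> P"
  shows "cyc Sh (N \<odot> A) P \<bullet>\<^bsub>\<T>\<^esub> sh1 Sh (inv2 \<B> (assoc \<B> N A P)) \<bullet>\<^bsub>\<T>\<^esub> cyc Sh (A \<odot> P) N
    = sh1 Sh (assoc \<B> P N A) \<bullet>\<^bsub>\<T>\<^esub> cyc Sh A (P \<odot> N) \<bullet>\<^bsub>\<T>\<^esub> sh1 Sh (assoc \<B> A P N)"
  by (simp add: cyc_hcomp_right[of A P N] sh1_vcomp_prolong sh1_vcomp[symmetric] del: sh1_Id)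
    (simp add: sh1_vcomp_prolong)

lemma trace_eq:
  assumes [simp]: "M \<in> cells1 \<B>" "D \<in> cells1 \<B>" "X \<in> cells1 \<B>" "Y \<in> cells1 \<B>"
    "src \<B> M = R" "trg \<B> M = S" "src \<B> D = S" "trg \<B> D = R"
    "src \<B> X = S" "trg \<B> X = S" "src \<B> Y = R" "trg \<B> Y = R"
    "\<eta> \<in> cells2 \<B>" "dom2 \<B> \<eta> = unit1 \<B> S" "cod2 \<B> \<eta> = D \<odot> M"
    "\<epsilon> \<in> cells2 \<B>" "dom2 \<B> \<epsilon> = M \<odot> D" "cod2 \<B> \<epsilon> = unit1 \<B> R"
    "f \<in> cells2 \<B>" "dom2 \<B> f = M \<odot> X" "cod2 \<B> f = Y \<odot> M"
  shows "trace \<B> \<T> Sh M D \<eta> \<epsilon> X Y f =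
     sh1 Sh (lunit \<B> Y \<cdot> (\<epsilon> \<triangleleft> Y) \<cdot> inv2 \<B> (assoc \<B> M D Y)) \<bullet>\<^bsub>\<T>\<^esub> cyc Sh (D \<odot> Y) M
     \<bullet>\<^bsub>\<T>\<^esub> sh1 Sh (inv2 \<B> (assoc \<B> D Y M) \<cdot> (D \<triangleright> f) \<cdot> assoc \<B> D M X \<cdot> (\<eta> \<triangleleft> X) \<cdot> inv2 \<B> (lunit \<B> X))"
proof -
  have [simp]: "R \<in> cells0 \<B>" "S \<in> cells0 \<B>"
    using src_closed[of M] trg_closed[of M] by simp_all
  show ?thesis by (simp add: trace_def sh1_vcomp)
qed

text \<open>
  Below, \<open>E\<close> and \<open>D\<close> are the left duals of \<open>M\<close> and \<open>N\<close>. The common value of both sides is the composite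
  through \<open>cyc Sh (K \<odot> E) (M \<odot> Q)\<close>.
\<close>
theorem trace_cyclic:
  assumes M: "M \<in> hom1 \<B> R S" "left_dual \<B> M E \<eta>M \<epsilon>M"
    and N: "N \<in> hom1 \<B> U T" "left_dual \<B> N D \<eta>N \<epsilon>N"
    and Q: "Q \<in> hom1 \<B> S T" and P: "P \<in> hom1 \<B> R U"
    and K: "K \<in> hom1 \<B> T S" and L: "L \<in> hom1 \<B> U R"
    and f: "f \<in> hom2 \<B> (M \<odot> Q) (P \<odot> N)"
    and h: "h \<in> hom2 \<B> (N \<odot> K) (L \<odot> M)"
    and F: "F = inv2 \<B> (assoc \<B> L P N) \<cdot> (L \<triangleright> f) \<cdot> assoc \<B> L M Q \<cdot> (h \<triangleleft> Q) \<cdot> inv2 \<B> (assoc \<B> N K Q)"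
    and H: "H = inv2 \<B> (assoc \<B> P L M) \<cdot> (P \<triangleright> h) \<cdot> assoc \<B> P N K \<cdot> (f \<triangleleft> K) \<cdot> inv2 \<B> (assoc \<B> M Q K)"
  shows "cyc Sh L P \<bullet>\<^bsub>\<T>\<^esub> trace \<B> \<T> Sh N D \<eta>N \<epsilon>N (K \<odot> Q) (L \<odot> P) F
    = trace \<B> \<T> Sh M E \<eta>M \<epsilon>M (Q \<odot> K) (P \<odot> L) H \<bullet>\<^bsub>\<T>\<^esub> cyc Sh K Q"
proof -
  have cells1 [simp]:
    "M \<in> cells1 \<B>" "src \<B> M = R" "trg \<B> M = S" "N \<in> cells1 \<B>" "src \<B> N = U" "trg \<B> N = T"
    "Q \<in> cells1 \<B>" "src \<B> Q = S" "trg \<B> Q = T" "P \<in> cells1 \<B>" "src \<B> P = R" "trg \<B> P = U"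
    "K \<in> cells1 \<B>" "src \<B> K = T" "trg \<B> K = S" "L \<in> cells1 \<B>" "src \<B> L = U" "trg \<B> L = R"
    using M N Q P K L by (auto simp: hom1_iff)
  have dual_cells [simp]: "E \<in> cells1 \<B>" "src \<B> E = S" "trg \<B> E = R"
    "D \<in> cells1 \<B>" "src \<B> D = T" "trg \<B> D = U"
    "\<eta>M \<in> cells2 \<B>" "dom2 \<B> \<eta>M = unit1 \<B> S" "cod2 \<B> \<eta>M = E \<odot> M"
    "\<epsilon>M \<in> cells2 \<B>" "dom2 \<B> \<epsilon>M = M \<odot> E" "cod2 \<B> \<epsilon>M = unit1 \<B> R"
    "\<eta>N \<in> cells2 \<B>" "dom2 \<B> \<eta>N = unit1 \<B> T" "cod2 \<B> \<eta>N = D \<odot> N"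
    "\<epsilon>N \<in> cells2 \<B>" "dom2 \<B> \<epsilon>N = N \<odot> D" "cod2 \<B> \<epsilon>N = unit1 \<B> U"
    using M(2) N(2) by (auto simp: left_dual_def hom1_iff hom2_iff)
  have fh [simp]: "f \<in> cells2 \<B>" "dom2 \<B> f = M \<odot> Q" "cod2 \<B> f = P \<odot> N"
    "h \<in> cells2 \<B>" "dom2 \<B> h = N \<odot> K" "cod2 \<B> h = L \<odot> M"
    using f h by (auto simp: hom2_iff)
  have cells0 [simp]: "R \<in> cells0 \<B>" "S \<in> cells0 \<B>" "T \<in> cells0 \<B>" "U \<in> cells0 \<B>"
    using src_closed[of M] trg_closed[of M] src_closed[of N] trg_closed[of N] by simp_all
  have FH [simp]: "F \<in> cells2 \<B>" "dom2 \<B> F = N \<odot> (K \<odot> Q)" "cod2 \<B> F = (L \<odot> P) \<odot> N"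
    "H \<in> cells2 \<B>" "dom2 \<B> H = M \<odot> (Q \<odot> K)" "cod2 \<B> H = (P \<odot> L) \<odot> M"
    by (simp_all add: F H)

  \<comment> \<open>\<open>h'\<close> is the mate of \<open>h\<close>. The 2-cell \<open>p\<close> creates \<open>E \<odot> M\<close> between \<open>K\<close> and \<open>Q\<close>, and \<open>q\<close> annihilates
    \<open>N \<odot> D\<close>; \<open>pN\<close>, \<open>qN\<close> and \<open>pM\<close>, \<open>qM\<close> are the parts of the two traces before and after the cyclicity
    map.\<close>
  define h' where "h' = (D \<triangleright> (runit \<B> L \<cdot> (L \<triangleright> \<epsilon>M) \<cdot> assoc \<B> L M E \<cdot> (h \<triangleleft> E) \<cdot> inv2 \<B> (assoc \<B> N K E)))
    \<cdot> assoc \<B> D N (K \<odot> E) \<cdot> (\<eta>N \<triangleleft> (K \<odot> E)) \<cdot> inv2 \<B> (lunit \<B> (K \<odot> E))"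
  define e where "e = assoc \<B> E M Q \<cdot> (\<eta>M \<triangleleft> Q) \<cdot> inv2 \<B> (lunit \<B> Q)"
  define p where "p = inv2 \<B> (assoc \<B> K E (M \<odot> Q)) \<cdot> (K \<triangleright> e)"
  define k where "k = H \<cdot> assoc \<B> M Q K"
  define q where "q = lunit \<B> L \<cdot> (\<epsilon>N \<triangleleft> L) \<cdot> inv2 \<B> (assoc \<B> N D L)"
  define b where "b = inv2 \<B> (assoc \<B> D L P)"
  define pN where "pN = inv2 \<B> (assoc \<B> D (L \<odot> P) N) \<cdot> (D \<triangleright> F) \<cdot> assoc \<B> D N (K \<odot> Q)
    \<cdot> (\<eta>N \<triangleleft> (K \<odot> Q)) \<cdot> inv2 \<B> (lunit \<B> (K \<odot> Q))"
  define qN where "qN = lunit \<B> (L \<odot> P) \<cdot> (\<epsilon>N \<triangleleft> (L \<odot> P)) \<cdot> inv2 \<B> (assoc \<B> N D (L \<odot> P))"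
  define pM where "pM = inv2 \<B> (assoc \<B> E (P \<odot> L) M) \<cdot> (E \<triangleright> H) \<cdot> assoc \<B> E M (Q \<odot> K)
    \<cdot> (\<eta>M \<triangleleft> (Q \<odot> K)) \<cdot> inv2 \<B> (lunit \<B> (Q \<odot> K))"
  define qM where "qM = lunit \<B> (P \<odot> L) \<cdot> (\<epsilon>M \<triangleleft> (P \<odot> L)) \<cdot> inv2 \<B> (assoc \<B> M E (P \<odot> L))"

  have h' [simp]: "h' \<in> cells2 \<B>" "dom2 \<B> h' = K \<odot> E" "cod2 \<B> h' = D \<odot> L"
    by (simp_all add: h'_def)
  have e [simp]: "e \<in> cells2 \<B>" "dom2 \<B> e = Q" "cod2 \<B> e = E \<odot> (M \<odot> Q)"
    by (simp_all add: e_def)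
  have p [simp]: "p \<in> cells2 \<B>" "dom2 \<B> p = K \<odot> Q" "cod2 \<B> p = (K \<odot> E) \<odot> (M \<odot> Q)"
    by (simp_all add: p_def)
  have k [simp]: "k \<in> cells2 \<B>" "dom2 \<B> k = (M \<odot> Q) \<odot> K" "cod2 \<B> k = (P \<odot> L) \<odot> M"
    by (simp_all add: k_def)
  have q [simp]: "q \<in> cells2 \<B>" "dom2 \<B> q = N \<odot> (D \<odot> L)" "cod2 \<B> q = L"
    by (simp_all add: q_def)
  have b [simp]: "b \<in> cells2 \<B>" "dom2 \<B> b = D \<odot> (L \<odot> P)" "cod2 \<B> b = (D \<odot> L) \<odot> P"
    by (simp_all add: b_def)
  have pN [simp]: "pN \<in> cells2 \<B>" "dom2 \<B> pN = K \<odot> Q" "cod2 \<B> pN = (D \<odot> (L \<odot> P)) \<odot> N"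
    by (simp_all add: pN_def)
  have qN [simp]: "qN \<in> cells2 \<B>" "dom2 \<B> qN = N \<odot> (D \<odot> (L \<odot> P))" "cod2 \<B> qN = L \<odot> P"
    by (simp_all add: qN_def)
  have pM [simp]: "pM \<in> cells2 \<B>" "dom2 \<B> pM = Q \<odot> K" "cod2 \<B> pM = (E \<odot> (P \<odot> L)) \<odot> M"
    by (simp_all add: pM_def)
  have qM [simp]: "qM \<in> cells2 \<B>" "dom2 \<B> qM = M \<odot> (E \<odot> (P \<odot> L))" "cod2 \<B> qM = P \<odot> L"
    by (simp_all add: qM_def)

  let ?M = "Atom M" and ?N = "Atom N" and ?Q = "Atom Q" and ?P = "Atom P" and ?K = "Atom K"
    and ?L = "Atom L" and ?D = "Atom D" and ?E = "Atom E"
  define \<eta>1 where "\<eta>1 = strict (Empty S) (Cat ?E ?M) \<eta>M"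
  define \<epsilon>1 where "\<epsilon>1 = strict (Cat ?M ?E) (Empty R) \<epsilon>M"
  define \<eta>2 where "\<eta>2 = strict (Empty T) (Cat ?D ?N) \<eta>N"
  define \<epsilon>2 where "\<epsilon>2 = strict (Cat ?N ?D) (Empty U) \<epsilon>N"
  define f1 where "f1 = strict (Cat ?M ?Q) (Cat ?P ?N) f"
  define h1 where "h1 = strict (Cat ?N ?K) (Cat ?L ?M) h"
  have r: "rep (Empty S) (Cat ?E ?M) \<eta>M \<eta>1" "rep (Cat ?M ?E) (Empty R) \<epsilon>M \<epsilon>1"
    "rep (Empty T) (Cat ?D ?N) \<eta>N \<eta>2" "rep (Cat ?N ?D) (Empty U) \<epsilon>N \<epsilon>2"
    "rep (Cat ?M ?Q) (Cat ?P ?N) f f1" "rep (Cat ?N ?K) (Cat ?L ?M) h h1"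
    unfolding \<eta>1_def \<epsilon>1_def \<eta>2_def \<epsilon>2_def f1_def h1_def by (rule rep_strict; simp)+
  note r_cells [simp] = r[THEN rep_cell(1)] r[THEN rep_cell(2)] r[THEN rep_cell(3)]
  have zigzag_M: "\<epsilon>1 (M \<odot> X) \<cdot> (M \<triangleright> \<eta>1 X) = id2 \<B> (M \<odot> X)" if "X \<in> cells1 \<B>" "src \<B> X = S" for X
    using left_dual_strict[OF M(2), of X] that by (simp add: \<eta>1_def \<epsilon>1_def)
  have zigzag_N: "\<epsilon>2 (N \<odot> X) \<cdot> (N \<triangleright> \<eta>2 X) = id2 \<B> (N \<odot> X)" if "X \<in> cells1 \<B>" "src \<B> X = T" for X
    using left_dual_strict[OF N(2), of X] that by (simp add: \<eta>2_def \<epsilon>2_def)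

  \<comment> \<open>Creating \<open>D \<odot> N\<close> and applying \<open>h\<close> and \<open>f\<close> is creating \<open>E \<odot> M\<close> and applying \<open>h'\<close> and \<open>f\<close>: the pair
    \<open>M \<odot> E\<close> inside \<open>h'\<close> cancels against \<open>\<eta>M\<close>. In strict form, \<open>\<eta>M\<close> and \<open>f\<close> are first moved to the left
    past \<open>\<eta>N\<close> and \<open>h\<close>, until they meet \<open>\<epsilon>M\<close>.\<close>
  have A: "assoc \<B> (D \<odot> L) P N \<cdot> (b \<triangleleft> N) \<cdot> pN = (h' \<odot>\<odot> f) \<cdot> p"
  proof -
    have strict_eq: "(D \<triangleright> L \<triangleright> f1 X) \<cdot> (D \<triangleright> h1 (Q \<odot> X)) \<cdot> \<eta>2 (K \<odot> (Q \<odot> X))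
      = (D \<triangleright> L \<triangleright> \<epsilon>1 (P \<odot> (N \<odot> X))) \<cdot> (D \<triangleright> h1 (E \<odot> (P \<odot> (N \<odot> X))))
        \<cdot> \<eta>2 (K \<odot> (E \<odot> (P \<odot> (N \<odot> X)))) \<cdot> (K \<triangleright> E \<triangleright> f1 X) \<cdot> (K \<triangleright> \<eta>1 (Q \<odot> X))"
      if X [simp]: "X \<in> cells1 \<B>" "src \<B> X = T" for X
    proof -
      define y where "y = (E \<triangleright> f1 X) \<cdot> \<eta>1 (Q \<odot> X)"
      have y [simp]: "y \<in> cells2 \<B>" "dom2 \<B> y = Q \<odot> X" "cod2 \<B> y = E \<odot> (P \<odot> (N \<odot> X))"
        by (simp_all add: y_def)
      have "\<epsilon>1 (P \<odot> (N \<odot> X)) \<cdot> (M \<triangleright> y)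
          = (\<epsilon>1 (P \<odot> (N \<odot> X)) \<cdot> (M \<triangleright> E \<triangleright> f1 X)) \<cdot> (M \<triangleright> \<eta>1 (Q \<odot> X))"
        by (simp add: y_def whisker_left_vcomp)
      also have "\<dots> = f1 X"
        using rep_natural[OF r(2), of "f1 X"] by (simp add: zigzag_M)
      finally have 1: "\<epsilon>1 (P \<odot> (N \<odot> X)) \<cdot> (M \<triangleright> y) = f1 X" .
      let ?W = "E \<odot> (P \<odot> (N \<odot> X))"
      have "(D \<triangleright> L \<triangleright> \<epsilon>1 (P \<odot> (N \<odot> X))) \<cdot> (D \<triangleright> h1 ?W) \<cdot> \<eta>2 (K \<odot> ?W) \<cdot> (K \<triangleright> y)
          = (D \<triangleright> ((L \<triangleright> \<epsilon>1 (P \<odot> (N \<odot> X))) \<cdot> h1 ?W \<cdot> (N \<triangleright> K \<triangleright> y))) \<cdot> \<eta>2 (K \<odot> (Q \<odot> X))"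
        using rep_natural[OF r(3), of "K \<triangleright> y"] by (simp add: whisker_left_vcomp)
      also have "h1 ?W \<cdot> (N \<triangleright> K \<triangleright> y) = (L \<triangleright> M \<triangleright> y) \<cdot> h1 (Q \<odot> X)"
        using rep_natural[OF r(6), of y] by simp
      also have "(L \<triangleright> \<epsilon>1 (P \<odot> (N \<odot> X))) \<cdot> \<dots> = (L \<triangleright> (\<epsilon>1 (P \<odot> (N \<odot> X)) \<cdot> (M \<triangleright> y))) \<cdot> h1 (Q \<odot> X)"
        by (simp add: whisker_left_vcomp)
      also have "\<epsilon>1 (P \<odot> (N \<odot> X)) \<cdot> (M \<triangleright> y) = f1 X"
        by (rule 1)
      finally show ?thesis
        by (simp add: y_def whisker_left_vcomp)
    qed
    show ?thesis
      unfolding F b_def pN_def h'_def p_def e_def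
      by (rule rep_eqI[where s = "Cat ?K ?Q" and t = "Cat (Cat ?D ?L) (Cat ?P ?N)"],
          (rule rep_rules r | (simp add: whisker_left_vcomp strict_eq; fail))+)
  qed
  \<comment> \<open>The last parts of the two sides agree: the pair \<open>N \<odot> D\<close> that \<open>h'\<close> creates cancels against \<open>q\<close>.\<close>
  have C: "(P \<triangleright> q) \<cdot> assoc \<B> P N (D \<odot> L) \<cdot> (f \<odot>\<odot> h')
      = runit \<B> (P \<odot> L) \<cdot> ((P \<odot> L) \<triangleright> \<epsilon>M) \<cdot> assoc \<B> (P \<odot> L) M E \<cdot> (k \<triangleleft> E) \<cdot> inv2 \<B> (assoc \<B> (M \<odot> Q) K E)"
  proof -
    have strict_eq: "(P \<triangleright> \<epsilon>2 (L \<odot> X)) \<cdot> f1 (D \<odot> (L \<odot> X)) \<cdot> (M \<triangleright> Q \<triangleright> D \<triangleright> L \<triangleright> \<epsilon>1 X)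
        \<cdot> (M \<triangleright> Q \<triangleright> D \<triangleright> h1 (E \<odot> X)) \<cdot> (M \<triangleright> Q \<triangleright> \<eta>2 (K \<odot> (E \<odot> X)))
      = (P \<triangleright> L \<triangleright> \<epsilon>1 X) \<cdot> (P \<triangleright> h1 (E \<odot> X)) \<cdot> f1 (K \<odot> (E \<odot> X))"
      if X [simp]: "X \<in> cells1 \<B>" "src \<B> X = R" for X
    proof -
      define z where "z = (L \<triangleright> \<epsilon>1 X) \<cdot> h1 (E \<odot> X)"
      have z [simp]: "z \<in> cells2 \<B>" "dom2 \<B> z = N \<odot> (K \<odot> (E \<odot> X))" "cod2 \<B> z = L \<odot> X"
        by (simp_all add: z_def)
      define w where "w = (D \<triangleright> z) \<cdot> \<eta>2 (K \<odot> (E \<odot> X))"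
      have w [simp]: "w \<in> cells2 \<B>" "dom2 \<B> w = K \<odot> (E \<odot> X)" "cod2 \<B> w = D \<odot> (L \<odot> X)"
        by (simp_all add: w_def)
      have "\<epsilon>2 (L \<odot> X) \<cdot> (N \<triangleright> w)
          = (\<epsilon>2 (L \<odot> X) \<cdot> (N \<triangleright> D \<triangleright> z)) \<cdot> (N \<triangleright> \<eta>2 (K \<odot> (E \<odot> X)))"
        by (simp add: w_def whisker_left_vcomp)
      also have "\<dots> = z"
        using rep_natural[OF r(4), of z] by (simp add: zigzag_N)
      finally have 1: "\<epsilon>2 (L \<odot> X) \<cdot> (N \<triangleright> w) = z" .
      have "(P \<triangleright> \<epsilon>2 (L \<odot> X)) \<cdot> f1 (D \<odot> (L \<odot> X)) \<cdot> (M \<triangleright> Q \<triangleright> w)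
          = (P \<triangleright> (\<epsilon>2 (L \<odot> X) \<cdot> (N \<triangleright> w))) \<cdot> f1 (K \<odot> (E \<odot> X))"
        using rep_natural[OF r(5), of w] by (simp add: whisker_left_vcomp)
      then show ?thesis
        unfolding 1 by (simp add: w_def z_def whisker_left_vcomp)
    qed
    show ?thesis
      unfolding k_def H q_def h'_def
      by (rule rep_eqI[where s = "Cat (Cat ?M ?Q) (Cat ?K ?E)" and t = "Cat ?P ?L"],
          (rule rep_rules r | (simp add: whisker_left_vcomp strict_eq; fail))+)
  qed
  have B: "pM = inv2 \<B> (assoc \<B> E (P \<odot> L) M) \<cdot> (E \<triangleright> k) \<cdot> assoc \<B> E (M \<odot> Q) K \<cdot> (e \<triangleleft> K)"
    unfolding k_def H pM_def e_def
    by (rule rep_eqI[where s = "Cat ?Q ?K" and t = "Cat (Cat ?E (Cat ?P ?L)) ?M"],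
        (rule rep_rules r | (simp add: whisker_left_vcomp; fail))+)
  have qN_eq: "qN = (q \<triangleleft> P) \<cdot> inv2 \<B> (assoc \<B> N (D \<odot> L) P) \<cdot> (N \<triangleright> b)"
    unfolding qN_def q_def b_def
    by (rule rep_eqI[where s = "Cat ?N (Cat ?D (Cat ?L ?P))" and t = "Cat ?L ?P"],
        (rule rep_rules r | (simp add: whisker_left_vcomp; fail))+)
  \<comment> \<open>The trace over \<open>N\<close>: annihilating \<open>N \<odot> D\<close> is postponed until \<open>P\<close> has moved; then \<open>N\<close> and \<open>P\<close> have moved
    in succession.\<close>
  have "cyc Sh L P \<bullet>\<^bsub>\<T>\<^esub> trace \<B> \<T> Sh N D \<eta>N \<epsilon>N (K \<odot> Q) (L \<odot> P) F
      = cyc Sh L P \<bullet>\<^bsub>\<T>\<^esub> sh1 Sh qN \<bullet>\<^bsub>\<T>\<^esub> cyc Sh (D \<odot> (L \<odot> P)) N \<bullet>\<^bsub>\<T>\<^esub> sh1 Sh pN"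
    by (simp add: trace_eq[where R = U and S = T] pN_def qN_def)
  also have "\<dots> = (cyc Sh L P \<bullet>\<^bsub>\<T>\<^esub> sh1 Sh (q \<triangleleft> P)) \<bullet>\<^bsub>\<T>\<^esub> sh1 Sh (inv2 \<B> (assoc \<B> N (D \<odot> L) P))
      \<bullet>\<^bsub>\<T>\<^esub> (sh1 Sh (N \<triangleright> b) \<bullet>\<^bsub>\<T>\<^esub> cyc Sh (D \<odot> (L \<odot> P)) N) \<bullet>\<^bsub>\<T>\<^esub> sh1 Sh pN"
    by (simp add: qN_eq sh1_vcomp)
  also have "\<dots> = (sh1 Sh (P \<triangleright> q) \<bullet>\<^bsub>\<T>\<^esub> cyc Sh (N \<odot> (D \<odot> L)) P) \<bullet>\<^bsub>\<T>\<^esub> sh1 Sh (inv2 \<B> (assoc \<B> N (D \<odot> L) P))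
      \<bullet>\<^bsub>\<T>\<^esub> (cyc Sh ((D \<odot> L) \<odot> P) N \<bullet>\<^bsub>\<T>\<^esub> sh1 Sh (b \<triangleleft> N)) \<bullet>\<^bsub>\<T>\<^esub> sh1 Sh pN"
    using cyc_slide[of q "id2 \<B> P"] cyc_slide[of b "id2 \<B> N"] by simp
  also have "\<dots> = sh1 Sh (P \<triangleright> q) \<bullet>\<^bsub>\<T>\<^esub> (cyc Sh (N \<odot> (D \<odot> L)) P \<bullet>\<^bsub>\<T>\<^esub> sh1 Sh (inv2 \<B> (assoc \<B> N (D \<odot> L) P))
      \<bullet>\<^bsub>\<T>\<^esub> cyc Sh ((D \<odot> L) \<odot> P) N) \<bullet>\<^bsub>\<T>\<^esub> sh1 Sh (b \<triangleleft> N) \<bullet>\<^bsub>\<T>\<^esub> sh1 Sh pN"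
    by simp
  also have "\<dots> = sh1 Sh (P \<triangleright> q) \<bullet>\<^bsub>\<T>\<^esub> sh1 Sh (assoc \<B> P N (D \<odot> L)) \<bullet>\<^bsub>\<T>\<^esub> cyc Sh (D \<odot> L) (P \<odot> N)
      \<bullet>\<^bsub>\<T>\<^esub> sh1 Sh (assoc \<B> (D \<odot> L) P N \<cdot> (b \<triangleleft> N) \<cdot> pN)"
    by (subst cyc_rotate) (simp_all add: sh1_vcomp)
  also have "\<dots> = sh1 Sh (P \<triangleright> q) \<bullet>\<^bsub>\<T>\<^esub> sh1 Sh (assoc \<B> P N (D \<odot> L))
      \<bullet>\<^bsub>\<T>\<^esub> (cyc Sh (D \<odot> L) (P \<odot> N) \<bullet>\<^bsub>\<T>\<^esub> sh1 Sh (h' \<odot>\<odot> f)) \<bullet>\<^bsub>\<T>\<^esub> sh1 Sh p"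
    by (subst A) (simp add: sh1_vcomp)
  also have "\<dots> = sh1 Sh (P \<triangleright> q) \<bullet>\<^bsub>\<T>\<^esub> sh1 Sh (assoc \<B> P N (D \<odot> L))
      \<bullet>\<^bsub>\<T>\<^esub> (sh1 Sh (f \<odot>\<odot> h') \<bullet>\<^bsub>\<T>\<^esub> cyc Sh (K \<odot> E) (M \<odot> Q)) \<bullet>\<^bsub>\<T>\<^esub> sh1 Sh p"
    using cyc_slide[of h' f] by simp
  also have "\<dots> = sh1 Sh ((P \<triangleright> q) \<cdot> assoc \<B> P N (D \<odot> L) \<cdot> (f \<odot>\<odot> h'))
      \<bullet>\<^bsub>\<T>\<^esub> cyc Sh (K \<odot> E) (M \<odot> Q) \<bullet>\<^bsub>\<T>\<^esub> sh1 Sh p"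
    by (simp add: sh1_vcomp)
  finally have lhs: "cyc Sh L P \<bullet>\<^bsub>\<T>\<^esub> trace \<B> \<T> Sh N D \<eta>N \<epsilon>N (K \<odot> Q) (L \<odot> P) F
    = sh1 Sh ((P \<triangleright> q) \<cdot> assoc \<B> P N (D \<odot> L) \<cdot> (f \<odot>\<odot> h')) \<bullet>\<^bsub>\<T>\<^esub> cyc Sh (K \<odot> E) (M \<odot> Q) \<bullet>\<^bsub>\<T>\<^esub> sh1 Sh p" .

  \<comment> \<open>The trace over \<open>M\<close>: \<open>E \<odot> M\<close> is created before \<open>Q\<close> moves, so that \<open>M \<odot> Q\<close>, then \<open>E\<close>, then \<open>M\<close> move.
    The last two moves merge into a move of \<open>M \<odot> E\<close>, which \<open>\<epsilon>M\<close> turns into a move of the unit.\<close>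
  have "trace \<B> \<T> Sh M E \<eta>M \<epsilon>M (Q \<odot> K) (P \<odot> L) H \<bullet>\<^bsub>\<T>\<^esub> cyc Sh K Q
      = sh1 Sh qM \<bullet>\<^bsub>\<T>\<^esub> cyc Sh (E \<odot> (P \<odot> L)) M \<bullet>\<^bsub>\<T>\<^esub> sh1 Sh pM \<bullet>\<^bsub>\<T>\<^esub> cyc Sh K Q"
    by (simp add: trace_eq[where R = R and S = S] pM_def qM_def)
  also have "\<dots> = sh1 Sh qM \<bullet>\<^bsub>\<T>\<^esub> cyc Sh (E \<odot> (P \<odot> L)) M \<bullet>\<^bsub>\<T>\<^esub> sh1 Sh (inv2 \<B> (assoc \<B> E (P \<odot> L) M))
      \<bullet>\<^bsub>\<T>\<^esub> sh1 Sh (E \<triangleright> k) \<bullet>\<^bsub>\<T>\<^esub> sh1 Sh (assoc \<B> E (M \<odot> Q) K) \<bullet>\<^bsub>\<T>\<^esub> (sh1 Sh (e \<triangleleft> K) \<bullet>\<^bsub>\<T>\<^esub> cyc Sh K Q)"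
    by (subst B) (simp add: sh1_vcomp)
  also have "sh1 Sh (e \<triangleleft> K) \<bullet>\<^bsub>\<T>\<^esub> cyc Sh K Q = cyc Sh K (E \<odot> (M \<odot> Q)) \<bullet>\<^bsub>\<T>\<^esub> sh1 Sh (K \<triangleright> e)"
    using cyc_slide[of "id2 \<B> K" e] by simp
  also have "cyc Sh K (E \<odot> (M \<odot> Q)) = sh1 Sh (inv2 \<B> (assoc \<B> E (M \<odot> Q) K)) \<bullet>\<^bsub>\<T>\<^esub> cyc Sh ((M \<odot> Q) \<odot> K) E
          \<bullet>\<^bsub>\<T>\<^esub> sh1 Sh (inv2 \<B> (assoc \<B> (M \<odot> Q) K E)) \<bullet>\<^bsub>\<T>\<^esub> cyc Sh (K \<odot> E) (M \<odot> Q)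
          \<bullet>\<^bsub>\<T>\<^esub> sh1 Sh (inv2 \<B> (assoc \<B> K E (M \<odot> Q)))"
    by (rule cyc_hcomp_right) simp_all
  also have "sh1 Sh (assoc \<B> E (M \<odot> Q) K) \<bullet>\<^bsub>\<T>\<^esub> (\<dots> \<bullet>\<^bsub>\<T>\<^esub> sh1 Sh (K \<triangleright> e))
      = cyc Sh ((M \<odot> Q) \<odot> K) E \<bullet>\<^bsub>\<T>\<^esub> sh1 Sh (inv2 \<B> (assoc \<B> (M \<odot> Q) K E))
        \<bullet>\<^bsub>\<T>\<^esub> cyc Sh (K \<odot> E) (M \<odot> Q) \<bullet>\<^bsub>\<T>\<^esub> sh1 Sh p"
    by (simp add: p_def sh1_vcomp sh1_vcomp_prolong)
  also have "sh1 Sh (E \<triangleright> k) \<bullet>\<^bsub>\<T>\<^esub> cyc Sh ((M \<odot> Q) \<odot> K) E \<bullet>\<^bsub>\<T>\<^esub> sh1 Sh (inv2 \<B> (assoc \<B> (M \<odot> Q) K E))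
        \<bullet>\<^bsub>\<T>\<^esub> cyc Sh (K \<odot> E) (M \<odot> Q) \<bullet>\<^bsub>\<T>\<^esub> sh1 Sh p
      = (cyc Sh ((P \<odot> L) \<odot> M) E \<bullet>\<^bsub>\<T>\<^esub> sh1 Sh (k \<triangleleft> E)) \<bullet>\<^bsub>\<T>\<^esub> sh1 Sh (inv2 \<B> (assoc \<B> (M \<odot> Q) K E))
        \<bullet>\<^bsub>\<T>\<^esub> cyc Sh (K \<odot> E) (M \<odot> Q) \<bullet>\<^bsub>\<T>\<^esub> sh1 Sh p"
    using cyc_slide[of k "id2 \<B> E"] by (intro Comp_prolong) simp_all
  also have "sh1 Sh qM \<bullet>\<^bsub>\<T>\<^esub> cyc Sh (E \<odot> (P \<odot> L)) M \<bullet>\<^bsub>\<T>\<^esub> sh1 Sh (inv2 \<B> (assoc \<B> E (P \<odot> L) M)) \<bullet>\<^bsub>\<T>\<^esub> \<dots>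
      = sh1 Sh qM \<bullet>\<^bsub>\<T>\<^esub> (cyc Sh (E \<odot> (P \<odot> L)) M \<bullet>\<^bsub>\<T>\<^esub> sh1 Sh (inv2 \<B> (assoc \<B> E (P \<odot> L) M))
        \<bullet>\<^bsub>\<T>\<^esub> cyc Sh ((P \<odot> L) \<odot> M) E) \<bullet>\<^bsub>\<T>\<^esub> sh1 Sh (k \<triangleleft> E) \<bullet>\<^bsub>\<T>\<^esub> sh1 Sh (inv2 \<B> (assoc \<B> (M \<odot> Q) K E))
        \<bullet>\<^bsub>\<T>\<^esub> cyc Sh (K \<odot> E) (M \<odot> Q) \<bullet>\<^bsub>\<T>\<^esub> sh1 Sh p"
    by simp
  also have "\<dots> = sh1 Sh (lunit \<B> (P \<odot> L)) \<bullet>\<^bsub>\<T>\<^esub> (sh1 Sh (\<epsilon>M \<triangleleft> (P \<odot> L)) \<bullet>\<^bsub>\<T>\<^esub> cyc Sh (P \<odot> L) (M \<odot> E))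
        \<bullet>\<^bsub>\<T>\<^esub> sh1 Sh (assoc \<B> (P \<odot> L) M E) \<bullet>\<^bsub>\<T>\<^esub> sh1 Sh (k \<triangleleft> E) \<bullet>\<^bsub>\<T>\<^esub> sh1 Sh (inv2 \<B> (assoc \<B> (M \<odot> Q) K E))
        \<bullet>\<^bsub>\<T>\<^esub> cyc Sh (K \<odot> E) (M \<odot> Q) \<bullet>\<^bsub>\<T>\<^esub> sh1 Sh p"
    by (subst cyc_rotate) (simp_all add: qM_def sh1_vcomp_prolong)
  also have "sh1 Sh (\<epsilon>M \<triangleleft> (P \<odot> L)) \<bullet>\<^bsub>\<T>\<^esub> cyc Sh (P \<odot> L) (M \<odot> E)
      = cyc Sh (P \<odot> L) (unit1 \<B> R) \<bullet>\<^bsub>\<T>\<^esub> sh1 Sh ((P \<odot> L) \<triangleright> \<epsilon>M)"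
    using cyc_slide[of "id2 \<B> (P \<odot> L)" \<epsilon>M] by simp
  also have "sh1 Sh (lunit \<B> (P \<odot> L)) \<bullet>\<^bsub>\<T>\<^esub> (\<dots>) \<bullet>\<^bsub>\<T>\<^esub> sh1 Sh (assoc \<B> (P \<odot> L) M E) \<bullet>\<^bsub>\<T>\<^esub> sh1 Sh (k \<triangleleft> E)
        \<bullet>\<^bsub>\<T>\<^esub> sh1 Sh (inv2 \<B> (assoc \<B> (M \<odot> Q) K E)) \<bullet>\<^bsub>\<T>\<^esub> cyc Sh (K \<odot> E) (M \<odot> Q) \<bullet>\<^bsub>\<T>\<^esub> sh1 Sh p
      = sh1 Sh (runit \<B> (P \<odot> L) \<cdot> ((P \<odot> L) \<triangleright> \<epsilon>M) \<cdot> assoc \<B> (P \<odot> L) M E \<cdot> (k \<triangleleft> E)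
          \<cdot> inv2 \<B> (assoc \<B> (M \<odot> Q) K E)) \<bullet>\<^bsub>\<T>\<^esub> cyc Sh (K \<odot> E) (M \<odot> Q) \<bullet>\<^bsub>\<T>\<^esub> sh1 Sh p"
    using Comp_prolong[OF cyc_unit[of "P \<odot> L" R]] by (simp add: sh1_vcomp)
  finally show ?thesis
    unfolding lhs C by simp
qed

end

section \<open>The bicategory of twists is a bicategory\<close>

context twisted_bicategory
begin

abbreviation \<C> where "\<C> \<equiv> twist_bicat G \<B> \<Theta>"
abbreviation twisted :: "('g, 'm, 'c) tw1 \<Rightarrow> bool" where "twisted X \<equiv> X \<in> twist_cells1 G \<B> \<Theta>"

lemma Tw_cell [simp]:
  assumes "A \<in> cells0 \<B>" "g \<in> carrier G"
  shows "Tw \<Theta> A g \<in> cells1 \<B>" "src \<B> (Tw \<Theta> A g) = A" "trg \<B> (Tw \<Theta> A g) = A"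
  using Tw_in[OF assms] by (auto simp: hom1_iff)

lemma mu_cell [simp]:
  assumes "A \<in> cells0 \<B>" "g \<in> carrier G" "h \<in> carrier G"
  shows "mu \<Theta> A g h \<in> cells2 \<B>" "dom2 \<B> (mu \<Theta> A g h) = Tw \<Theta> A g \<odot> Tw \<Theta> A h"
    "cod2 \<B> (mu \<Theta> A g h) = Tw \<Theta> A (g \<otimes>\<^bsub>G\<^esub> h)" "iso2 \<B> (mu \<Theta> A g h)"
  using mu_in[OF assms] mu_iso[OF assms] by (auto simp: hom2_iff)

lemma eta_cell [simp]:
  assumes "A \<in> cells0 \<B>"
  shows "eta \<Theta> A \<in> cells2 \<B>" "dom2 \<B> (eta \<Theta> A) = unit1 \<B> A"
    "cod2 \<B> (eta \<Theta> A) = Tw \<Theta> A \<one>\<^bsub>G\<^esub>" "iso2 \<B> (eta \<Theta> A)"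
  using eta_in[OF assms] eta_iso[OF assms] by (auto simp: hom2_iff)

lemma twistedD:
  assumes "twisted X"
  shows "und1 X \<in> cells1 \<B>" "tau X \<in> extensional (carrier G)"
    and "g \<in> carrier G \<Longrightarrow> tau X g \<in> cells2 \<B>"
    and "g \<in> carrier G \<Longrightarrow> dom2 \<B> (tau X g) = Tw \<Theta> (src \<B> (und1 X)) g \<odot> und1 X"
    and "g \<in> carrier G \<Longrightarrow> cod2 \<B> (tau X g) = und1 X \<odot> Tw \<Theta> (trg \<B> (und1 X)) g"
    and "g \<in> carrier G \<Longrightarrow> iso2 \<B> (tau X g)"
  using assms by (auto simp: twist_cells1_def hom2_iff)

definition strict_tau :: "('g, 'm, 'c) tw1 \<Rightarrow> 'g \<Rightarrow> 'm \<Rightarrow> 'c" where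
  "strict_tau X g = strict (Cat (Atom (Tw \<Theta> (src \<B> (und1 X)) g)) (Atom (und1 X)))
     (Cat (Atom (und1 X)) (Atom (Tw \<Theta> (trg \<B> (und1 X)) g))) (tau X g)"

definition strict_mu :: "'o \<Rightarrow> 'g \<Rightarrow> 'g \<Rightarrow> 'm \<Rightarrow> 'c" where
  "strict_mu A g h = strict (Cat (Atom (Tw \<Theta> A g)) (Atom (Tw \<Theta> A h))) (Atom (Tw \<Theta> A (g \<otimes>\<^bsub>G\<^esub> h)))
     (mu \<Theta> A g h)"

definition strict_eta :: "'o \<Rightarrow> 'm \<Rightarrow> 'c" where
  "strict_eta A = strict (Empty A) (Atom (Tw \<Theta> A \<one>\<^bsub>G\<^esub>)) (eta \<Theta> A)"

lemma rep_tau: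
  assumes "twisted X" "g \<in> carrier G" "src \<B> (und1 X) = A" "trg \<B> (und1 X) = B" "und1 X = M"
  shows "rep (Cat (Atom (Tw \<Theta> A g)) (Atom M)) (Cat (Atom M) (Atom (Tw \<Theta> B g))) (tau X g) (strict_tau X g)"
proof -
  note [simp] = twistedD[OF assms(1)] src_closed[OF twistedD(1)[OF assms(1)]] trg_closed[OF twistedD(1)[OF assms(1)]]
  show ?thesis
    unfolding assms(3-5)[symmetric] strict_tau_def by (rule rep_strict) (use assms(2) in simp_all)
qed

lemma rep_mu:
  assumes "A \<in> cells0 \<B>" "g \<in> carrier G" "h \<in> carrier G"
  shows "rep (Cat (Atom (Tw \<Theta> A g)) (Atom (Tw \<Theta> A h))) (Atom (Tw \<Theta> A (g \<otimes>\<^bsub>G\<^esub> h))) (mu \<Theta> A g h) (strict_mu A g h)"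
    and "rep (Atom (Tw \<Theta> A (g \<otimes>\<^bsub>G\<^esub> h))) (Cat (Atom (Tw \<Theta> A g)) (Atom (Tw \<Theta> A h))) (inv2 \<B> (mu \<Theta> A g h))
      (\<lambda>X. inv2 \<B> (strict_mu A g h X))"
proof -
  show r: "rep (Cat (Atom (Tw \<Theta> A g)) (Atom (Tw \<Theta> A h))) (Atom (Tw \<Theta> A (g \<otimes>\<^bsub>G\<^esub> h))) (mu \<Theta> A g h) (strict_mu A g h)"
    unfolding strict_mu_def strict_eta_def by (rule rep_strict) (use assms in simp_all)
  show "rep (Atom (Tw \<Theta> A (g \<otimes>\<^bsub>G\<^esub> h))) (Cat (Atom (Tw \<Theta> A g)) (Atom (Tw \<Theta> A h))) (inv2 \<B> (mu \<Theta> A g h))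
      (\<lambda>X. inv2 \<B> (strict_mu A g h X))"
    by (rule rep_inv2(1)[OF r]) (use assms in simp)
qed

lemma strict_mu_iso [simp]:
  assumes "A \<in> cells0 \<B>" "g \<in> carrier G" "h \<in> carrier G" "X \<in> cells1 \<B>" "src \<B> X = A"
  shows "iso2 \<B> (strict_mu A g h X)" "strict_mu A g h X \<in> cells2 \<B>"
    "dom2 \<B> (strict_mu A g h X) = Tw \<Theta> A g \<odot> (Tw \<Theta> A h \<odot> X)"
    "cod2 \<B> (strict_mu A g h X) = Tw \<Theta> A (g \<otimes>\<^bsub>G\<^esub> h) \<odot> X"
  using rep_inv2(2)[OF rep_mu(1), of A g h X] rep_cell[OF rep_mu(1), of A g h X] assms by simp_all

lemma rep_eta:
  assumes "A \<in> cells0 \<B>"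
  shows "rep (Empty A) (Atom (Tw \<Theta> A \<one>\<^bsub>G\<^esub>)) (eta \<Theta> A) (strict_eta A)"
    and "rep (Atom (Tw \<Theta> A \<one>\<^bsub>G\<^esub>)) (Empty A) (inv2 \<B> (eta \<Theta> A)) (\<lambda>X. inv2 \<B> (strict_eta A X))"
proof -
  show r: "rep (Empty A) (Atom (Tw \<Theta> A \<one>\<^bsub>G\<^esub>)) (eta \<Theta> A) (strict_eta A)"
    unfolding strict_mu_def strict_eta_def by (rule rep_strict) (use assms in simp_all)
  show "rep (Atom (Tw \<Theta> A \<one>\<^bsub>G\<^esub>)) (Empty A) (inv2 \<B> (eta \<Theta> A)) (\<lambda>X. inv2 \<B> (strict_eta A X))"
    by (rule rep_inv2(1)[OF r]) (use assms in simp)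
qed

lemma strict_eta_iso [simp]:
  assumes "A \<in> cells0 \<B>" "X \<in> cells1 \<B>" "src \<B> X = A"
  shows "iso2 \<B> (strict_eta A X)" "strict_eta A X \<in> cells2 \<B>" "dom2 \<B> (strict_eta A X) = X"
    "cod2 \<B> (strict_eta A X) = Tw \<Theta> A \<one>\<^bsub>G\<^esub> \<odot> X"
  using rep_inv2(2)[OF rep_eta(1), of A X] rep_cell[OF rep_eta(1), of A X] assms by simp_all

lemma strict_tau_cell [simp]:
  assumes "twisted X" "g \<in> carrier G" "Y \<in> cells1 \<B>" "src \<B> Y = trg \<B> (und1 X)"
  shows "strict_tau X g Y \<in> cells2 \<B>" "dom2 \<B> (strict_tau X g Y) = Tw \<Theta> (src \<B> (und1 X)) g \<odot> (und1 X \<odot> Y)"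
    "cod2 \<B> (strict_tau X g Y) = und1 X \<odot> (Tw \<Theta> (trg \<B> (und1 X)) g \<odot> Y)"
  using rep_cell[OF rep_tau[OF assms(1,2)], OF refl refl refl assms(3)] twistedD[OF assms(1)] assms by simp_all

text \<open>
  In strict form, the unit and cocycle conditions on \<open>\<tau>\<close> lose their unitors and associators.
\<close>
lemma strict_tau_one:
  assumes X: "twisted X" and Y: "Y \<in> cells1 \<B>" "src \<B> Y = trg \<B> (und1 X)"
  shows "strict_tau X \<one>\<^bsub>G\<^esub> Y = (und1 X \<triangleright> strict_eta (trg \<B> (und1 X)) Y)
    \<cdot> inv2 \<B> (strict_eta (src \<B> (und1 X)) (und1 X \<odot> Y))"
proof -
  let ?M = "und1 X" and ?A = "src \<B> (und1 X)" and ?B = "trg \<B> (und1 X)"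
  note [simp] = twistedD(1)[OF X] Y
  have eq: "tau X \<one>\<^bsub>G\<^esub> = (?M \<triangleright> eta \<Theta> ?B) \<cdot> inv2 \<B> (runit \<B> ?M) \<cdot> lunit \<B> ?M \<cdot> (inv2 \<B> (eta \<Theta> ?A) \<triangleleft> ?M)"
    using X by (auto simp: twist_cells1_def)
  show ?thesis
    by (rule rep_eqD[OF eq, where X = Y and s = "Cat (Atom (Tw \<Theta> ?A \<one>\<^bsub>G\<^esub>)) (Atom ?M)"
          and t = "Cat (Atom ?M) (Atom (Tw \<Theta> ?B \<one>\<^bsub>G\<^esub>))"],
        (rule rep_rules rep_tau[OF X] rep_eta | (simp; fail))+)
qed

lemma strict_tau_mult:
  assumes X: "twisted X" and Y: "Y \<in> cells1 \<B>" "src \<B> Y = trg \<B> (und1 X)"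
    and [simp]: "g \<in> carrier G" "h \<in> carrier G"
  shows "strict_tau X (g \<otimes>\<^bsub>G\<^esub> h) Y = (und1 X \<triangleright> strict_mu (trg \<B> (und1 X)) g h Y)
    \<cdot> strict_tau X g (Tw \<Theta> (trg \<B> (und1 X)) h \<odot> Y)
    \<cdot> (Tw \<Theta> (src \<B> (und1 X)) g \<triangleright> strict_tau X h Y)
    \<cdot> inv2 \<B> (strict_mu (src \<B> (und1 X)) g h (und1 X \<odot> Y))"
proof -
  let ?M = "und1 X" and ?A = "src \<B> (und1 X)" and ?B = "trg \<B> (und1 X)"
  note [simp] = twistedD(1)[OF X] Y X
  have eq: "tau X (g \<otimes>\<^bsub>G\<^esub> h) = (?M \<triangleright> mu \<Theta> ?B g h) \<cdot> assoc \<B> ?M (Tw \<Theta> ?B g) (Tw \<Theta> ?B h)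
          \<cdot> (tau X g \<triangleleft> Tw \<Theta> ?B h) \<cdot> inv2 \<B> (assoc \<B> (Tw \<Theta> ?A g) ?M (Tw \<Theta> ?B h))
          \<cdot> (Tw \<Theta> ?A g \<triangleright> tau X h) \<cdot> assoc \<B> (Tw \<Theta> ?A g) (Tw \<Theta> ?A h) ?M
          \<cdot> (inv2 \<B> (mu \<Theta> ?A g h) \<triangleleft> ?M)"
    using X by (auto simp: twist_cells1_def)
  show ?thesis
    by (rule rep_eqD[OF eq, where X = Y and s = "Cat (Atom (Tw \<Theta> ?A (g \<otimes>\<^bsub>G\<^esub> h))) (Atom ?M)"
          and t = "Cat (Atom ?M) (Atom (Tw \<Theta> ?B (g \<otimes>\<^bsub>G\<^esub> h)))"],
        (rule rep_rules rep_tau[OF X] rep_mu | (simp; fail))+)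
qed


lemma twistedI:
  assumes "M \<in> cells1 \<B>" "src \<B> M = A" "trg \<B> M = B" "\<tau> \<in> extensional (carrier G)"
    "\<And>g. g \<in> carrier G \<Longrightarrow> \<tau> g \<in> cells2 \<B>"
    "\<And>g. g \<in> carrier G \<Longrightarrow> dom2 \<B> (\<tau> g) = Tw \<Theta> A g \<odot> M"
    "\<And>g. g \<in> carrier G \<Longrightarrow> cod2 \<B> (\<tau> g) = M \<odot> Tw \<Theta> (B) g"
    "\<And>g. g \<in> carrier G \<Longrightarrow> iso2 \<B> (\<tau> g)"
    "\<tau> \<one>\<^bsub>G\<^esub> = (M \<triangleright> eta \<Theta> (B)) \<cdot> inv2 \<B> (runit \<B> M) \<cdot> lunit \<B> M \<cdot> (inv2 \<B> (eta \<Theta> A) \<triangleleft> M)"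
    "\<And>g h. \<lbrakk>g \<in> carrier G; h \<in> carrier G\<rbrakk> \<Longrightarrow> \<tau> (g \<otimes>\<^bsub>G\<^esub> h)
        = (M \<triangleright> mu \<Theta> (B) g h) \<cdot> assoc \<B> M (Tw \<Theta> (B) g) (Tw \<Theta> (B) h)
          \<cdot> (\<tau> g \<triangleleft> Tw \<Theta> (B) h) \<cdot> inv2 \<B> (assoc \<B> (Tw \<Theta> A g) M (Tw \<Theta> (B) h))
          \<cdot> (Tw \<Theta> A g \<triangleright> \<tau> h) \<cdot> assoc \<B> (Tw \<Theta> A g) (Tw \<Theta> A h) M
          \<cdot> (inv2 \<B> (mu \<Theta> A g h) \<triangleleft> M)"
  shows "twisted (Tw1 M \<tau>)"
  using assms unfolding twist_cells1_def by (simp add: hom2_iff)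

text \<open>
  For the cocycle condition of \<open>\<tau> \<star> \<sigma>\<close>, expand \<open>\<tau>\<close> and \<open>\<sigma>\<close> at \<open>g h\<close>: the structure map \<open>\<mu>\<close> of the middle
  0-cell cancels, and it remains to interchange \<open>\<tau>\<close> at \<open>g\<close> with \<open>\<sigma>\<close> at \<open>h\<close>.
\<close>
lemma twisted_hcomp:
  assumes X: "twisted X" and Y: "twisted Y" and XY: "src \<B> (und1 Y) = trg \<B> (und1 X)"
  shows "twisted (twist_hcomp G \<B> \<Theta> X Y)"
proof -
  define M A B where MAB: "M = und1 X" "A = src \<B> M" "B = trg \<B> M"
  define N C where NC: "N = und1 Y" "C = trg \<B> N"
  have [simp]: "und1 X = M" "src \<B> M = A" "trg \<B> M = B" "und1 Y = N" "src \<B> N = B" "trg \<B> N = C"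
    using XY by (simp_all add: MAB NC)
  have [simp]: "M \<in> cells1 \<B>" "N \<in> cells1 \<B>" "A \<in> cells0 \<B>" "B \<in> cells0 \<B>" "C \<in> cells0 \<B>"
    using twistedD(1)[OF X] twistedD(1)[OF Y] src_closed[of M] trg_closed[of M] trg_closed[of N] by simp_all
  note [simp] = twistedD(3-)[OF X, simplified] twistedD(3-)[OF Y, simplified] X Y
  let ?\<rho> = "\<lambda>g. inv2 \<B> (assoc \<B> M N (Tw \<Theta> C g)) \<cdot> (M \<triangleright> tau Y g) \<cdot> assoc \<B> M (Tw \<Theta> B g) N
    \<cdot> (tau X g \<triangleleft> N) \<cdot> inv2 \<B> (assoc \<B> (Tw \<Theta> A g) M N)"
  note reps = rep_tau[OF X] rep_tau[OF Y] rep_mu rep_eta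
  have "twisted (Tw1 (M \<odot> N) (\<lambda>g \<in> carrier G. ?\<rho> g))"
  proof (rule twistedI[of _ A C])
    show "(\<lambda>g \<in> carrier G. ?\<rho> g) \<one>\<^bsub>G\<^esub> = (M \<odot> N) \<triangleright> eta \<Theta> C \<cdot> inv2 \<B> (runit \<B> (M \<odot> N))
        \<cdot> lunit \<B> (M \<odot> N) \<cdot> inv2 \<B> (eta \<Theta> A) \<triangleleft> (M \<odot> N)"
      unfolding restrict_apply'[OF one_closed]
      by (rule rep_eqI[where s = "Cat (Atom (Tw \<Theta> A \<one>\<^bsub>G\<^esub>)) (Cat (Atom M) (Atom N))"
          and t = "Cat (Cat (Atom M) (Atom N)) (Atom (Tw \<Theta> C \<one>\<^bsub>G\<^esub>))"],
        (rule rep_rules reps | (simp; fail)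
          | (simp add: strict_tau_one[OF X, simplified] strict_tau_one[OF Y, simplified] whisker_left_vcomp; fail))+)
  next
    fix g h assume gh [simp]: "g \<in> carrier G" "h \<in> carrier G"
    have exchange: "(M \<triangleright> Tw \<Theta> B g \<triangleright> strict_tau Y h Z) \<cdot> strict_tau X g (Tw \<Theta> B h \<odot> (N \<odot> Z)) \<cdot> z
      = strict_tau X g (N \<odot> (Tw \<Theta> C h \<odot> Z)) \<cdot> (Tw \<Theta> A g \<triangleright> M \<triangleright> strict_tau Y h Z) \<cdot> z"
      if [simp]: "Z \<in> cells1 \<B>" "src \<B> Z = C" "z \<in> cells2 \<B>" "cod2 \<B> z = Tw \<Theta> A g \<odot> (M \<odot> (Tw \<Theta> B h \<odot> (N \<odot> Z)))"
      for Z z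
      using vcomp_prolong[OF rep_natural[OF rep_tau[OF X, of g A B M], of "strict_tau Y h Z"], of z]
      by simp
    show "(\<lambda>g \<in> carrier G. ?\<rho> g) (g \<otimes>\<^bsub>G\<^esub> h)
        = ((M \<odot> N) \<triangleright> mu \<Theta> C g h)
          \<cdot> assoc \<B> (M \<odot> N) (Tw \<Theta> C g) (Tw \<Theta> C h)
          \<cdot> ((\<lambda>g \<in> carrier G. ?\<rho> g) g \<triangleleft> Tw \<Theta> C h)
          \<cdot> inv2 \<B> (assoc \<B> (Tw \<Theta> A g) (M \<odot> N) (Tw \<Theta> C h))
          \<cdot> (Tw \<Theta> A g \<triangleright> (\<lambda>g \<in> carrier G. ?\<rho> g) h)
          \<cdot> assoc \<B> (Tw \<Theta> A g) (Tw \<Theta> A h) (M \<odot> N)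
          \<cdot> (inv2 \<B> (mu \<Theta> A g h) \<triangleleft> (M \<odot> N))"
      unfolding restrict_apply'[OF gh(1)] restrict_apply'[OF gh(2)] restrict_apply'[OF m_closed[OF gh]]
      apply (rule rep_eqI[where s = "Cat (Atom (Tw \<Theta> A (g \<otimes>\<^bsub>G\<^esub> h))) (Cat (Atom M) (Atom N))"
          and t = "Cat (Cat (Atom M) (Atom N)) (Atom (Tw \<Theta> C (g \<otimes>\<^bsub>G\<^esub> h)))"])
      apply ((rule rep_rules reps | (simp; fail))+)
      apply (simp add: strict_tau_mult[OF X, simplified] strict_tau_mult[OF Y, simplified] whisker_left_vcomp)
      apply (subst exchange)
      apply simp_all
      done
  qed simp_all
  then show ?thesis by (simp add: twist_hcomp_def)
qed

lemma twisted_unit: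
  assumes [simp]: "A \<in> cells0 \<B>"
  shows "twisted (twist_unit G \<B> \<Theta> A)"
  unfolding twist_unit_def
proof (rule twistedI[of _ A A])
  let ?\<rho> = "\<lambda>g. inv2 \<B> (lunit \<B> (Tw \<Theta> A g)) \<cdot> runit \<B> (Tw \<Theta> A g)"
  let ?U = "unit1 \<B> A"
  show "(\<lambda>g \<in> carrier G. ?\<rho> g) \<one>\<^bsub>G\<^esub> = ?U \<triangleright> eta \<Theta> A \<cdot> inv2 \<B> (runit \<B> ?U)
      \<cdot> lunit \<B> ?U \<cdot> inv2 \<B> (eta \<Theta> A) \<triangleleft> ?U"
    unfolding restrict_apply'[OF one_closed]
    by (rule rep_eqI[where s = "Cat (Atom (Tw \<Theta> A \<one>\<^bsub>G\<^esub>)) (Empty A)" and t = "Cat (Empty A) (Atom (Tw \<Theta> A \<one>\<^bsub>G\<^esub>))"],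
        (rule rep_rules rep_eta | (simp; fail))+)
next
  fix g h assume gh [simp]: "g \<in> carrier G" "h \<in> carrier G"
  let ?\<rho> = "\<lambda>g. inv2 \<B> (lunit \<B> (Tw \<Theta> A g)) \<cdot> runit \<B> (Tw \<Theta> A g)"
  let ?U = "unit1 \<B> A"
  show "(\<lambda>g \<in> carrier G. ?\<rho> g) (g \<otimes>\<^bsub>G\<^esub> h)
        = (?U \<triangleright> mu \<Theta> A g h) \<cdot> assoc \<B> ?U (Tw \<Theta> A g) (Tw \<Theta> A h)
          \<cdot> ((\<lambda>g \<in> carrier G. ?\<rho> g) g \<triangleleft> Tw \<Theta> A h)
          \<cdot> inv2 \<B> (assoc \<B> (Tw \<Theta> A g) ?U (Tw \<Theta> A h))
          \<cdot> (Tw \<Theta> A g \<triangleright> (\<lambda>g \<in> carrier G. ?\<rho> g) h)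
          \<cdot> assoc \<B> (Tw \<Theta> A g) (Tw \<Theta> A h) ?U
          \<cdot> (inv2 \<B> (mu \<Theta> A g h) \<triangleleft> ?U)"
    unfolding restrict_apply'[OF gh(1)] restrict_apply'[OF gh(2)] restrict_apply'[OF m_closed[OF gh]]
    by (rule rep_eqI[where s = "Cat (Atom (Tw \<Theta> A (g \<otimes>\<^bsub>G\<^esub> h))) (Empty A)" and t = "Cat (Empty A) (Atom (Tw \<Theta> A (g \<otimes>\<^bsub>G\<^esub> h)))"],
        (rule rep_rules rep_mu | (simp; fail))+)
qed simp_all



lemma twist_bicat_sel [simp]:
  "cells0 \<C> = cells0 \<B>" "cells1 \<C> = twist_cells1 G \<B> \<Theta>" "cells2 \<C> = twist_cells2 G \<B> \<Theta>"
  "src \<C> X = src \<B> (und1 X)" "trg \<C> X = trg \<B> (und1 X)" "dom2 \<C> = tdom" "cod2 \<C> = tcod"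
  "id2 \<C> X = Tw2 X (id2 \<B> (und1 X)) X"
  "vcomp \<C> k f = Tw2 (tdom f) (und2 k \<cdot> und2 f) (tcod k)"
  "unit1 \<C> = twist_unit G \<B> \<Theta>" "hcomp1 \<C> = twist_hcomp G \<B> \<Theta>"
  "hcomp2 \<C> f k = Tw2 (twist_hcomp G \<B> \<Theta> (tdom f) (tdom k)) (und2 f \<odot>\<odot> und2 k)
     (twist_hcomp G \<B> \<Theta> (tcod f) (tcod k))"
  "assoc \<C> X Y Z = Tw2 (twist_hcomp G \<B> \<Theta> (twist_hcomp G \<B> \<Theta> X Y) Z)
     (assoc \<B> (und1 X) (und1 Y) (und1 Z)) (twist_hcomp G \<B> \<Theta> X (twist_hcomp G \<B> \<Theta> Y Z))"
  "lunit \<C> X = Tw2 (twist_hcomp G \<B> \<Theta> (twist_unit G \<B> \<Theta> (src \<B> (und1 X))) X) (lunit \<B> (und1 X)) X"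
  "runit \<C> X = Tw2 (twist_hcomp G \<B> \<Theta> X (twist_unit G \<B> \<Theta> (trg \<B> (und1 X)))) (runit \<B> (und1 X)) X"
  by (simp_all add: twist_bicat_def Let_def)

lemma und1_hcomp [simp]: "und1 (twist_hcomp G \<B> \<Theta> X Y) = und1 X \<odot> und1 Y"
  by (simp add: twist_hcomp_def Let_def)

lemma und1_unit [simp]: "und1 (twist_unit G \<B> \<Theta> A) = unit1 \<B> A"
  by (simp add: twist_unit_def)

lemma twist_cells2_iff:
  "f \<in> twist_cells2 G \<B> \<Theta> \<longleftrightarrow> twisted (tdom f) \<and> twisted (tcod f) \<and> und2 f \<in> cells2 \<B> \<and>
     dom2 \<B> (und2 f) = und1 (tdom f) \<and> cod2 \<B> (und2 f) = und1 (tcod f) \<and>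
     (\<forall>g \<in> carrier G. tau (tcod f) g \<cdot> (Tw \<Theta> (src \<B> (und1 (tdom f))) g \<triangleright> und2 f)
        = (und2 f \<triangleleft> Tw \<Theta> (trg \<B> (und1 (tdom f))) g) \<cdot> tau (tdom f) g)"
proof -
  obtain M \<tau> k N \<sigma> where "f = Tw2 (Tw1 M \<tau>) k (Tw1 N \<sigma>)"
    by (metis tw1.exhaust tw2.exhaust)
  then show ?thesis
    unfolding twist_cells2_def by (auto simp: hom2_iff)
qed

lemma twist_cells2D [simp]:
  assumes "f \<in> twist_cells2 G \<B> \<Theta>"
  shows "twisted (tdom f)" "twisted (tcod f)" "und2 f \<in> cells2 \<B>"
    "dom2 \<B> (und2 f) = und1 (tdom f)" "cod2 \<B> (und2 f) = und1 (tcod f)"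
    "src \<B> (und1 (tcod f)) = src \<B> (und1 (tdom f))" "trg \<B> (und1 (tcod f)) = trg \<B> (und1 (tdom f))"
proof -
  show 1: "twisted (tdom f)" "twisted (tcod f)" "und2 f \<in> cells2 \<B>"
    "dom2 \<B> (und2 f) = und1 (tdom f)" "cod2 \<B> (und2 f) = und1 (tcod f)"
    using assms unfolding twist_cells2_iff by blast+
  show "src \<B> (und1 (tcod f)) = src \<B> (und1 (tdom f))" "trg \<B> (und1 (tcod f)) = trg \<B> (und1 (tdom f))"
    using src_cod2[OF 1(3)] trg_cod2[OF 1(3)] unfolding 1(4,5) by blast+
qed

lemma twist_cells2_tau:
  "\<lbrakk>f \<in> twist_cells2 G \<B> \<Theta>; g \<in> carrier G\<rbrakk>
    \<Longrightarrow> tau (tcod f) g \<cdot> (Tw \<Theta> (src \<B> (und1 (tdom f))) g \<triangleright> und2 f)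
        = (und2 f \<triangleleft> Tw \<Theta> (trg \<B> (und1 (tdom f))) g) \<cdot> tau (tdom f) g"
  unfolding twist_cells2_iff by blast

lemma twist_cells2I:
  assumes "twisted X" "twisted Y" "f \<in> cells2 \<B>" "dom2 \<B> f = und1 X" "cod2 \<B> f = und1 Y"
    "\<And>g. g \<in> carrier G \<Longrightarrow> tau Y g \<cdot> (Tw \<Theta> (src \<B> (und1 X)) g \<triangleright> f)
        = (f \<triangleleft> Tw \<Theta> (trg \<B> (und1 X)) g) \<cdot> tau X g"
  shows "Tw2 X f Y \<in> twist_cells2 G \<B> \<Theta>"
  using assms by (simp add: twist_cells2_iff)

lemma tau_hcomp:
  "g \<in> carrier G \<Longrightarrow> tau (twist_hcomp G \<B> \<Theta> X Y) g
    = inv2 \<B> (assoc \<B> (und1 X) (und1 Y) (Tw \<Theta> (trg \<B> (und1 Y)) g))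
       \<cdot> (und1 X \<triangleright> tau Y g) \<cdot> assoc \<B> (und1 X) (Tw \<Theta> (trg \<B> (und1 X)) g) (und1 Y)
       \<cdot> (tau X g \<triangleleft> und1 Y) \<cdot> inv2 \<B> (assoc \<B> (Tw \<Theta> (src \<B> (und1 X)) g) (und1 X) (und1 Y))"
  by (simp add: twist_hcomp_def Let_def)

lemma tau_unit:
  "g \<in> carrier G \<Longrightarrow> tau (twist_unit G \<B> \<Theta> A) g = inv2 \<B> (lunit \<B> (Tw \<Theta> A g)) \<cdot> runit \<B> (Tw \<Theta> A g)"
  by (simp add: twist_unit_def)

lemma twisted_und1 [simp]: "twisted X \<Longrightarrow> und1 X \<in> cells1 \<B>"
  by (rule twistedD)

lemma tau_cell [simp]:
  assumes "twisted X" "g \<in> carrier G"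
  shows "tau X g \<in> cells2 \<B>" "dom2 \<B> (tau X g) = Tw \<Theta> (src \<B> (und1 X)) g \<odot> und1 X"
    "cod2 \<B> (tau X g) = und1 X \<odot> Tw \<Theta> (trg \<B> (und1 X)) g" "iso2 \<B> (tau X g)"
  using twistedD[OF assms(1)] assms(2) by simp_all

text \<open>
  In strict form, both bracketings of a triple composite have the same \<open>\<tau>\<close>, so the associator is a
  2-cell of twists; likewise for the unitors below.
\<close>
lemma twist_assoc_cell:
  assumes X [simp]: "twisted X" and Y [simp]: "twisted Y" and Z [simp]: "twisted Z"
    and [simp]: "src \<B> (und1 Y) = trg \<B> (und1 X)" "src \<B> (und1 Z) = trg \<B> (und1 Y)"
  shows "assoc \<C> X Y Z \<in> cells2 \<C>"
proof -
  have "Tw2 (twist_hcomp G \<B> \<Theta> (twist_hcomp G \<B> \<Theta> X Y) Z)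
     (assoc \<B> (und1 X) (und1 Y) (und1 Z)) (twist_hcomp G \<B> \<Theta> X (twist_hcomp G \<B> \<Theta> Y Z)) \<in> twist_cells2 G \<B> \<Theta>"
  proof (rule twist_cells2I)
    fix g assume [simp]: "g \<in> carrier G"
    let ?M = "Atom (und1 X)" and ?N = "Atom (und1 Y)" and ?P = "Atom (und1 Z)"
    show "tau (twist_hcomp G \<B> \<Theta> X (twist_hcomp G \<B> \<Theta> Y Z)) g
        \<cdot> (Tw \<Theta> (src \<B> (und1 (twist_hcomp G \<B> \<Theta> (twist_hcomp G \<B> \<Theta> X Y) Z))) g
          \<triangleright> assoc \<B> (und1 X) (und1 Y) (und1 Z))
      = (assoc \<B> (und1 X) (und1 Y) (und1 Z) \<triangleleft> Tw \<Theta> (trg \<B> (und1 (twist_hcomp G \<B> \<Theta> (twist_hcomp G \<B> \<Theta> X Y) Z))) g)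
        \<cdot> tau (twist_hcomp G \<B> \<Theta> (twist_hcomp G \<B> \<Theta> X Y) Z) g"
      apply (simp add: tau_hcomp del: vcomp_assoc')
      by (rule rep_eqI[where s = "Cat (Atom (Tw \<Theta> (src \<B> (und1 X)) g)) (Cat (Cat ?M ?N) ?P)"
          and t = "Cat (Cat ?M (Cat ?N ?P)) (Atom (Tw \<Theta> (trg \<B> (und1 Z)) g))"],
        (rule rep_rules rep_tau[OF X] rep_tau[OF Y] rep_tau[OF Z] | (simp add: whisker_left_vcomp; fail))+)
  qed (simp_all add: twisted_hcomp)
  then show ?thesis by simp
qed

lemma twist_lunit_cell:
  assumes X [simp]: "twisted X"
  shows "lunit \<C> X \<in> cells2 \<C>"
proof -
  let ?A = "src \<B> (und1 X)" and ?B = "trg \<B> (und1 X)"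
  have "Tw2 (twist_hcomp G \<B> \<Theta> (twist_unit G \<B> \<Theta> ?A) X) (lunit \<B> (und1 X)) X \<in> twist_cells2 G \<B> \<Theta>"
  proof (rule twist_cells2I)
    fix g assume [simp]: "g \<in> carrier G"
    show "tau X g \<cdot> (Tw \<Theta> (src \<B> (und1 (twist_hcomp G \<B> \<Theta> (twist_unit G \<B> \<Theta> ?A) X))) g \<triangleright> lunit \<B> (und1 X))
      = (lunit \<B> (und1 X) \<triangleleft> Tw \<Theta> (trg \<B> (und1 (twist_hcomp G \<B> \<Theta> (twist_unit G \<B> \<Theta> ?A) X))) g)
        \<cdot> tau (twist_hcomp G \<B> \<Theta> (twist_unit G \<B> \<Theta> ?A) X) g"
      apply (simp add: tau_hcomp tau_unit del: vcomp_assoc')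
      by (rule rep_eqI[where s = "Cat (Atom (Tw \<Theta> ?A g)) (Cat (Empty ?A) (Atom (und1 X)))"
          and t = "Cat (Atom (und1 X)) (Atom (Tw \<Theta> ?B g))"],
        (rule rep_rules rep_tau[OF X] | (simp add: whisker_left_vcomp; fail))+)
  qed (simp_all add: twisted_hcomp twisted_unit)
  then show ?thesis by simp
qed

lemma twist_runit_cell:
  assumes X [simp]: "twisted X"
  shows "runit \<C> X \<in> cells2 \<C>"
proof -
  let ?A = "src \<B> (und1 X)" and ?B = "trg \<B> (und1 X)"
  have "Tw2 (twist_hcomp G \<B> \<Theta> X (twist_unit G \<B> \<Theta> ?B)) (runit \<B> (und1 X)) X \<in> twist_cells2 G \<B> \<Theta>"
  proof (rule twist_cells2I)
    fix g assume [simp]: "g \<in> carrier G"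
    show "tau X g \<cdot> (Tw \<Theta> (src \<B> (und1 (twist_hcomp G \<B> \<Theta> X (twist_unit G \<B> \<Theta> ?B)))) g \<triangleright> runit \<B> (und1 X))
      = (runit \<B> (und1 X) \<triangleleft> Tw \<Theta> (trg \<B> (und1 (twist_hcomp G \<B> \<Theta> X (twist_unit G \<B> \<Theta> ?B)))) g)
        \<cdot> tau (twist_hcomp G \<B> \<Theta> X (twist_unit G \<B> \<Theta> ?B)) g"
      apply (simp add: tau_hcomp tau_unit del: vcomp_assoc')
      by (rule rep_eqI[where s = "Cat (Atom (Tw \<Theta> ?A g)) (Cat (Atom (und1 X)) (Empty ?B))"
          and t = "Cat (Atom (und1 X)) (Atom (Tw \<Theta> ?B g))"],
        (rule rep_rules rep_tau[OF X] | (simp add: whisker_left_vcomp; fail))+)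
  qed (simp_all add: twisted_hcomp twisted_unit)
  then show ?thesis by simp
qed


text \<open>The underlying 2-cell decides invertibility, because the inverse is again compatible with \<open>\<tau>\<close>.\<close>
lemma iso2_twist:
  assumes f [simp]: "f \<in> twist_cells2 G \<B> \<Theta>" and iso [simp]: "iso2 \<B> (und2 f)"
  shows "iso2 \<C> f" "inv2 \<C> f = Tw2 (tcod f) (inv2 \<B> (und2 f)) (tdom f)"
    "Tw2 (tcod f) (inv2 \<B> (und2 f)) (tdom f) \<in> twist_cells2 G \<B> \<Theta>"
proof -
  let ?k = "Tw2 (tcod f) (inv2 \<B> (und2 f)) (tdom f)"
  show cell: "?k \<in> twist_cells2 G \<B> \<Theta>"
  proof (rule twist_cells2I)
    fix g assume [simp]: "g \<in> carrier G"
    let ?A = "src \<B> (und1 (tcod f))" and ?B = "trg \<B> (und1 (tcod f))"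
    show "tau (tdom f) g \<cdot> (Tw \<Theta> ?A g \<triangleright> inv2 \<B> (und2 f)) = (inv2 \<B> (und2 f) \<triangleleft> Tw \<Theta> ?B g) \<cdot> tau (tcod f) g"
    proof (rule iso2_epi[of "Tw \<Theta> ?A g \<triangleright> und2 f"])
      have "((inv2 \<B> (und2 f) \<triangleleft> Tw \<Theta> ?B g) \<cdot> tau (tcod f) g) \<cdot> (Tw \<Theta> ?A g \<triangleright> und2 f)
          = (inv2 \<B> (und2 f) \<triangleleft> Tw \<Theta> ?B g) \<cdot> (und2 f \<triangleleft> Tw \<Theta> ?B g) \<cdot> tau (tdom f) g"
        using twist_cells2_tau[OF f, of g] by simp
      also have "\<dots> = ((inv2 \<B> (und2 f) \<cdot> und2 f) \<triangleleft> Tw \<Theta> ?B g) \<cdot> tau (tdom f) g"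
        by (subst whisker_right_vcomp) simp_all
      finally show "(tau (tdom f) g \<cdot> (Tw \<Theta> ?A g \<triangleright> inv2 \<B> (und2 f))) \<cdot> (Tw \<Theta> ?A g \<triangleright> und2 f)
          = ((inv2 \<B> (und2 f) \<triangleleft> Tw \<Theta> ?B g) \<cdot> tau (tcod f) g) \<cdot> (Tw \<Theta> ?A g \<triangleright> und2 f)"
        by simp
    qed simp_all
  qed simp_all
  have "inverse2 \<C> f ?k" and unique: "\<And>k'. inverse2 \<C> f k' \<Longrightarrow> k' = ?k"
  proof -
    show "inverse2 \<C> f ?k"
      using cell by (simp add: inverse2_def hom2_def)
    fix k' assume "inverse2 \<C> f k'"
    then have k': "k' \<in> twist_cells2 G \<B> \<Theta>" "tdom k' = tcod f" "tcod k' = tdom f"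
      "und2 k' \<cdot> und2 f = id2 \<B> (und1 (tdom f))" "und2 f \<cdot> und2 k' = id2 \<B> (und1 (tcod f))"
      by (auto simp: inverse2_def hom2_def)
    then have "inv2 \<B> (und2 f) = und2 k'"
      by (intro iso2I(2)) simp_all
    then show "k' = ?k"
      using k' by (intro tw2.expand) simp
  qed
  then show "iso2 \<C> f" "inv2 \<C> f = ?k"
    unfolding iso2_def inv2_def by (blast intro: the_equality)+
qed

lemma twist_vcomp_cell:
  assumes f [simp]: "f \<in> twist_cells2 G \<B> \<Theta>" and k [simp]: "k \<in> twist_cells2 G \<B> \<Theta>"
    and [simp]: "tdom k = tcod f"
  shows "Tw2 (tdom f) (und2 k \<cdot> und2 f) (tcod k) \<in> twist_cells2 G \<B> \<Theta>"
proof (rule twist_cells2I)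
  have [simp]: "dom2 \<B> (und2 k) = und1 (tcod f)" "src \<B> (und1 (tcod k)) = src \<B> (und1 (tdom f))"
    "trg \<B> (und1 (tcod k)) = trg \<B> (und1 (tdom f))"
    using twist_cells2D(4,6,7)[OF k] by simp_all
  show "und2 k \<cdot> und2 f \<in> cells2 \<B>" "dom2 \<B> (und2 k \<cdot> und2 f) = und1 (tdom f)"
    "cod2 \<B> (und2 k \<cdot> und2 f) = und1 (tcod k)"
    by simp_all
  fix g assume [simp]: "g \<in> carrier G"
  let ?A = "src \<B> (und1 (tdom f))" and ?B = "trg \<B> (und1 (tdom f))"
  have "tau (tcod k) g \<cdot> (Tw \<Theta> ?A g \<triangleright> (und2 k \<cdot> und2 f))
      = tau (tcod k) g \<cdot> (Tw \<Theta> ?A g \<triangleright> und2 k) \<cdot> (Tw \<Theta> ?A g \<triangleright> und2 f)"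
    by (simp add: whisker_left_vcomp)
  also have "\<dots> = ((und2 k \<triangleleft> Tw \<Theta> ?B g) \<cdot> tau (tcod f) g) \<cdot> (Tw \<Theta> ?A g \<triangleright> und2 f)"
    using twist_cells2_tau[OF k, of g] by (intro vcomp_prolong) simp_all
  also have "\<dots> = (und2 k \<triangleleft> Tw \<Theta> ?B g) \<cdot> (und2 f \<triangleleft> Tw \<Theta> ?B g) \<cdot> tau (tdom f) g"
    using twist_cells2_tau[OF f, of g] by simp
  finally show "tau (tcod k) g \<cdot> (Tw \<Theta> ?A g \<triangleright> (und2 k \<cdot> und2 f))
      = ((und2 k \<cdot> und2 f) \<triangleleft> Tw \<Theta> ?B g) \<cdot> tau (tdom f) g"
    by (simp add: whisker_right_vcomp)
qed simp_all

definition strict_und2 :: "('g, 'm, 'c) tw2 \<Rightarrow> 'm \<Rightarrow> 'c" where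
  "strict_und2 f = strict (Atom (und1 (tdom f))) (Atom (und1 (tcod f))) (und2 f)"

lemma rep_und2:
  assumes "f \<in> twist_cells2 G \<B> \<Theta>" "tdom f = X" "tcod f = Y"
  shows "rep (Atom (und1 X)) (Atom (und1 Y)) (und2 f) (strict_und2 f)"
  unfolding strict_und2_def using assms by (auto intro!: rep_strict)

lemma strict_und2_tau:
  assumes f [simp]: "f \<in> twist_cells2 G \<B> \<Theta>" and X: "tdom f = X" "tcod f = X'"
    and g [simp]: "g \<in> carrier G" and Z [simp]: "Z \<in> cells1 \<B>" "src \<B> Z = trg \<B> (und1 X)"
  shows "strict_tau X' g Z \<cdot> (Tw \<Theta> (src \<B> (und1 X)) g \<triangleright> strict_und2 f Z)
    = strict_und2 f (Tw \<Theta> (trg \<B> (und1 X)) g \<odot> Z) \<cdot> strict_tau X g Z"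
proof -
  have [simp]: "twisted X" "twisted X'" "src \<B> (und1 X') = src \<B> (und1 X)" "trg \<B> (und1 X') = trg \<B> (und1 X)"
    using twist_cells2D[OF f] unfolding X by simp_all
  note eq = twist_cells2_tau[OF f g, unfolded X]
  let ?A = "src \<B> (und1 X)" and ?B = "trg \<B> (und1 X)"
  show ?thesis
    by (rule rep_eqD[OF eq, where X = Z and s = "Cat (Atom (Tw \<Theta> ?A g)) (Atom (und1 X))"
          and t = "Cat (Atom (und1 X')) (Atom (Tw \<Theta> ?B g))"],
        (rule rep_rules rep_tau[of X] rep_tau[of X'] rep_und2[OF f X]
          | (simp add: rep_cell[OF rep_und2[OF f X]]; fail))+)
qed

text \<open>
  In strict form: the compatibility of the first 2-cell, an interchange on either side of it, and then
  the compatibility of the second 2-cell.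
\<close>
lemma twist_hcomp_cell:
  assumes f [simp]: "f \<in> twist_cells2 G \<B> \<Theta>" and k [simp]: "k \<in> twist_cells2 G \<B> \<Theta>"
    and X: "tdom f = X" "tcod f = X'" and Y: "tdom k = Y" "tcod k = Y'"
    and XY [simp]: "src \<B> (und1 Y) = trg \<B> (und1 X)"
  shows "Tw2 (twist_hcomp G \<B> \<Theta> X Y) (und2 f \<odot>\<odot> und2 k) (twist_hcomp G \<B> \<Theta> X' Y') \<in> twist_cells2 G \<B> \<Theta>"
proof (rule twist_cells2I)
  have [simp]: "twisted X" "twisted X'" "src \<B> (und1 X') = src \<B> (und1 X)" "trg \<B> (und1 X') = trg \<B> (und1 X)"
     "und2 f \<in> cells2 \<B>" "dom2 \<B> (und2 f) = und1 X" "cod2 \<B> (und2 f) = und1 X'"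
    using twist_cells2D[OF f] unfolding X by simp_all
  have [simp]: "twisted Y" "twisted Y'" "src \<B> (und1 Y') = src \<B> (und1 Y)" "trg \<B> (und1 Y') = trg \<B> (und1 Y)"
     "und2 k \<in> cells2 \<B>" "dom2 \<B> (und2 k) = und1 Y" "cod2 \<B> (und2 k) = und1 Y'"
    using twist_cells2D[OF k] unfolding Y by simp_all
  show "twisted (twist_hcomp G \<B> \<Theta> X Y)" "twisted (twist_hcomp G \<B> \<Theta> X' Y')"
    "und2 f \<odot>\<odot> und2 k \<in> cells2 \<B>" "dom2 \<B> (und2 f \<odot>\<odot> und2 k) = und1 (twist_hcomp G \<B> \<Theta> X Y)"
    "cod2 \<B> (und2 f \<odot>\<odot> und2 k) = und1 (twist_hcomp G \<B> \<Theta> X' Y')"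
    by (simp_all add: twisted_hcomp)
  fix g assume [simp]: "g \<in> carrier G"
  let ?A = "src \<B> (und1 X)" and ?B = "trg \<B> (und1 X)" and ?C = "trg \<B> (und1 Y)"
  note [simp] = rep_cell[OF rep_und2[OF f X]] rep_cell[OF rep_und2[OF k Y]]
  have strict_eq: "(und1 X' \<triangleright> strict_tau Y' g Z) \<cdot> strict_tau X' g (und1 Y' \<odot> Z)
        \<cdot> (Tw \<Theta> ?A g \<triangleright> strict_und2 f (und1 Y' \<odot> Z)) \<cdot> (Tw \<Theta> ?A g \<triangleright> und1 X \<triangleright> strict_und2 k Z)
      = strict_und2 f (und1 Y' \<odot> (Tw \<Theta> ?C g \<odot> Z)) \<cdot> (und1 X \<triangleright> strict_und2 k (Tw \<Theta> ?C g \<odot> Z))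
        \<cdot> (und1 X \<triangleright> strict_tau Y g Z) \<cdot> strict_tau X g (und1 Y \<odot> Z)"
    if [simp]: "Z \<in> cells1 \<B>" "src \<B> Z = ?C" for Z
  proof -
    have "(und1 X' \<triangleright> strict_tau Y' g Z) \<cdot> strict_tau X' g (und1 Y' \<odot> Z)
        \<cdot> (Tw \<Theta> ?A g \<triangleright> strict_und2 f (und1 Y' \<odot> Z)) \<cdot> (Tw \<Theta> ?A g \<triangleright> und1 X \<triangleright> strict_und2 k Z)
      = (und1 X' \<triangleright> strict_tau Y' g Z) \<cdot> (strict_und2 f (Tw \<Theta> ?B g \<odot> (und1 Y' \<odot> Z))
        \<cdot> strict_tau X g (und1 Y' \<odot> Z)) \<cdot> (Tw \<Theta> ?A g \<triangleright> und1 X \<triangleright> strict_und2 k Z)"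
      by (subst vcomp_prolong[OF strict_und2_tau[OF f X]]) simp_all
    also have "\<dots> = ((und1 X' \<triangleright> strict_tau Y' g Z) \<cdot> strict_und2 f (Tw \<Theta> ?B g \<odot> (und1 Y' \<odot> Z)))
        \<cdot> (und1 X \<triangleright> Tw \<Theta> ?B g \<triangleright> strict_und2 k Z) \<cdot> strict_tau X g (und1 Y \<odot> Z)"
      using rep_natural[OF rep_tau[of X g ?A ?B "und1 X"], of "strict_und2 k Z"] by simp
    also have "\<dots> = (strict_und2 f (und1 Y' \<odot> (Tw \<Theta> ?C g \<odot> Z)) \<cdot> (und1 X \<triangleright> strict_tau Y' g Z))
        \<cdot> (und1 X \<triangleright> Tw \<Theta> ?B g \<triangleright> strict_und2 k Z) \<cdot> strict_tau X g (und1 Y \<odot> Z)"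
      using rep_natural[OF rep_und2[OF f X], of "strict_tau Y' g Z"] by simp
    also have "\<dots> = strict_und2 f (und1 Y' \<odot> (Tw \<Theta> ?C g \<odot> Z))
        \<cdot> (und1 X \<triangleright> (strict_tau Y' g Z \<cdot> (Tw \<Theta> ?B g \<triangleright> strict_und2 k Z))) \<cdot> strict_tau X g (und1 Y \<odot> Z)"
      by (simp add: whisker_left_vcomp)
    also have "strict_tau Y' g Z \<cdot> (Tw \<Theta> ?B g \<triangleright> strict_und2 k Z) = strict_und2 k (Tw \<Theta> ?C g \<odot> Z) \<cdot> strict_tau Y g Z"
      using strict_und2_tau[OF k Y, of g Z] by simp
    finally show ?thesis
      by (simp add: whisker_left_vcomp)
  qed
  show "tau (twist_hcomp G \<B> \<Theta> X' Y') g \<cdot> (Tw \<Theta> (src \<B> (und1 (twist_hcomp G \<B> \<Theta> X Y))) g \<triangleright> (und2 f \<odot>\<odot> und2 k))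
     = ((und2 f \<odot>\<odot> und2 k) \<triangleleft> Tw \<Theta> (trg \<B> (und1 (twist_hcomp G \<B> \<Theta> X Y))) g) \<cdot> tau (twist_hcomp G \<B> \<Theta> X Y) g"
    apply (simp add: tau_hcomp del: vcomp_assoc')
    apply (rule rep_eqI[where s = "Cat (Atom (Tw \<Theta> ?A g)) (Cat (Atom (und1 X)) (Atom (und1 Y)))"
          and t = "Cat (Cat (Atom (und1 X')) (Atom (und1 Y'))) (Atom (Tw \<Theta> ?C g))"])
      apply (rule rep_rules rep_tau[of X] rep_tau[of X'] rep_tau[of Y] rep_tau[of Y'] rep_und2[OF f X] rep_und2[OF k Y]
          | (simp; fail))+
    apply (simp add: whisker_left_vcomp strict_eq)
    done
qed

lemma bicategory_twist_bicat: "bicategory \<C>"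
proof
  show "src \<C> M \<in> cells0 \<C>" "trg \<C> M \<in> cells0 \<C>" if "M \<in> cells1 \<C>" for M
    using that by simp_all
  show "dom2 \<C> f \<in> cells1 \<C>" "cod2 \<C> f \<in> cells1 \<C>" if "f \<in> cells2 \<C>" for f
    using that by simp_all
  show "src \<C> (dom2 \<C> f) = src \<C> (cod2 \<C> f)" "trg \<C> (dom2 \<C> f) = trg \<C> (cod2 \<C> f)"
    if "f \<in> cells2 \<C>" for f
    using that by simp_all
  have id2_twist: "Tw2 X (id2 \<B> (und1 X)) X \<in> twist_cells2 G \<B> \<Theta>" if "twisted X" for X
    by (rule twist_cells2I) (use that in simp_all)
  then show "id2 \<C> M \<in> hom2 \<C> M M" if "M \<in> cells1 \<C>" for M
    using that by (simp add: hom2_def)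
  show "vcomp \<C> k f \<in> hom2 \<C> M P" if "f \<in> hom2 \<C> M N" "k \<in> hom2 \<C> N P" for f k M N P
    using that twist_vcomp_cell[of f k] by (auto simp: hom2_def)
  have hcomp1: "twist_hcomp G \<B> \<Theta> M N \<in> hom1 \<C> A C" if "M \<in> hom1 \<C> A B" "N \<in> hom1 \<C> B C" for M N A B C
    using that by (auto simp: hom1_def twisted_hcomp)
  then show "hcomp1 \<C> M N \<in> hom1 \<C> A C" if "M \<in> hom1 \<C> A B" "N \<in> hom1 \<C> B C" for M N A B C
    using that by simp
  show "hcomp2 \<C> f k \<in> hom2 \<C> (hcomp1 \<C> M N) (hcomp1 \<C> M' N')"
    if "M \<in> hom1 \<C> A B" "N \<in> hom1 \<C> B C" "f \<in> hom2 \<C> M M'" "k \<in> hom2 \<C> N N'" for M N A B C f k M' N'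
    using that twist_hcomp_cell[of f k M M' N N'] by (auto simp: hom1_def hom2_def)
  show "unit1 \<C> A \<in> hom1 \<C> A A" if "A \<in> cells0 \<C>" for A
    using that by (simp add: hom1_def twisted_unit)
  show "assoc \<C> M N P \<in> hom2 \<C> (hcomp1 \<C> (hcomp1 \<C> M N) P) (hcomp1 \<C> M (hcomp1 \<C> N P))"
    "iso2 \<C> (assoc \<C> M N P)"
    if "M \<in> hom1 \<C> A B" "N \<in> hom1 \<C> B C" "P \<in> hom1 \<C> C D" for M N P A B C D
  proof -
    have "assoc \<C> M N P \<in> cells2 \<C>"
      using that by (intro twist_assoc_cell) (auto simp: hom1_def)
    then show "assoc \<C> M N P \<in> hom2 \<C> (hcomp1 \<C> (hcomp1 \<C> M N) P) (hcomp1 \<C> M (hcomp1 \<C> N P))"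
      "iso2 \<C> (assoc \<C> M N P)"
      using that by (auto simp: hom2_def hom1_def intro!: iso2_twist)
  qed
  show "lunit \<C> M \<in> hom2 \<C> (hcomp1 \<C> (unit1 \<C> A) M) M" if "M \<in> hom1 \<C> A B" for M A B
    using that twist_lunit_cell[of M] by (auto simp: hom1_def hom2_def)
  show "iso2 \<C> (lunit \<C> M)" if "M \<in> cells1 \<C>" for M
    using that twist_lunit_cell[of M] by (intro iso2_twist) simp_all
  show "runit \<C> M \<in> hom2 \<C> (hcomp1 \<C> M (unit1 \<C> B)) M" if "M \<in> hom1 \<C> A B" for M A B
    using that twist_runit_cell[of M] by (auto simp: hom1_def hom2_def)
  show "iso2 \<C> (runit \<C> M)" if "M \<in> cells1 \<C>" for M
    using that twist_runit_cell[of M] by (intro iso2_twist) simp_all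
  show "vcomp \<C> (id2 \<C> N) f = f" if "f \<in> hom2 \<C> M N" for f M N
    using that by (auto simp: hom2_def intro: tw2.expand)
  show "vcomp \<C> f (id2 \<C> M) = f" if "f \<in> hom2 \<C> M N" for f M N
    using that by (auto simp: hom2_def intro: tw2.expand)
  show "vcomp \<C> (vcomp \<C> j k) f = vcomp \<C> j (vcomp \<C> k f)"
    if "f \<in> hom2 \<C> M N" "k \<in> hom2 \<C> N P" "j \<in> hom2 \<C> P Q" for f k j M N P Q
    using that by (auto simp: hom2_def)
  show "hcomp2 \<C> (id2 \<C> M) (id2 \<C> N) = id2 \<C> (hcomp1 \<C> M N)"
    if "M \<in> hom1 \<C> A B" "N \<in> hom1 \<C> B C" for M N A B C
    using that by (auto simp: hom1_def)
  show "hcomp2 \<C> (vcomp \<C> f' f) (vcomp \<C> k' k) = vcomp \<C> (hcomp2 \<C> f' k') (hcomp2 \<C> f k)"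
    if "M \<in> hom1 \<C> A B" "N \<in> hom1 \<C> B C" "f \<in> hom2 \<C> M M'" "f' \<in> hom2 \<C> M' M''"
      "k \<in> hom2 \<C> N N'" "k' \<in> hom2 \<C> N' N''" for M N A B C f f' k k' M' M'' N' N''
    using that by (auto simp: hom1_def hom2_def interchange')
  show "vcomp \<C> (assoc \<C> M' N' P') (hcomp2 \<C> (hcomp2 \<C> f k) j)
      = vcomp \<C> (hcomp2 \<C> f (hcomp2 \<C> k j)) (assoc \<C> M N P)"
    if "M \<in> hom1 \<C> A B" "N \<in> hom1 \<C> B C" "P \<in> hom1 \<C> C D"
      "f \<in> hom2 \<C> M M'" "k \<in> hom2 \<C> N N'" "j \<in> hom2 \<C> P P'" for M N P A B C D f k j M' N' P'
    using that assoc_natural'[of "und2 f" "und2 k" "und2 j"] by (auto simp: hom1_def hom2_def)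
  show "vcomp \<C> (lunit \<C> M') (hcomp2 \<C> (id2 \<C> (unit1 \<C> A)) f) = vcomp \<C> f (lunit \<C> M)"
    if "M \<in> hom1 \<C> A B" "f \<in> hom2 \<C> M M'" for M A B f M'
    using that lunit_natural'[of "und2 f"] by (auto simp: hom1_def hom2_def)
  show "vcomp \<C> (runit \<C> M') (hcomp2 \<C> f (id2 \<C> (unit1 \<C> B))) = vcomp \<C> f (runit \<C> M)"
    if "M \<in> hom1 \<C> A B" "f \<in> hom2 \<C> M M'" for M A B f M'
    using that runit_natural'[of "und2 f"] by (auto simp: hom1_def hom2_def)
  show "vcomp \<C> (hcomp2 \<C> (id2 \<C> M) (assoc \<C> N P Q))
        (vcomp \<C> (assoc \<C> M (hcomp1 \<C> N P) Q) (hcomp2 \<C> (assoc \<C> M N P) (id2 \<C> Q)))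
      = vcomp \<C> (assoc \<C> M N (hcomp1 \<C> P Q)) (assoc \<C> (hcomp1 \<C> M N) P Q)"
    if "M \<in> hom1 \<C> A B" "N \<in> hom1 \<C> B C" "P \<in> hom1 \<C> C D" "Q \<in> hom1 \<C> D E" for M N P Q A B C D E
    using that pentagon'[of "und1 M" "und1 N" "und1 P" "und1 Q"] by (auto simp: hom1_def)
  show "vcomp \<C> (hcomp2 \<C> (id2 \<C> M) (lunit \<C> N)) (assoc \<C> M (unit1 \<C> B) N) = hcomp2 \<C> (runit \<C> M) (id2 \<C> N)"
    if "M \<in> hom1 \<C> A B" "N \<in> hom1 \<C> B C" for M N A B C
    using that triangle'[of "und1 M" "und1 N" B] by (auto simp: hom1_def)
qed

end

section \<open>Shadows are weak shadows\<close>

context shadowed_bicategory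
begin

lemma sh1_cell:
  assumes "f \<in> cells2 \<B>" "src \<B> (dom2 \<B> f) = trg \<B> (dom2 \<B> f)"
  shows "sh1 Sh f \<in> arrs \<T>" "Dom \<T> (sh1 Sh f) = sh0 Sh (dom2 \<B> f)" "Cod \<T> (sh1 Sh f) = sh0 Sh (cod2 \<B> f)"
  using sh1_in[of "dom2 \<B> f" _ f "cod2 \<B> f"] assms by (auto simp: hom1_iff hom2_iff homs_iff)

lemma cyc_cell:
  assumes "M \<in> cells1 \<B>" "N \<in> cells1 \<B>" "src \<B> N = trg \<B> M" "src \<B> M = trg \<B> N"
  shows "cyc Sh M N \<in> arrs \<T>" "Dom \<T> (cyc Sh M N) = sh0 Sh (M \<odot> N)" "Cod \<T> (cyc Sh M N) = sh0 Sh (N \<odot> M)"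
  using cyc_in[of M _ _ N] assms by (auto simp: hom1_iff homs_iff)

lemma sh1_id2: "\<lbrakk>M \<in> cells1 \<B>; src \<B> M = trg \<B> M\<rbrakk> \<Longrightarrow> sh1 Sh (id2 \<B> M) = Id \<T> (sh0 Sh M)"
  using sh1_id by (auto simp: hom1_iff)

lemma sh1_comp':
  "\<lbrakk>f \<in> cells2 \<B>; k \<in> cells2 \<B>; dom2 \<B> k = cod2 \<B> f; src \<B> (dom2 \<B> f) = trg \<B> (dom2 \<B> f)\<rbrakk>
    \<Longrightarrow> sh1 Sh (k \<cdot> f) = sh1 Sh k \<bullet>\<^bsub>\<T>\<^esub> sh1 Sh f"
  using sh1_comp[of "dom2 \<B> f" _ f "cod2 \<B> f" k "cod2 \<B> k"] by (auto simp: hom1_iff hom2_iff)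

lemma cyc_slide':
  "\<lbrakk>f \<in> cells2 \<B>; k \<in> cells2 \<B>; src \<B> (dom2 \<B> k) = trg \<B> (dom2 \<B> f); src \<B> (dom2 \<B> f) = trg \<B> (dom2 \<B> k)\<rbrakk>
    \<Longrightarrow> cyc Sh (cod2 \<B> f) (cod2 \<B> k) \<bullet>\<^bsub>\<T>\<^esub> sh1 Sh (f \<odot>\<odot> k)
      = sh1 Sh (k \<odot>\<odot> f) \<bullet>\<^bsub>\<T>\<^esub> cyc Sh (dom2 \<B> f) (dom2 \<B> k)"
  using cyc_natural[of "dom2 \<B> f" _ _ "dom2 \<B> k" f "cod2 \<B> f" k "cod2 \<B> k"]
  by (auto simp: hom1_iff hom2_iff)

lemma sh1_prolong:
  "\<lbrakk>f \<in> cells2 \<B>; k \<in> cells2 \<B>; dom2 \<B> k = cod2 \<B> f; src \<B> (dom2 \<B> f) = trg \<B> (dom2 \<B> f);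
    z \<in> arrs \<T>; Cod \<T> z = sh0 Sh (dom2 \<B> f)\<rbrakk>
   \<Longrightarrow> sh1 Sh k \<bullet>\<^bsub>\<T>\<^esub> sh1 Sh f \<bullet>\<^bsub>\<T>\<^esub> z = sh1 Sh (k \<cdot> f) \<bullet>\<^bsub>\<T>\<^esub> z"
  by (rule Comp_prolong) (simp_all add: sh1_comp' sh1_cell)

text \<open>
  Compare the hexagon for \<open>cyc Sh (M \<odot> N) U\<close>, where \<open>U\<close> is a unit 1-cell, with the unit law: after the
  unitors are slid past the cyclicity maps, the hexagon reads as two moves in succession.
\<close>
lemma cyc_involution:
  assumes M [simp]: "M \<in> cells1 \<B>" and N [simp]: "N \<in> cells1 \<B>"
    and MN [simp]: "src \<B> N = trg \<B> M" "src \<B> M = trg \<B> N"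
  shows "cyc Sh N M \<bullet>\<^bsub>\<T>\<^esub> cyc Sh M N = Id \<T> (sh0 Sh (M \<odot> N))"
proof -
  let ?A = "trg \<B> N"
  let ?U = "unit1 \<B> ?A"
  note [simp] = sh1_cell cyc_cell sh1_id2
  have 1: "lunit \<B> (M \<odot> N) \<cdot> assoc \<B> ?U M N = lunit \<B> M \<triangleleft> N"
    using lunit_whisker_right[of M N] by simp
  have 2: "(N \<triangleright> lunit \<B> M) \<cdot> assoc \<B> N ?U M = runit \<B> N \<triangleleft> M"
    by (rule triangle') simp_all
  have 3: "(M \<triangleright> runit \<B> N) \<cdot> assoc \<B> M N ?U = runit \<B> (M \<odot> N)"
    by (rule rep_eqI[where s = "Cat (Cat (Atom M) (Atom N)) (Empty ?A)" and t = "Cat (Atom M) (Atom N)"],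
        (rule rep_rules | (simp; fail))+)
  have "Id \<T> (sh0 Sh (M \<odot> N)) \<bullet>\<^bsub>\<T>\<^esub> sh1 Sh (runit \<B> (M \<odot> N)) = sh1 Sh (lunit \<B> (M \<odot> N)) \<bullet>\<^bsub>\<T>\<^esub> cyc Sh (M \<odot> N) ?U"
    using cyc_unit_right[of "M \<odot> N" ?A] by (simp add: hom1_iff)
  also have "\<dots> = sh1 Sh (lunit \<B> (M \<odot> N)) \<bullet>\<^bsub>\<T>\<^esub> sh1 Sh (assoc \<B> ?U M N) \<bullet>\<^bsub>\<T>\<^esub> cyc Sh N (?U \<odot> M)
      \<bullet>\<^bsub>\<T>\<^esub> sh1 Sh (assoc \<B> N ?U M) \<bullet>\<^bsub>\<T>\<^esub> cyc Sh M (N \<odot> ?U) \<bullet>\<^bsub>\<T>\<^esub> sh1 Sh (assoc \<B> M N ?U)"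
    by (subst cyc_hcomp) (auto simp: hom1_iff)
  also have "\<dots> = (sh1 Sh (lunit \<B> M \<triangleleft> N) \<bullet>\<^bsub>\<T>\<^esub> cyc Sh N (?U \<odot> M))
      \<bullet>\<^bsub>\<T>\<^esub> sh1 Sh (assoc \<B> N ?U M) \<bullet>\<^bsub>\<T>\<^esub> cyc Sh M (N \<odot> ?U) \<bullet>\<^bsub>\<T>\<^esub> sh1 Sh (assoc \<B> M N ?U)"
    by (subst sh1_prolong) (simp_all add: 1)
  also have "sh1 Sh (lunit \<B> M \<triangleleft> N) \<bullet>\<^bsub>\<T>\<^esub> cyc Sh N (?U \<odot> M) = cyc Sh N M \<bullet>\<^bsub>\<T>\<^esub> sh1 Sh (N \<triangleright> lunit \<B> M)"
    using cyc_slide'[of "id2 \<B> N" "lunit \<B> M"] by simp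
  also have "\<dots> \<bullet>\<^bsub>\<T>\<^esub> sh1 Sh (assoc \<B> N ?U M) \<bullet>\<^bsub>\<T>\<^esub> cyc Sh M (N \<odot> ?U) \<bullet>\<^bsub>\<T>\<^esub> sh1 Sh (assoc \<B> M N ?U)
      = cyc Sh N M \<bullet>\<^bsub>\<T>\<^esub> (sh1 Sh (runit \<B> N \<triangleleft> M) \<bullet>\<^bsub>\<T>\<^esub> cyc Sh M (N \<odot> ?U)) \<bullet>\<^bsub>\<T>\<^esub> sh1 Sh (assoc \<B> M N ?U)"
    by (simp add: sh1_prolong 2)
  also have "sh1 Sh (runit \<B> N \<triangleleft> M) \<bullet>\<^bsub>\<T>\<^esub> cyc Sh M (N \<odot> ?U) = cyc Sh M N \<bullet>\<^bsub>\<T>\<^esub> sh1 Sh (M \<triangleright> runit \<B> N)"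
    using cyc_slide'[of "id2 \<B> M" "runit \<B> N"] by simp
  also have "cyc Sh N M \<bullet>\<^bsub>\<T>\<^esub> (\<dots>) \<bullet>\<^bsub>\<T>\<^esub> sh1 Sh (assoc \<B> M N ?U)
      = (cyc Sh N M \<bullet>\<^bsub>\<T>\<^esub> cyc Sh M N) \<bullet>\<^bsub>\<T>\<^esub> sh1 Sh (runit \<B> (M \<odot> N))"
    by (simp add: 3 flip: sh1_comp')
  finally have eq: "Id \<T> (sh0 Sh (M \<odot> N)) \<bullet>\<^bsub>\<T>\<^esub> sh1 Sh (runit \<B> (M \<odot> N))
      = (cyc Sh N M \<bullet>\<^bsub>\<T>\<^esub> cyc Sh M N) \<bullet>\<^bsub>\<T>\<^esub> sh1 Sh (runit \<B> (M \<odot> N))" .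
  have "sh1 Sh (runit \<B> (M \<odot> N)) \<bullet>\<^bsub>\<T>\<^esub> sh1 Sh (inv2 \<B> (runit \<B> (M \<odot> N))) = Id \<T> (sh0 Sh (M \<odot> N))"
    by (simp flip: sh1_comp')
  then show ?thesis
    using arg_cong[OF eq, of "\<lambda>x. x \<bullet>\<^bsub>\<T>\<^esub> sh1 Sh (inv2 \<B> (runit \<B> (M \<odot> N)))"]
      sh0_in[of "M \<odot> N" ?A] Id_in[of "sh0 Sh (M \<odot> N)"]
    by (simp add: hom1_iff homs_iff)
qed

text \<open>The hexagon, solved for its middle factor; the inverse of a cyclicity map is a cyclicity map.\<close>
lemma cyc_hcomp_right':
  assumes [simp]: "M \<in> cells1 \<B>" "N \<in> cells1 \<B>" "P \<in> cells1 \<B>" "src \<B> N = trg \<B> M"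
    "src \<B> P = trg \<B> N" "src \<B> M = trg \<B> P"
  shows "cyc Sh M (N \<odot> P)
    = sh1 Sh (inv2 \<B> (assoc \<B> N P M)) \<bullet>\<^bsub>\<T>\<^esub> cyc Sh (P \<odot> M) N
      \<bullet>\<^bsub>\<T>\<^esub> sh1 Sh (inv2 \<B> (assoc \<B> P M N)) \<bullet>\<^bsub>\<T>\<^esub> cyc Sh (M \<odot> N) P
      \<bullet>\<^bsub>\<T>\<^esub> sh1 Sh (inv2 \<B> (assoc \<B> M N P))"
proof -
  note [simp] = sh1_cell cyc_cell sh1_id2
  have "sh1 Sh (inv2 \<B> (assoc \<B> P M N)) \<bullet>\<^bsub>\<T>\<^esub> cyc Sh (M \<odot> N) P \<bullet>\<^bsub>\<T>\<^esub> sh1 Sh (inv2 \<B> (assoc \<B> M N P))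
      = sh1 Sh (inv2 \<B> (assoc \<B> P M N)) \<bullet>\<^bsub>\<T>\<^esub> sh1 Sh (assoc \<B> P M N) \<bullet>\<^bsub>\<T>\<^esub> cyc Sh N (P \<odot> M)
        \<bullet>\<^bsub>\<T>\<^esub> sh1 Sh (assoc \<B> N P M) \<bullet>\<^bsub>\<T>\<^esub> cyc Sh M (N \<odot> P)
        \<bullet>\<^bsub>\<T>\<^esub> sh1 Sh (assoc \<B> M N P) \<bullet>\<^bsub>\<T>\<^esub> sh1 Sh (inv2 \<B> (assoc \<B> M N P))"
    by (subst cyc_hcomp) (auto simp: hom1_iff)
  also have "\<dots> = cyc Sh N (P \<odot> M) \<bullet>\<^bsub>\<T>\<^esub> sh1 Sh (assoc \<B> N P M) \<bullet>\<^bsub>\<T>\<^esub> cyc Sh M (N \<odot> P)"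
    by (simp add: sh1_prolong flip: sh1_comp')
  finally have "cyc Sh (P \<odot> M) N \<bullet>\<^bsub>\<T>\<^esub> sh1 Sh (inv2 \<B> (assoc \<B> P M N)) \<bullet>\<^bsub>\<T>\<^esub> cyc Sh (M \<odot> N) P
        \<bullet>\<^bsub>\<T>\<^esub> sh1 Sh (inv2 \<B> (assoc \<B> M N P))
      = cyc Sh (P \<odot> M) N \<bullet>\<^bsub>\<T>\<^esub> cyc Sh N (P \<odot> M) \<bullet>\<^bsub>\<T>\<^esub> sh1 Sh (assoc \<B> N P M) \<bullet>\<^bsub>\<T>\<^esub> cyc Sh M (N \<odot> P)"
    by simp
  also have "\<dots> = sh1 Sh (assoc \<B> N P M) \<bullet>\<^bsub>\<T>\<^esub> cyc Sh M (N \<odot> P)"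
    by (subst Comp_prolong[OF cyc_involution]) simp_all
  finally show ?thesis
    by (simp add: sh1_prolong)
qed

lemma cyc_unit':
  "\<lbrakk>M \<in> cells1 \<B>; trg \<B> M = R; src \<B> M = R\<rbrakk>
    \<Longrightarrow> sh1 Sh (lunit \<B> M) \<bullet>\<^bsub>\<T>\<^esub> cyc Sh M (unit1 \<B> R) = sh1 Sh (runit \<B> M)"
  using cyc_unit_right[of M R] by (simp add: hom1_iff)

sublocale weak_shadow \<B> \<T> Sh
  by unfold_locales
    (use sh0_in in \<open>auto simp: hom1_iff sh1_cell sh1_id2 sh1_comp' cyc_cell cyc_slide'
      intro: cyc_hcomp_right' cyc_unit'\<close>)

end

section \<open>The twisted shadow is a weak shadow\<close>

locale twisted_shadowed_bicategory =
  shadowed_bicategory \<B> \<T> Sh + twisted_bicategory G \<B> \<Theta>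
  for G :: "('g, 'e) monoid_scheme"
    and \<B> :: "('o, 'm, 'c) bicat" (structure)
    and \<Theta> :: "('g, 'o, 'm, 'c) twist_data"
    and \<T> :: "('x, 'a) cat"
    and Sh :: "('m, 'c, 'x, 'a) shadow_data" +
  fixes g :: 'g
  assumes g: "g \<in> carrier G"
begin

abbreviation gSh where "gSh \<equiv> twisted_shadow G \<B> \<Theta> \<T> Sh g"
abbreviation Th where "Th A \<equiv> Tw \<Theta> A (inv\<^bsub>G\<^esub> g)"

lemma inv_g [simp]: "inv\<^bsub>G\<^esub> g \<in> carrier G"
  using g by simp

text \<open>
  The 2-cell \<open>N \<odot> (\<Theta> \<odot> M) \<Rightarrow> \<Theta> \<odot> (N \<odot> M)\<close> that brings the twist back to the front after \<open>N\<close> has moved.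
  Each of the three laws of the twisted cyclicity map follows from the same law of the given one and
  its counterpart for this 2-cell: \<open>pull_unit\<close>, \<open>pull_hcomp\<close> and \<open>pull_natural\<close>.
\<close>
definition pull :: "('g, 'm, 'c) tw1 \<Rightarrow> 'm \<Rightarrow> 'c" where
  "pull Y M = assoc \<B> (Th (src \<B> (und1 Y))) (und1 Y) M \<cdot> (inv2 \<B> (tau Y (inv\<^bsub>G\<^esub> g)) \<triangleleft> M)
     \<cdot> inv2 \<B> (assoc \<B> (und1 Y) (Th (trg \<B> (und1 Y))) M)"

lemma pull_cell [simp]:
  assumes "twisted Y" "M \<in> cells1 \<B>" "src \<B> M = trg \<B> (und1 Y)"
  shows "pull Y M \<in> cells2 \<B>" "dom2 \<B> (pull Y M) = und1 Y \<odot> (Th (trg \<B> (und1 Y)) \<odot> M)"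
    "cod2 \<B> (pull Y M) = Th (src \<B> (und1 Y)) \<odot> (und1 Y \<odot> M)"
  using assms by (simp_all add: pull_def)

lemma twisted_shadow_sel [simp]:
  "sh0 gSh X = sh0 Sh (Th (src \<B> (und1 X)) \<odot> und1 X)"
  "sh1 gSh f = sh1 Sh (Th (src \<B> (und1 (tdom f))) \<triangleright> und2 f)"
  by (simp_all add: twisted_shadow_def)

lemma twisted_cyc_eq:
  assumes [simp]: "twisted X" "twisted Y" "src \<B> (und1 Y) = trg \<B> (und1 X)" "src \<B> (und1 X) = trg \<B> (und1 Y)"
  shows "cyc gSh X Y = sh1 Sh (pull Y (und1 X)) \<bullet>\<^bsub>\<T>\<^esub> cyc Sh (Th (src \<B> (und1 X)) \<odot> und1 X) (und1 Y)
    \<bullet>\<^bsub>\<T>\<^esub> sh1 Sh (inv2 \<B> (assoc \<B> (Th (src \<B> (und1 X))) (und1 X) (und1 Y)))"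
  by (simp add: twisted_shadow_def twisted_cyc_def Let_def transport_def pull_def sh1_vcomp)

lemma rep_inv_tau:
  assumes "twisted X" "h \<in> carrier G" "src \<B> (und1 X) = A" "trg \<B> (und1 X) = B" "und1 X = M"
  shows "rep (Cat (Atom M) (Atom (Tw \<Theta> B h))) (Cat (Atom (Tw \<Theta> A h)) (Atom M)) (inv2 \<B> (tau X h))
    (\<lambda>Z. inv2 \<B> (strict_tau X h Z))"
  by (rule rep_inv2(1)[OF rep_tau]) (use assms in simp_all)

lemma strict_tau_iso [simp]:
  assumes [simp]: "twisted X" "h \<in> carrier G" "Z \<in> cells1 \<B>" "src \<B> Z = trg \<B> (und1 X)"
  shows "iso2 \<B> (strict_tau X h Z)"
  by (rule rep_inv2(2)[OF rep_tau[OF assms(1,2) refl refl refl]]) simp_all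

lemma pull_unit:
  assumes [simp]: "M \<in> cells1 \<B>" "src \<B> M = R" "trg \<B> M = R" "R \<in> cells0 \<B>"
  shows "(Th R \<triangleright> lunit \<B> M) \<cdot> pull (twist_unit G \<B> \<Theta> R) M = lunit \<B> (Th R \<odot> M)"
proof -
  have "(Th R \<triangleright> lunit \<B> M) \<cdot> assoc \<B> (Th R) (unit1 \<B> R) M
      \<cdot> ((inv2 \<B> (runit \<B> (Th R)) \<cdot> lunit \<B> (Th R)) \<triangleleft> M) \<cdot> inv2 \<B> (assoc \<B> (unit1 \<B> R) (Th R) M)
    = lunit \<B> (Th R \<odot> M)"
    by (rule rep_eqI[where s = "Cat (Empty R) (Cat (Atom (Th R)) (Atom M))" and t = "Cat (Atom (Th R)) (Atom M)"],
        (rule rep_rules | (simp; fail))+)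
  then show ?thesis
    by (simp add: pull_def tau_unit)
qed

text \<open>
  The twist passes a composite by passing its factors in turn; this inverts the definition of \<open>\<tau> \<star> \<sigma>\<close>.
\<close>
lemma pull_hcomp:
  assumes Y [simp]: "twisted Y" and Z [simp]: "twisted Z"
    and [simp]: "M \<in> cells1 \<B>" "src \<B> (und1 Z) = trg \<B> (und1 Y)" "src \<B> M = trg \<B> (und1 Z)"
  shows "pull (twist_hcomp G \<B> \<Theta> Y Z) M
    = (Th (src \<B> (und1 Y)) \<triangleright> inv2 \<B> (assoc \<B> (und1 Y) (und1 Z) M)) \<cdot> pull Y (und1 Z \<odot> M)
      \<cdot> (und1 Y \<triangleright> pull Z M) \<cdot> assoc \<B> (und1 Y) (und1 Z) (Th (trg \<B> (und1 Z)) \<odot> M)"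
proof -
  let ?A = "src \<B> (und1 Y)" and ?B = "trg \<B> (und1 Y)" and ?C = "trg \<B> (und1 Z)"
  show ?thesis
    unfolding pull_def und1_hcomp tau_hcomp[OF inv_g]
    apply simp
    apply (rule rep_eqI[where s = "Cat (Cat (Atom (und1 Y)) (Atom (und1 Z))) (Cat (Atom (Th ?C)) (Atom M))"
        and t = "Cat (Atom (Th ?A)) (Cat (Cat (Atom (und1 Y)) (Atom (und1 Z))) (Atom M))"])
    apply (rule rep_rules rep_inv_tau[OF Y] rep_inv_tau[OF Z] | (simp; fail))+
    done
qed

lemma pull_natural:
  assumes k [simp]: "k \<in> twist_cells2 G \<B> \<Theta>" and Y: "tdom k = Y" "tcod k = Y'"
    and f [simp]: "f \<in> cells2 \<B>" "dom2 \<B> f = M" "cod2 \<B> f = M'" "src \<B> M = trg \<B> (und1 Y)"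
  shows "pull Y' M' \<cdot> (und2 k \<odot>\<odot> (Th (trg \<B> (und1 Y)) \<triangleright> f))
    = (Th (src \<B> (und1 Y)) \<triangleright> (und2 k \<odot>\<odot> f)) \<cdot> pull Y M"
proof -
  have [simp]: "twisted Y" "twisted Y'" "src \<B> (und1 Y') = src \<B> (und1 Y)" "trg \<B> (und1 Y') = trg \<B> (und1 Y)"
     "und2 k \<in> cells2 \<B>" "dom2 \<B> (und2 k) = und1 Y" "cod2 \<B> (und2 k) = und1 Y'"
    using twist_cells2D[OF k] unfolding Y by simp_all
  have [simp]: "M \<in> cells1 \<B>" "M' \<in> cells1 \<B>" "src \<B> M' = trg \<B> (und1 Y)" "trg \<B> M' = trg \<B> M"
    using dom2_closed[of f] cod2_closed[of f] src_cod2[of f] trg_cod2[of f] by simp_all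
  define f' where "f' = strict (Atom M) (Atom M') f"
  have f': "rep (Atom M) (Atom M') f f'"
    unfolding f'_def by (rule rep_strict) simp_all
  let ?A = "src \<B> (und1 Y)" and ?B = "trg \<B> (und1 Y)" and ?i = "inv\<^bsub>G\<^esub> g"
  note [simp] = rep_cell[OF rep_und2[OF k Y]] rep_cell[OF f']
  have strict_eq: "inv2 \<B> (strict_tau Y' ?i (M' \<odot> Z)) \<cdot> strict_und2 k (Th ?B \<odot> (M' \<odot> Z)) \<cdot> (und1 Y \<triangleright> Th ?B \<triangleright> f' Z)
      = (Th ?A \<triangleright> strict_und2 k (M' \<odot> Z)) \<cdot> (Th ?A \<triangleright> und1 Y \<triangleright> f' Z) \<cdot> inv2 \<B> (strict_tau Y ?i (M \<odot> Z))"
    if [simp]: "Z \<in> cells1 \<B>" "src \<B> Z = trg \<B> M" for Z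
  proof -
    have "strict_tau Y' ?i (M' \<odot> Z) \<cdot> ((Th ?A \<triangleright> strict_und2 k (M' \<odot> Z)) \<cdot> (Th ?A \<triangleright> und1 Y \<triangleright> f' Z) \<cdot> inv2 \<B> (strict_tau Y ?i (M \<odot> Z)))
      = strict_und2 k (Th ?B \<odot> (M' \<odot> Z)) \<cdot> (strict_tau Y ?i (M' \<odot> Z) \<cdot> (Th ?A \<triangleright> und1 Y \<triangleright> f' Z)) \<cdot> inv2 \<B> (strict_tau Y ?i (M \<odot> Z))"
      by (subst vcomp_prolong[OF strict_und2_tau[OF k Y]]) simp_all
    also have "strict_tau Y ?i (M' \<odot> Z) \<cdot> (Th ?A \<triangleright> und1 Y \<triangleright> f' Z) = (und1 Y \<triangleright> Th ?B \<triangleright> f' Z) \<cdot> strict_tau Y ?i (M \<odot> Z)"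
      using rep_natural[OF rep_tau[of Y ?i ?A ?B "und1 Y"], of "f' Z"] by simp
    also have "strict_und2 k (Th ?B \<odot> (M' \<odot> Z)) \<cdot> (\<dots>) \<cdot> inv2 \<B> (strict_tau Y ?i (M \<odot> Z))
      = strict_tau Y' ?i (M' \<odot> Z) \<cdot> (inv2 \<B> (strict_tau Y' ?i (M' \<odot> Z)) \<cdot> strict_und2 k (Th ?B \<odot> (M' \<odot> Z)) \<cdot> (und1 Y \<triangleright> Th ?B \<triangleright> f' Z))"
      by simp
    finally show ?thesis
      by (rule iso2_mono[of "strict_tau Y' ?i (M' \<odot> Z)", rotated -1, OF sym]) simp_all
  qed
  show ?thesis
    unfolding pull_def
    apply simp
    apply (rule rep_eqI[where s = "Cat (Atom (und1 Y)) (Cat (Atom (Th ?B)) (Atom M))"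
        and t = "Cat (Atom (Th ?A)) (Cat (Atom (und1 Y')) (Atom M'))"])
    apply (rule rep_rules rep_inv_tau[of Y] rep_inv_tau[of Y'] rep_und2[OF k Y] f' | (simp; fail))+
    apply (simp add: whisker_left_vcomp strict_eq)
    done
qed


lemma twisted_cyc_slide:
  assumes f [simp]: "f \<in> twist_cells2 G \<B> \<Theta>" and k [simp]: "k \<in> twist_cells2 G \<B> \<Theta>"
    and X: "tdom f = X" "tcod f = X'" and Y: "tdom k = Y" "tcod k = Y'"
    and XY [simp]: "src \<B> (und1 Y) = trg \<B> (und1 X)" "src \<B> (und1 X) = trg \<B> (und1 Y)"
  shows "cyc gSh X' Y' \<bullet>\<^bsub>\<T>\<^esub> sh1 Sh (Th (src \<B> (und1 X)) \<triangleright> (und2 f \<odot>\<odot> und2 k))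
    = sh1 Sh (Th (src \<B> (und1 Y)) \<triangleright> (und2 k \<odot>\<odot> und2 f)) \<bullet>\<^bsub>\<T>\<^esub> cyc gSh X Y"
proof -
  have [simp]: "twisted X" "twisted X'" "src \<B> (und1 X') = src \<B> (und1 X)" "trg \<B> (und1 X') = trg \<B> (und1 X)"
     "und2 f \<in> cells2 \<B>" "dom2 \<B> (und2 f) = und1 X" "cod2 \<B> (und2 f) = und1 X'"
    using twist_cells2D[OF f] unfolding X by simp_all
  have [simp]: "twisted Y" "twisted Y'" "src \<B> (und1 Y') = src \<B> (und1 Y)" "trg \<B> (und1 Y') = trg \<B> (und1 Y)"
     "und2 k \<in> cells2 \<B>" "dom2 \<B> (und2 k) = und1 Y" "cod2 \<B> (und2 k) = und1 Y'"
    using twist_cells2D[OF k] unfolding Y by simp_all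
  let ?A = "trg \<B> (und1 Y)" and ?B = "trg \<B> (und1 X)"
  let ?M = "und1 X" and ?M' = "und1 X'" and ?N = "und1 Y" and ?N' = "und1 Y'"
  have 1: "inv2 \<B> (assoc \<B> (Th ?A) ?M' ?N') \<cdot> (Th ?A \<triangleright> (und2 f \<odot>\<odot> und2 k))
      = ((Th ?A \<triangleright> und2 f) \<odot>\<odot> und2 k) \<cdot> inv2 \<B> (assoc \<B> (Th ?A) ?M ?N)"
  proof (rule iso2_mono[of "assoc \<B> (Th ?A) ?M' ?N'"])
    have "assoc \<B> (Th ?A) ?M' ?N' \<cdot> ((Th ?A \<triangleright> und2 f) \<odot>\<odot> und2 k) \<cdot> inv2 \<B> (assoc \<B> (Th ?A) ?M ?N)
        = ((Th ?A \<triangleright> (und2 f \<odot>\<odot> und2 k)) \<cdot> assoc \<B> (Th ?A) ?M ?N) \<cdot> inv2 \<B> (assoc \<B> (Th ?A) ?M ?N)"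
      using assoc_natural'[of "id2 \<B> (Th ?A)" "und2 f" "und2 k"] by (intro vcomp_prolong) simp_all
    then show "assoc \<B> (Th ?A) ?M' ?N' \<cdot> inv2 \<B> (assoc \<B> (Th ?A) ?M' ?N') \<cdot> (Th ?A \<triangleright> (und2 f \<odot>\<odot> und2 k))
      = assoc \<B> (Th ?A) ?M' ?N' \<cdot> ((Th ?A \<triangleright> und2 f) \<odot>\<odot> und2 k) \<cdot> inv2 \<B> (assoc \<B> (Th ?A) ?M ?N)"
      by simp
  qed simp_all
  have "cyc gSh X' Y' \<bullet>\<^bsub>\<T>\<^esub> sh1 Sh (Th ?A \<triangleright> (und2 f \<odot>\<odot> und2 k))
      = sh1 Sh (pull Y' ?M') \<bullet>\<^bsub>\<T>\<^esub> cyc Sh (Th ?A \<odot> ?M') ?N'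
        \<bullet>\<^bsub>\<T>\<^esub> sh1 Sh (inv2 \<B> (assoc \<B> (Th ?A) ?M' ?N') \<cdot> (Th ?A \<triangleright> (und2 f \<odot>\<odot> und2 k)))"
    by (simp add: twisted_cyc_eq sh1_vcomp)
  also have "\<dots> = sh1 Sh (pull Y' ?M') \<bullet>\<^bsub>\<T>\<^esub> (cyc Sh (Th ?A \<odot> ?M') ?N'
        \<bullet>\<^bsub>\<T>\<^esub> sh1 Sh ((Th ?A \<triangleright> und2 f) \<odot>\<odot> und2 k)) \<bullet>\<^bsub>\<T>\<^esub> sh1 Sh (inv2 \<B> (assoc \<B> (Th ?A) ?M ?N))"
    by (subst 1) (simp add: sh1_vcomp)
  also have "cyc Sh (Th ?A \<odot> ?M') ?N' \<bullet>\<^bsub>\<T>\<^esub> sh1 Sh ((Th ?A \<triangleright> und2 f) \<odot>\<odot> und2 k)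
      = sh1 Sh (und2 k \<odot>\<odot> (Th ?A \<triangleright> und2 f)) \<bullet>\<^bsub>\<T>\<^esub> cyc Sh (Th ?A \<odot> ?M) ?N"
    using cyc_slide[of "Th ?A \<triangleright> und2 f" "und2 k"] by simp
  also have "sh1 Sh (pull Y' ?M') \<bullet>\<^bsub>\<T>\<^esub> (\<dots>) \<bullet>\<^bsub>\<T>\<^esub> sh1 Sh (inv2 \<B> (assoc \<B> (Th ?A) ?M ?N))
      = sh1 Sh (pull Y' ?M' \<cdot> (und2 k \<odot>\<odot> (Th ?A \<triangleright> und2 f))) \<bullet>\<^bsub>\<T>\<^esub> cyc Sh (Th ?A \<odot> ?M) ?N
        \<bullet>\<^bsub>\<T>\<^esub> sh1 Sh (inv2 \<B> (assoc \<B> (Th ?A) ?M ?N))"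
    by (simp add: sh1_vcomp)
  also have "pull Y' ?M' \<cdot> (und2 k \<odot>\<odot> (Th ?A \<triangleright> und2 f)) = (Th ?B \<triangleright> (und2 k \<odot>\<odot> und2 f)) \<cdot> pull Y ?M"
    using pull_natural[OF k Y, of "und2 f" ?M ?M'] by simp
  finally show ?thesis
    by (simp add: twisted_cyc_eq sh1_vcomp)
qed

lemma twisted_cyc_unit:
  assumes [simp]: "twisted X" "src \<B> (und1 X) = R" "trg \<B> (und1 X) = R"
  shows "sh1 Sh (Th R \<triangleright> lunit \<B> (und1 X)) \<bullet>\<^bsub>\<T>\<^esub> cyc gSh X (twist_unit G \<B> \<Theta> R) = sh1 Sh (Th R \<triangleright> runit \<B> (und1 X))"
proof -
  let ?M = "und1 X"
  have [simp]: "R \<in> cells0 \<B>"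
    using src_closed[of ?M] by simp
  have 1: "runit \<B> (Th R \<odot> ?M) \<cdot> inv2 \<B> (assoc \<B> (Th R) ?M (unit1 \<B> R)) = Th R \<triangleright> runit \<B> ?M"
    by (rule rep_eqI[where s = "Cat (Atom (Th R)) (Cat (Atom ?M) (Empty R))" and t = "Cat (Atom (Th R)) (Atom ?M)"],
        (rule rep_rules | (simp; fail))+)
  have "sh1 Sh (Th R \<triangleright> lunit \<B> ?M) \<bullet>\<^bsub>\<T>\<^esub> cyc gSh X (twist_unit G \<B> \<Theta> R)
      = sh1 Sh ((Th R \<triangleright> lunit \<B> ?M) \<cdot> pull (twist_unit G \<B> \<Theta> R) ?M) \<bullet>\<^bsub>\<T>\<^esub> cyc Sh (Th R \<odot> ?M) (unit1 \<B> R)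
        \<bullet>\<^bsub>\<T>\<^esub> sh1 Sh (inv2 \<B> (assoc \<B> (Th R) ?M (unit1 \<B> R)))"
    by (simp add: twisted_cyc_eq twisted_unit sh1_vcomp)
  also have "\<dots> = (sh1 Sh (lunit \<B> (Th R \<odot> ?M)) \<bullet>\<^bsub>\<T>\<^esub> cyc Sh (Th R \<odot> ?M) (unit1 \<B> R))
        \<bullet>\<^bsub>\<T>\<^esub> sh1 Sh (inv2 \<B> (assoc \<B> (Th R) ?M (unit1 \<B> R)))"
    by (simp add: pull_unit)
  also have "sh1 Sh (lunit \<B> (Th R \<odot> ?M)) \<bullet>\<^bsub>\<T>\<^esub> cyc Sh (Th R \<odot> ?M) (unit1 \<B> R) = sh1 Sh (runit \<B> (Th R \<odot> ?M))"
    by (rule cyc_unit) simp_all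
  finally show ?thesis
    by (simp add: 1 flip: sh1_vcomp)
qed

text \<open>
  The right-hand side moves \<open>Z\<close> and then \<open>Y\<close>, and the twist passes \<open>Z\<close> and then \<open>Y\<close>. By naturality,
  the passage of the twist past \<open>Z\<close> is postponed until \<open>Y\<close> has moved. Then the two moves merge by the
  law of the given shadow, and the two passages merge by \<open>pull_hcomp\<close>.
\<close>
lemma twisted_cyc_hcomp_right:
  assumes X [simp]: "twisted X" and Y [simp]: "twisted Y" and Z [simp]: "twisted Z"
    and src [simp]: "src \<B> (und1 Y) = trg \<B> (und1 X)" "src \<B> (und1 Z) = trg \<B> (und1 Y)" "src \<B> (und1 X) = trg \<B> (und1 Z)"
  shows "cyc gSh X (twist_hcomp G \<B> \<Theta> Y Z)
    = sh1 Sh (Th (src \<B> (und1 Y)) \<triangleright> inv2 \<B> (assoc \<B> (und1 Y) (und1 Z) (und1 X)))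
      \<bullet>\<^bsub>\<T>\<^esub> cyc gSh (twist_hcomp G \<B> \<Theta> Z X) Y
      \<bullet>\<^bsub>\<T>\<^esub> sh1 Sh (Th (src \<B> (und1 Z)) \<triangleright> inv2 \<B> (assoc \<B> (und1 Z) (und1 X) (und1 Y)))
      \<bullet>\<^bsub>\<T>\<^esub> cyc gSh (twist_hcomp G \<B> \<Theta> X Y) Z
      \<bullet>\<^bsub>\<T>\<^esub> sh1 Sh (Th (src \<B> (und1 X)) \<triangleright> inv2 \<B> (assoc \<B> (und1 X) (und1 Y) (und1 Z)))"
proof -
  let ?M = "und1 X" and ?N = "und1 Y" and ?P = "und1 Z"
  let ?\<Theta>A = "Th (trg \<B> ?P)" and ?\<Theta>B = "Th (trg \<B> ?M)" and ?\<Theta>C = "Th (trg \<B> ?N)"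
  let ?v = "assoc \<B> ?\<Theta>A ?M ?N"
  let ?a = "Atom ?M" and ?b = "Atom ?N" and ?c = "Atom ?P" and ?tA = "Atom ?\<Theta>A" and ?tC = "Atom ?\<Theta>C" and ?tB = "Atom ?\<Theta>B"
  have 1: "inv2 \<B> (assoc \<B> ?\<Theta>A (?M \<odot> ?N) ?P) \<cdot> (?\<Theta>A \<triangleright> inv2 \<B> (assoc \<B> ?M ?N ?P))
      = (?v \<triangleleft> ?P) \<cdot> inv2 \<B> (assoc \<B> (?\<Theta>A \<odot> ?M) ?N ?P) \<cdot> inv2 \<B> (assoc \<B> ?\<Theta>A ?M (?N \<odot> ?P))"
    by (rule rep_eqI[where s = "Cat ?tA (Cat ?a (Cat ?b ?c))" and t = "Cat (Cat ?tA (Cat ?a ?b)) ?c"],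
        (rule rep_rules | (simp; fail))+)
  have 2: "inv2 \<B> (assoc \<B> ?\<Theta>C (?P \<odot> ?M) ?N) \<cdot> (?\<Theta>C \<triangleright> inv2 \<B> (assoc \<B> ?P ?M ?N))
        \<cdot> pull Z (?M \<odot> ?N) \<cdot> (?P \<triangleright> ?v)
      = (pull Z ?M \<triangleleft> ?N) \<cdot> inv2 \<B> (assoc \<B> ?P (?\<Theta>A \<odot> ?M) ?N)"
    unfolding pull_def
    apply simp
    apply (rule rep_eqI[where s = "Cat ?c (Cat (Cat ?tA ?a) ?b)" and t = "Cat (Cat ?tC (Cat ?c ?a)) ?b"])
    apply (rule rep_rules rep_inv_tau[OF Z] | (simp; fail))+
    done
  have lhs: "cyc gSh X (twist_hcomp G \<B> \<Theta> Y Z)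
    = sh1 Sh (pull (twist_hcomp G \<B> \<Theta> Y Z) ?M) \<bullet>\<^bsub>\<T>\<^esub> cyc Sh (?\<Theta>A \<odot> ?M) (?N \<odot> ?P) \<bullet>\<^bsub>\<T>\<^esub> sh1 Sh (inv2 \<B> (assoc \<B> ?\<Theta>A ?M (?N \<odot> ?P)))"
    by (simp add: twisted_cyc_eq twisted_hcomp)
  let ?end = "sh1 Sh (inv2 \<B> (assoc \<B> (?\<Theta>A \<odot> ?M) ?N ?P)) \<bullet>\<^bsub>\<T>\<^esub> sh1 Sh (inv2 \<B> (assoc \<B> ?\<Theta>A ?M (?N \<odot> ?P)))"
  have "cyc gSh (twist_hcomp G \<B> \<Theta> X Y) Z \<bullet>\<^bsub>\<T>\<^esub> sh1 Sh (?\<Theta>A \<triangleright> inv2 \<B> (assoc \<B> ?M ?N ?P))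
      = sh1 Sh (pull Z (?M \<odot> ?N)) \<bullet>\<^bsub>\<T>\<^esub> cyc Sh (?\<Theta>A \<odot> (?M \<odot> ?N)) ?P
        \<bullet>\<^bsub>\<T>\<^esub> sh1 Sh (inv2 \<B> (assoc \<B> ?\<Theta>A (?M \<odot> ?N) ?P) \<cdot> (?\<Theta>A \<triangleright> inv2 \<B> (assoc \<B> ?M ?N ?P)))"
    by (simp add: twisted_cyc_eq twisted_hcomp sh1_vcomp)
  also have "\<dots> = sh1 Sh (pull Z (?M \<odot> ?N)) \<bullet>\<^bsub>\<T>\<^esub> (cyc Sh (?\<Theta>A \<odot> (?M \<odot> ?N)) ?P \<bullet>\<^bsub>\<T>\<^esub> sh1 Sh (?v \<triangleleft> ?P)) \<bullet>\<^bsub>\<T>\<^esub> ?end"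
    by (subst 1) (simp add: sh1_vcomp)
  also have "cyc Sh (?\<Theta>A \<odot> (?M \<odot> ?N)) ?P \<bullet>\<^bsub>\<T>\<^esub> sh1 Sh (?v \<triangleleft> ?P) = sh1 Sh (?P \<triangleright> ?v) \<bullet>\<^bsub>\<T>\<^esub> cyc Sh ((?\<Theta>A \<odot> ?M) \<odot> ?N) ?P"
    using cyc_slide[of ?v "id2 \<B> ?P"] by simp
  finally have first: "cyc gSh (twist_hcomp G \<B> \<Theta> X Y) Z \<bullet>\<^bsub>\<T>\<^esub> sh1 Sh (?\<Theta>A \<triangleright> inv2 \<B> (assoc \<B> ?M ?N ?P))
      = sh1 Sh (pull Z (?M \<odot> ?N)) \<bullet>\<^bsub>\<T>\<^esub> sh1 Sh (?P \<triangleright> ?v) \<bullet>\<^bsub>\<T>\<^esub> cyc Sh ((?\<Theta>A \<odot> ?M) \<odot> ?N) ?P \<bullet>\<^bsub>\<T>\<^esub> ?end"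
    by simp
  have "cyc gSh (twist_hcomp G \<B> \<Theta> Z X) Y \<bullet>\<^bsub>\<T>\<^esub> sh1 Sh (?\<Theta>C \<triangleright> inv2 \<B> (assoc \<B> ?P ?M ?N))
        \<bullet>\<^bsub>\<T>\<^esub> sh1 Sh (pull Z (?M \<odot> ?N)) \<bullet>\<^bsub>\<T>\<^esub> sh1 Sh (?P \<triangleright> ?v)
      = sh1 Sh (pull Y (?P \<odot> ?M)) \<bullet>\<^bsub>\<T>\<^esub> cyc Sh (?\<Theta>C \<odot> (?P \<odot> ?M)) ?N
        \<bullet>\<^bsub>\<T>\<^esub> sh1 Sh (inv2 \<B> (assoc \<B> ?\<Theta>C (?P \<odot> ?M) ?N) \<cdot> (?\<Theta>C \<triangleright> inv2 \<B> (assoc \<B> ?P ?M ?N)) \<cdot> pull Z (?M \<odot> ?N) \<cdot> (?P \<triangleright> ?v))"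
    by (simp add: twisted_cyc_eq twisted_hcomp sh1_vcomp)
  also have "\<dots> = sh1 Sh (pull Y (?P \<odot> ?M)) \<bullet>\<^bsub>\<T>\<^esub> (cyc Sh (?\<Theta>C \<odot> (?P \<odot> ?M)) ?N
        \<bullet>\<^bsub>\<T>\<^esub> sh1 Sh (pull Z ?M \<triangleleft> ?N)) \<bullet>\<^bsub>\<T>\<^esub> sh1 Sh (inv2 \<B> (assoc \<B> ?P (?\<Theta>A \<odot> ?M) ?N))"
    by (subst 2) (simp add: sh1_vcomp)
  also have "cyc Sh (?\<Theta>C \<odot> (?P \<odot> ?M)) ?N \<bullet>\<^bsub>\<T>\<^esub> sh1 Sh (pull Z ?M \<triangleleft> ?N) = sh1 Sh (?N \<triangleright> pull Z ?M) \<bullet>\<^bsub>\<T>\<^esub> cyc Sh (?P \<odot> (?\<Theta>A \<odot> ?M)) ?N"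
    using cyc_slide[of "pull Z ?M" "id2 \<B> ?N"] by simp
  finally have second: "cyc gSh (twist_hcomp G \<B> \<Theta> Z X) Y \<bullet>\<^bsub>\<T>\<^esub> sh1 Sh (?\<Theta>C \<triangleright> inv2 \<B> (assoc \<B> ?P ?M ?N))
        \<bullet>\<^bsub>\<T>\<^esub> sh1 Sh (pull Z (?M \<odot> ?N)) \<bullet>\<^bsub>\<T>\<^esub> sh1 Sh (?P \<triangleright> ?v)
      = sh1 Sh (pull Y (?P \<odot> ?M)) \<bullet>\<^bsub>\<T>\<^esub> sh1 Sh (?N \<triangleright> pull Z ?M) \<bullet>\<^bsub>\<T>\<^esub> cyc Sh (?P \<odot> (?\<Theta>A \<odot> ?M)) ?N
        \<bullet>\<^bsub>\<T>\<^esub> sh1 Sh (inv2 \<B> (assoc \<B> ?P (?\<Theta>A \<odot> ?M) ?N))"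
    by simp
  let ?rest = "cyc Sh ((?\<Theta>A \<odot> ?M) \<odot> ?N) ?P \<bullet>\<^bsub>\<T>\<^esub> ?end"
  have cells: "cyc gSh (twist_hcomp G \<B> \<Theta> Z X) Y \<in> arrs \<T>"
    "Dom \<T> (cyc gSh (twist_hcomp G \<B> \<Theta> Z X) Y) = sh0 Sh (?\<Theta>C \<odot> ((?P \<odot> ?M) \<odot> ?N))"
    "Cod \<T> (cyc gSh (twist_hcomp G \<B> \<Theta> Z X) Y) = sh0 Sh (?\<Theta>B \<odot> (?N \<odot> (?P \<odot> ?M)))"
    by (simp_all add: twisted_cyc_eq twisted_hcomp)
  have "sh1 Sh (Th (src \<B> ?N) \<triangleright> inv2 \<B> (assoc \<B> ?N ?P ?M))
      \<bullet>\<^bsub>\<T>\<^esub> cyc gSh (twist_hcomp G \<B> \<Theta> Z X) Y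
      \<bullet>\<^bsub>\<T>\<^esub> sh1 Sh (Th (src \<B> ?P) \<triangleright> inv2 \<B> (assoc \<B> ?P ?M ?N))
      \<bullet>\<^bsub>\<T>\<^esub> cyc gSh (twist_hcomp G \<B> \<Theta> X Y) Z
      \<bullet>\<^bsub>\<T>\<^esub> sh1 Sh (Th (src \<B> ?M) \<triangleright> inv2 \<B> (assoc \<B> ?M ?N ?P))
    = sh1 Sh (?\<Theta>B \<triangleright> inv2 \<B> (assoc \<B> ?N ?P ?M))
      \<bullet>\<^bsub>\<T>\<^esub> (cyc gSh (twist_hcomp G \<B> \<Theta> Z X) Y
        \<bullet>\<^bsub>\<T>\<^esub> sh1 Sh (?\<Theta>C \<triangleright> inv2 \<B> (assoc \<B> ?P ?M ?N))
        \<bullet>\<^bsub>\<T>\<^esub> sh1 Sh (pull Z (?M \<odot> ?N)) \<bullet>\<^bsub>\<T>\<^esub> sh1 Sh (?P \<triangleright> ?v)) \<bullet>\<^bsub>\<T>\<^esub> ?rest"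
    by (simp add: first cells)
  also have "\<dots> = sh1 Sh ((?\<Theta>B \<triangleright> inv2 \<B> (assoc \<B> ?N ?P ?M)) \<cdot> pull Y (?P \<odot> ?M) \<cdot> (?N \<triangleright> pull Z ?M)
        \<cdot> assoc \<B> ?N ?P (?\<Theta>A \<odot> ?M)) \<bullet>\<^bsub>\<T>\<^esub> sh1 Sh (inv2 \<B> (assoc \<B> ?N ?P (?\<Theta>A \<odot> ?M)))
      \<bullet>\<^bsub>\<T>\<^esub> cyc Sh (?P \<odot> (?\<Theta>A \<odot> ?M)) ?N \<bullet>\<^bsub>\<T>\<^esub> sh1 Sh (inv2 \<B> (assoc \<B> ?P (?\<Theta>A \<odot> ?M) ?N)) \<bullet>\<^bsub>\<T>\<^esub> ?rest"
    unfolding second by (simp add: sh1_vcomp_prolong)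
  also have "\<dots> = sh1 Sh (pull (twist_hcomp G \<B> \<Theta> Y Z) ?M) \<bullet>\<^bsub>\<T>\<^esub> cyc Sh (?\<Theta>A \<odot> ?M) (?N \<odot> ?P)
      \<bullet>\<^bsub>\<T>\<^esub> sh1 Sh (inv2 \<B> (assoc \<B> ?\<Theta>A ?M (?N \<odot> ?P)))"
    using pull_hcomp[OF Y Z, of ?M] by (simp add: cyc_hcomp_right[of "?\<Theta>A \<odot> ?M" ?N ?P])
  finally show ?thesis
    unfolding lhs by simp
qed


lemma weak_shadow_twisted: "weak_shadow \<C> \<T> gSh"
proof -
  interpret C: bicategory \<C>
    by (rule bicategory_twist_bicat)
  show ?thesis
  proof
    show "sh0 gSh M \<in> objs \<T>" if "M \<in> cells1 \<C>" "src \<C> M = trg \<C> M" for M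
      using that by (simp add: sh0_obj)
    show "sh1 gSh f \<in> arrs \<T>" "Dom \<T> (sh1 gSh f) = sh0 gSh (dom2 \<C> f)" "Cod \<T> (sh1 gSh f) = sh0 gSh (cod2 \<C> f)"
      if "f \<in> cells2 \<C>" "src \<C> (dom2 \<C> f) = trg \<C> (dom2 \<C> f)" for f
      using that by simp_all
    show "sh1 gSh (id2 \<C> M) = Id \<T> (sh0 gSh M)" if "M \<in> cells1 \<C>" "src \<C> M = trg \<C> M" for M
      using that by simp
    show "sh1 gSh (vcomp \<C> k f) = sh1 gSh k \<bullet>\<^bsub>\<T>\<^esub> sh1 gSh f"
      if "f \<in> cells2 \<C>" "k \<in> cells2 \<C>" "dom2 \<C> k = cod2 \<C> f" "src \<C> (dom2 \<C> f) = trg \<C> (dom2 \<C> f)" for f k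
      using that by (simp add: whisker_left_vcomp sh1_vcomp)
    show "cyc gSh M N \<in> arrs \<T>" "Dom \<T> (cyc gSh M N) = sh0 gSh (hcomp1 \<C> M N)"
      "Cod \<T> (cyc gSh M N) = sh0 gSh (hcomp1 \<C> N M)"
      if "M \<in> cells1 \<C>" "N \<in> cells1 \<C>" "src \<C> N = trg \<C> M" "src \<C> M = trg \<C> N" for M N
      using that by (simp_all add: twisted_cyc_eq)
    show "cyc gSh (cod2 \<C> f) (cod2 \<C> k) \<bullet>\<^bsub>\<T>\<^esub> sh1 gSh (hcomp2 \<C> f k)
        = sh1 gSh (hcomp2 \<C> k f) \<bullet>\<^bsub>\<T>\<^esub> cyc gSh (dom2 \<C> f) (dom2 \<C> k)"
      if "f \<in> cells2 \<C>" "k \<in> cells2 \<C>" "src \<C> (dom2 \<C> k) = trg \<C> (dom2 \<C> f)"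
        "src \<C> (dom2 \<C> f) = trg \<C> (dom2 \<C> k)" for f k
      using twisted_cyc_slide[OF _ _ refl refl refl refl, of f k] that by simp
    show "cyc gSh M (hcomp1 \<C> N P)
        = sh1 gSh (inv2 \<C> (assoc \<C> N P M)) \<bullet>\<^bsub>\<T>\<^esub> cyc gSh (hcomp1 \<C> P M) N
          \<bullet>\<^bsub>\<T>\<^esub> sh1 gSh (inv2 \<C> (assoc \<C> P M N)) \<bullet>\<^bsub>\<T>\<^esub> cyc gSh (hcomp1 \<C> M N) P
          \<bullet>\<^bsub>\<T>\<^esub> sh1 gSh (inv2 \<C> (assoc \<C> M N P))"
      if M: "M \<in> cells1 \<C>" "N \<in> cells1 \<C>" "P \<in> cells1 \<C>" "src \<C> N = trg \<C> M"
        "src \<C> P = trg \<C> N" "src \<C> M = trg \<C> P" for M N P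
    proof -
      have inv: "sh1 gSh (inv2 \<C> (assoc \<C> X Y Z))
          = sh1 Sh (Th (src \<B> (und1 X)) \<triangleright> inv2 \<B> (assoc \<B> (und1 X) (und1 Y) (und1 Z)))"
        if "twisted X" "twisted Y" "twisted Z" "src \<B> (und1 Y) = trg \<B> (und1 X)"
          "src \<B> (und1 Z) = trg \<B> (und1 Y)" for X Y Z
        using twist_assoc_cell[OF that] iso2_twist(2)[of "assoc \<C> X Y Z"] that by simp
      show ?thesis
        using M twisted_cyc_hcomp_right[of M N P] inv[of N P M] inv[of P M N] inv[of M N P]
        by (simp del: twist_bicat_sel(13) twisted_shadow_sel)
    qed
    show "sh1 gSh (lunit \<C> M) \<bullet>\<^bsub>\<T>\<^esub> cyc gSh M (unit1 \<C> R) = sh1 gSh (runit \<C> M)"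
      if "M \<in> cells1 \<C>" "trg \<C> M = R" "src \<C> M = R" for M R
      using that twisted_cyc_unit[of M R] src_closed[of "und1 M"] by simp
  qed
qed

end

section \<open>Cyclicity of the twisted trace\<close>

lemma twisted_trace_eq_trace:
  "twisted_trace G \<B> \<Theta> \<T> Sh g M D \<eta> \<epsilon> X Y f
    = trace (twist_bicat G \<B> \<Theta>) \<T> (twisted_shadow G \<B> \<Theta> \<T> Sh g) M D \<eta> \<epsilon> X Y f"
  by (simp add: twisted_trace_def trace_def Let_def)

theorem proposition6p3:
  fixes G :: "('g, 'e) monoid_scheme"
    and \<B> :: "('o, 'm, 'c) bicat"
    and \<T> :: "('x, 'a) cat"
    and Sh :: "('m, 'c, 'x, 'a) shadow_data"
    and \<Theta> :: "('g, 'o, 'm, 'c) twist_data"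
    and \<C> :: "('o, ('g, 'm, 'c) tw1, ('g, 'm, 'c) tw2) bicat"
    and g :: 'g
    and R S T U :: 'o
    and M M' N N' Q P K L :: "('g, 'm, 'c) tw1"
    and \<eta>M \<epsilon>M \<eta>N \<epsilon>N f h F H :: "('g, 'm, 'c) tw2"
  assumes "group G" and "g \<in> carrier G"
    and "shadowed_bicategory \<B> \<T> Sh"
    and "twisted_bicategory G \<B> \<Theta>"
    and "\<C> = twist_bicat G \<B> \<Theta>"
    and "M \<in> hom1 \<C> R S" and "left_dual \<C> M M' \<eta>M \<epsilon>M"
    and "N \<in> hom1 \<C> U T" and "left_dual \<C> N N' \<eta>N \<epsilon>N"
    and "Q \<in> hom1 \<C> S T" and "P \<in> hom1 \<C> R U"
    and "K \<in> hom1 \<C> T S" and "L \<in> hom1 \<C> U R"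
    and "f \<in> hom2 \<C> (M \<odot>\<^bsub>\<C>\<^esub> Q) (P \<odot>\<^bsub>\<C>\<^esub> N)"
    and "h \<in> hom2 \<C> (N \<odot>\<^bsub>\<C>\<^esub> K) (L \<odot>\<^bsub>\<C>\<^esub> M)"
    and "F = inv2 \<C> (assoc \<C> L P N) \<cdot>\<^bsub>\<C>\<^esub> (id2 \<C> L \<odot>\<odot>\<^bsub>\<C>\<^esub> f) \<cdot>\<^bsub>\<C>\<^esub> assoc \<C> L M Q
             \<cdot>\<^bsub>\<C>\<^esub> (h \<odot>\<odot>\<^bsub>\<C>\<^esub> id2 \<C> Q) \<cdot>\<^bsub>\<C>\<^esub> inv2 \<C> (assoc \<C> N K Q)"
    and "H = inv2 \<C> (assoc \<C> P L M) \<cdot>\<^bsub>\<C>\<^esub> (id2 \<C> P \<odot>\<odot>\<^bsub>\<C>\<^esub> h) \<cdot>\<^bsub>\<C>\<^esub> assoc \<C> P N K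
             \<cdot>\<^bsub>\<C>\<^esub> (f \<odot>\<odot>\<^bsub>\<C>\<^esub> id2 \<C> K) \<cdot>\<^bsub>\<C>\<^esub> inv2 \<C> (assoc \<C> M Q K)"
  shows "twisted_cyc G \<B> \<Theta> \<T> Sh g L P
           \<bullet>\<^bsub>\<T>\<^esub> twisted_trace G \<B> \<Theta> \<T> Sh g N N' \<eta>N \<epsilon>N (K \<odot>\<^bsub>\<C>\<^esub> Q) (L \<odot>\<^bsub>\<C>\<^esub> P) F
         = twisted_trace G \<B> \<Theta> \<T> Sh g M M' \<eta>M \<epsilon>M (Q \<odot>\<^bsub>\<C>\<^esub> K) (P \<odot>\<^bsub>\<C>\<^esub> L) H
           \<bullet>\<^bsub>\<T>\<^esub> twisted_cyc G \<B> \<Theta> \<T> Sh g K Q"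
proof -
  have "twisted_shadowed_bicategory G \<B> \<Theta> \<T> Sh g"
    using assms(2-4) by (simp add: twisted_shadowed_bicategory_def twisted_shadowed_bicategory_axioms_def)
  then have "weak_shadow \<C> \<T> (twisted_shadow G \<B> \<Theta> \<T> Sh g)"
    unfolding assms(5) by (rule twisted_shadowed_bicategory.weak_shadow_twisted)
  from weak_shadow.trace_cyclic[OF this assms(6-17)] show ?thesis
    unfolding twisted_trace_eq_trace assms(5) by (simp add: twisted_shadow_def)
qed

end
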